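(* Let $\alpha$ and $\beta$ be $E_0$-semigroups on a $\mathrm{II}_1$ factor $\mathrm{M}$ such that both $\mathcal{A}_\alpha$ and $\mathcal{A}_\beta$ are ultraweakly dense in $\mathrm{M}$. Then $\alpha$ is cocycle conjugate to $\beta$ if and only if $\alpha$ is conjugate to $\beta$.
   Context: An $E_0$-semigroup on a von Neumann algebra $\mathrm{M}$ is a semigroup $(\alpha_t)_{t\ge 0}$ of normal unital $*$-endomorphisms of $\mathrm{M}$ with $\alpha_0=\mathrm{id}$, $\alpha_t(\mathrm{M})\ne \mathrm{M}$ for all $t>0$, and $t\mapsto\rho(\alpha_t(x))$ continuous for all $x\in\mathrm{M}$, $\rho\in\mathrm{M}_*$. A cocycle for $\alpha$ is a strongly continuous family of unitaries $(U_t)_{t\ge0}$ in $\mathrm{M}$ with $U_s\alpha_s(U_t)=U_{s+t}$ for all $s,t\ge 0$; then $\alpha^U_t(x)=U_t\alpha_t(x)U_t^*$ is an $E_0$-semigroup. $\alpha$ on $\mathrm{M}$ and $\beta$ on $\mathrm{N}$ are conjugate if there is a $*$-isomorphism $\theta:\mathrm{M}\to\mathrm{N}$ with $\beta_t=\theta\circ\alpha_t\circ\theta^{-1}$ for all $t$, and cocycle conjugate if $\beta$ is conjugate to $\alpha^U$ for some cocycle $U$ for $\alpha$. For an $E_0$-semigroup $\alpha$ on $\mathrm{M}$, $\mathcal{A}_\alpha$ denotes the norm closure of $\bigcup_{t\ge0}(\alpha_t(\mathrm{M})'\cap\mathrm{M})$. *)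

theory Defs
  imports "HOL-Analysis.Analysis"
begin

section \<open>Complex Hilbert spaces and their bounded operators\<close>

text \<open>
  A complex Hilbert space is a complete real inner product space carrying a compatible complex
  structure; its real inner product is the real part of the complex one. The complex inner product
  is linear in the second argument.
\<close>

class complex_hilbert_space = real_inner + complete_space +
  fixes scaleC :: "complex \<Rightarrow> 'a \<Rightarrow> 'a" (infixr "*\<^sub>C" 75)
    and cinner :: "'a \<Rightarrow> 'a \<Rightarrow> complex"
  assumes scaleC_add_right: "a *\<^sub>C (x + y) = a *\<^sub>C x + a *\<^sub>C y"
    and scaleC_add_left: "(a + b) *\<^sub>C x = a *\<^sub>C x + b *\<^sub>C x"
    and scaleC_scaleC: "a *\<^sub>C b *\<^sub>C x = (a * b) *\<^sub>C x"
    and scaleR_scaleC: "r *\<^sub>R x = complex_of_real r *\<^sub>C x"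
    and cinner_commute: "cinner x y = cnj (cinner y x)"
    and cinner_add_right: "cinner x (y + z) = cinner x y + cinner x z"
    and cinner_scaleC_right: "cinner x (a *\<^sub>C y) = a * cinner x y"
    and inner_eq_Re_cinner: "inner x y = Re (cinner x y)"
begin

lemma cinner_scaleC_left: "cinner (a *\<^sub>C x) y = cnj a * cinner x y"
  using cinner_commute[of "a *\<^sub>C x" y] cinner_commute[of x y]
  by (simp add: cinner_scaleC_right)

end

instantiation complex :: complex_hilbert_space
begin

definition "scaleC a (x::complex) = a * x"
definition "cinner x (y::complex) = cnj x * y"

instance
  by standard
    (auto simp: scaleC_complex_def cinner_complex_def inner_complex_def algebra_simps
       scaleR_conv_of_real)

end

lemma cinner_self: "cinner x x = complex_of_real ((norm x)\<^sup>2)"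
  for x :: "'a::complex_hilbert_space"
proof (rule complex_eqI)
  show "Re (cinner x x) = Re (complex_of_real ((norm x)\<^sup>2))"
    by (simp add: power2_norm_eq_inner inner_eq_Re_cinner)
  show "Im (cinner x x) = Im (complex_of_real ((norm x)\<^sup>2))"
    using arg_cong[OF cinner_commute[of x x], of Im] by simp
qed

lemma norm_scaleC: "norm (a *\<^sub>C x) = cmod a * norm x"
  for x :: "'a::complex_hilbert_space"
proof -
  have "complex_of_real ((norm (a *\<^sub>C x))\<^sup>2) = a * cnj a * cinner x x"
    unfolding cinner_self[symmetric] by (simp add: cinner_scaleC_left cinner_scaleC_right)
  also have "\<dots> = complex_of_real ((cmod a * norm x)\<^sup>2)"
    by (simp add: cinner_self complex_norm_square[symmetric] power_mult_distrib)
  finally have "(norm (a *\<^sub>C x))\<^sup>2 = (cmod a * norm x)\<^sup>2"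
    using of_real_eq_iff by blast
  then show ?thesis
    by (simp add: power2_eq_iff_nonneg)
qed

lemma bounded_linear_scaleC: "bounded_linear (\<lambda>x::'a::complex_hilbert_space. a *\<^sub>C x)"
  by (rule bounded_linear_intro[where K = "cmod a"])
    (auto simp: scaleC_add_right scaleR_scaleC scaleC_scaleC norm_scaleC mult.commute)

type_synonym 'h operator = "'h \<Rightarrow>\<^sub>L 'h"

text \<open>
  Bounded operators are the complex linear elements of the library type of bounded real linear
  maps, which supplies the vector space structure, the operator norm and the composition
  \<open>o\<^sub>L\<close>.
\<close>

definition bounded_operators :: "'h::complex_hilbert_space operator set" where
  "bounded_operators = {T. \<forall>c x. blinfun_apply T (c *\<^sub>C x) = c *\<^sub>C blinfun_apply T x}"

lift_definition scaleC_op :: "complex \<Rightarrow> 'h::complex_hilbert_space operator \<Rightarrow> 'h operator"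
    (infixr "*\<^sub>O" 75)
  is "\<lambda>c T x. c *\<^sub>C T x"
  using bounded_linear_compose[OF bounded_linear_scaleC] by blast

text \<open>Existence of the adjoint is the Riesz representation theorem (uniqueness is elementary).\<close>

definition adj :: "'h::complex_hilbert_space operator \<Rightarrow> 'h operator" where
  "adj T = (THE S. \<forall>x y. cinner (blinfun_apply S x) y = cinner x (blinfun_apply T y))"

definition commutant :: "'h::complex_hilbert_space operator set \<Rightarrow> 'h operator set" where
  "commutant S = {T \<in> bounded_operators. \<forall>X\<in>S. T o\<^sub>L X = X o\<^sub>L T}"


section \<open>Von Neumann algebras\<close>

definition star_subalgebra :: "'h::complex_hilbert_space operator set \<Rightarrow> bool" where
  "star_subalgebra M \<longleftrightarrow> M \<subseteq> bounded_operators \<and> id_blinfun \<in> M \<and>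
     (\<forall>x\<in>M. \<forall>y\<in>M. x + y \<in> M \<and> x o\<^sub>L y \<in> M) \<and>
     (\<forall>c. \<forall>x\<in>M. c *\<^sub>O x \<in> M) \<and> (\<forall>x\<in>M. adj x \<in> M)"

definition von_neumann_algebra :: "'h::complex_hilbert_space operator set \<Rightarrow> bool" where
  "von_neumann_algebra M \<longleftrightarrow> star_subalgebra M \<and> commutant (commutant M) = M"

definition factor :: "'h::complex_hilbert_space operator set \<Rightarrow> bool" where
  "factor M \<longleftrightarrow> von_neumann_algebra M \<and> M \<inter> commutant M = range (\<lambda>c. c *\<^sub>O id_blinfun)"

text \<open>
  The ultraweak (\<open>\<sigma>\<close>-weak) topology on \<open>M\<close>: the coarsest topology making all functionals
  \<open>T \<mapsto> \<Sum>n. \<langle>\<xi>\<^sub>n, T \<eta>\<^sub>n\<rangle>\<close> with square-summable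
  \<open>\<xi>\<close>, \<open>\<eta>\<close> continuous. Its underlying space is \<open>M\<close>.
\<close>

definition ultraweak :: "'h::complex_hilbert_space operator set \<Rightarrow> 'h operator topology" where
  "ultraweak M = topology_generated_by
     {{T \<in> M. (\<Sum>n. cinner (\<xi> n) (blinfun_apply T (\<eta> n))) \<in> V} | \<xi> \<eta> V.
        summable (\<lambda>n::nat. (norm (\<xi> n))\<^sup>2) \<and> summable (\<lambda>n. (norm (\<eta> n))\<^sup>2) \<and> open V}"

text \<open>The predual of \<open>M\<close>, as the space of ultraweakly continuous linear functionals on \<open>M\<close>;
  values outside \<open>M\<close> are irrelevant.\<close>

definition predual :: "'h::complex_hilbert_space operator set \<Rightarrow> ('h operator \<Rightarrow> complex) set" where
  "predual M = {\<rho>. (\<forall>x\<in>M. \<forall>y\<in>M. \<rho> (x + y) = \<rho> x + \<rho> y) \<and>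
     (\<forall>c. \<forall>x\<in>M. \<rho> (c *\<^sub>O x) = c * \<rho> x) \<and> continuous_map (ultraweak M) euclidean \<rho>}"

definition faithful_normal_tracial_state ::
    "'h::complex_hilbert_space operator set \<Rightarrow> ('h operator \<Rightarrow> complex) \<Rightarrow> bool" where
  "faithful_normal_tracial_state M \<tau> \<longleftrightarrow> \<tau> \<in> predual M \<and> \<tau> id_blinfun = 1 \<and>
     (\<forall>x\<in>M. \<tau> (adj x o\<^sub>L x) \<in> \<real>\<^sub>\<ge>\<^sub>0) \<and>
     (\<forall>x\<in>M. \<tau> (adj x o\<^sub>L x) = 0 \<longrightarrow> x = 0) \<and>
     (\<forall>x\<in>M. \<forall>y\<in>M. \<tau> (x o\<^sub>L y) = \<tau> (y o\<^sub>L x))"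

text \<open>Infinite dimension over the reals and over the complex numbers is the same;
  \<open>span\<close> is the real span.\<close>

definition II1_factor :: "'h::complex_hilbert_space operator set \<Rightarrow> bool" where
  "II1_factor M \<longleftrightarrow> factor M \<and> \<not> (\<exists>B. finite B \<and> M \<subseteq> span B) \<and>
     (\<exists>\<tau>. faithful_normal_tracial_state M \<tau>)"

definition star_hom :: "'h::complex_hilbert_space operator set \<Rightarrow> 'k::complex_hilbert_space operator set
    \<Rightarrow> ('h operator \<Rightarrow> 'k operator) \<Rightarrow> bool" where
  "star_hom M N \<theta> \<longleftrightarrow> \<theta> \<in> M \<rightarrow> N \<and>
     (\<forall>x\<in>M. \<forall>y\<in>M. \<theta> (x + y) = \<theta> x + \<theta> y \<and> \<theta> (x o\<^sub>L y) = \<theta> x o\<^sub>L \<theta> y) \<and>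
     (\<forall>c. \<forall>x\<in>M. \<theta> (c *\<^sub>O x) = c *\<^sub>O \<theta> x) \<and> (\<forall>x\<in>M. \<theta> (adj x) = adj (\<theta> x))"

definition star_iso :: "'h::complex_hilbert_space operator set \<Rightarrow> 'k::complex_hilbert_space operator set
    \<Rightarrow> ('h operator \<Rightarrow> 'k operator) \<Rightarrow> bool" where
  "star_iso M N \<theta> \<longleftrightarrow> star_hom M N \<theta> \<and> bij_betw \<theta> M N"

definition normal_unital_endomorphism ::
    "'h::complex_hilbert_space operator set \<Rightarrow> ('h operator \<Rightarrow> 'h operator) \<Rightarrow> bool" where
  "normal_unital_endomorphism M \<phi> \<longleftrightarrow> star_hom M M \<phi> \<and> \<phi> id_blinfun = id_blinfun \<and>
     continuous_map (ultraweak M) (ultraweak M) \<phi>"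


section \<open>\<open>E\<^sub>0\<close>-semigroups\<close>

text \<open>Only the values \<open>\<alpha> t x\<close> with \<open>t \<ge> 0\<close> and \<open>x \<in> M\<close> matter.\<close>

definition E0_semigroup ::
    "'h::complex_hilbert_space operator set \<Rightarrow> (real \<Rightarrow> 'h operator \<Rightarrow> 'h operator) \<Rightarrow> bool" where
  "E0_semigroup M \<alpha> \<longleftrightarrow>
     (\<forall>t\<ge>0. normal_unital_endomorphism M (\<alpha> t)) \<and>
     (\<forall>x\<in>M. \<alpha> 0 x = x) \<and>
     (\<forall>s\<ge>0. \<forall>t\<ge>0. \<forall>x\<in>M. \<alpha> (s + t) x = \<alpha> s (\<alpha> t x)) \<and>
     (\<forall>t>0. \<alpha> t ` M \<noteq> M) \<and>
     (\<forall>x\<in>M. \<forall>\<rho>\<in>predual M. continuous_on {0..} (\<lambda>t. \<rho> (\<alpha> t x)))"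

definition unitary_op :: "'h::complex_hilbert_space operator \<Rightarrow> bool" where
  "unitary_op U \<longleftrightarrow> U \<in> bounded_operators \<and>
     adj U o\<^sub>L U = id_blinfun \<and> U o\<^sub>L adj U = id_blinfun"

definition cocycle :: "'h::complex_hilbert_space operator set \<Rightarrow> (real \<Rightarrow> 'h operator \<Rightarrow> 'h operator)
    \<Rightarrow> (real \<Rightarrow> 'h operator) \<Rightarrow> bool" where
  "cocycle M \<alpha> U \<longleftrightarrow>
     (\<forall>t\<ge>0. U t \<in> M \<and> unitary_op (U t)) \<and>
     (\<forall>\<xi>. continuous_on {0..} (\<lambda>t. blinfun_apply (U t) \<xi>)) \<and>
     (\<forall>s\<ge>0. \<forall>t\<ge>0. U s o\<^sub>L \<alpha> s (U t) = U (s + t))"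

definition perturbed :: "(real \<Rightarrow> 'h::complex_hilbert_space operator \<Rightarrow> 'h operator)
    \<Rightarrow> (real \<Rightarrow> 'h operator) \<Rightarrow> real \<Rightarrow> 'h operator \<Rightarrow> 'h operator" where
  "perturbed \<alpha> U t x = U t o\<^sub>L \<alpha> t x o\<^sub>L adj (U t)"

definition conjugate ::
    "'h::complex_hilbert_space operator set \<Rightarrow> (real \<Rightarrow> 'h operator \<Rightarrow> 'h operator) \<Rightarrow>
     'k::complex_hilbert_space operator set \<Rightarrow> (real \<Rightarrow> 'k operator \<Rightarrow> 'k operator) \<Rightarrow> bool" where
  "conjugate M \<alpha> N \<beta> \<longleftrightarrow>
     (\<exists>\<theta>. star_iso M N \<theta> \<and> (\<forall>t\<ge>0. \<forall>y\<in>N. \<beta> t y = \<theta> (\<alpha> t (inv_into M \<theta> y))))"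

definition cocycle_conjugate ::
    "'h::complex_hilbert_space operator set \<Rightarrow> (real \<Rightarrow> 'h operator \<Rightarrow> 'h operator) \<Rightarrow>
     'k::complex_hilbert_space operator set \<Rightarrow> (real \<Rightarrow> 'k operator \<Rightarrow> 'k operator) \<Rightarrow> bool" where
  "cocycle_conjugate M \<alpha> N \<beta> \<longleftrightarrow> (\<exists>U. cocycle M \<alpha> U \<and> conjugate M (perturbed \<alpha> U) N \<beta>)"

text \<open>The \<open>C\<^sup>*\<close>-algebra \<open>\<A>\<^sub>\<alpha>\<close>; \<open>closure\<close> is with respect to the operator norm.\<close>

definition relcomm_algebra :: "'h::complex_hilbert_space operator set \<Rightarrow>
    (real \<Rightarrow> 'h operator \<Rightarrow> 'h operator) \<Rightarrow> 'h operator set" where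
  "relcomm_algebra M \<alpha> = closure (\<Union>t\<in>{0..}. commutant (\<alpha> t ` M) \<inter> M)"

end

theory Submission
  imports Defs
begin

text \<open>
  Let \<open>U\<close> be a cocycle for \<open>\<alpha>\<close> and \<open>\<gamma>\<^sub>t = U\<^sub>t \<alpha>\<^sub>t(\<sqdot>) U\<^sub>t\<^sup>*\<close>. If \<open>x\<close> commutes with \<open>\<alpha>\<^sub>s(M)\<close>, then
  \<open>U\<^sub>t x U\<^sub>t\<^sup>*\<close> is constant for \<open>t \<ge> s\<close>, because \<open>U\<^sub>t = U\<^sub>s \<alpha>\<^sub>s(U\<^sub>t\<^sub>-\<^sub>s)\<close>; likewise \<open>U\<^sub>t\<^sup>* c U\<^sub>t\<close> is eventually
  constant if \<open>c\<close> commutes with some \<open>\<gamma>\<^sub>s(M)\<close>. Since both families of elements separate \<open>M\<close> with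
  respect to the trace, weak compactness gives limits \<open>\<theta>(x) = lim U\<^sub>t x U\<^sub>t\<^sup>*\<close> and
  \<open>\<psi>(y) = lim U\<^sub>t\<^sup>* y U\<^sub>t\<close> on all of \<open>M\<close>, and \<open>\<tau>(y \<theta>(x)) = \<tau>(x \<psi>(y))\<close> shows that they are mutually
  inverse automorphisms. The cocycle identity gives \<open>\<theta> \<circ> \<alpha>\<^sub>s = \<gamma>\<^sub>s \<circ> \<theta>\<close>.

  Density is assumed for \<open>\<beta>\<close>, not for \<open>\<gamma>\<close>. It is transported along the isomorphism \<open>\<kappa>\<close> between \<open>\<gamma>\<close>
  and \<open>\<beta>\<close> by means of the uniqueness of the trace, \<open>\<tau> \<circ> \<kappa> = \<tau>\<close>: averaging over unitaries brings
  \<open>x\<close> close to \<open>\<tau>(x) 1\<close> in the \<open>2\<close>-norm on a bounded set, where \<open>\<tau> \<circ> \<kappa>\<close> is continuous.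
\<close>

section \<open>Complex Hilbert spaces\<close>

text \<open>The obstacle is that a \<open>star_iso\<close> carries no continuity:
  \<open>\<tau> \<circ> \<kappa>\<close> is at first only a positive tracial functional, about whose
  value at a limit of averages nothing is known. What an algebraic isomorphism does preserve is
  invertibility, hence order, norm bounds and suprema of bounded monotone sequences. Continuity on
  balls is extracted from this through resolvents, because infinite sums of positive elements may be
  unbounded while their resolvents stay between 0 and 1. Transporting density itself would require
  an ultraweakly continuous isomorphism; \<open>separating\<close>, its consequence for the trace
  pairing, requires only that \<kappa> preserves the trace. Square roots and spectral theory are
  avoided: positivity is that of quadratic forms, inverses come from a contraction principle, and
  limits are cluster points along finer filters.\<close>

lemma cinner_add_left: "cinner (x + y) z = cinner x z + cinner y z"
  for x :: "'a::complex_hilbert_space"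
  by (metis cinner_add_right cinner_commute complex_cnj_add)

text \<open>A phase \<open>c\<close> rotates the complex inner product onto the positive axis, where
  it agrees with the real one and the real inequality applies.\<close>

lemma cinner_cauchy_schwarz: "cmod (cinner x y) \<le> norm x * norm y"
  for x :: "'a::complex_hilbert_space"
proof (cases "cinner x y = 0")
  case False
  define c where "c = cnj (cinner x y) / cmod (cinner x y)"
  have c: "cmod c = 1"
    using False by (simp add: c_def norm_divide)
  have "cinner x (c *\<^sub>C y) = complex_of_real (cmod (cinner x y))"
    using False unfolding cinner_scaleC_right c_def
    by (simp add: complex_norm_square[symmetric] mult.commute power2_eq_square)
  then have "cmod (cinner x y) = inner x (c *\<^sub>C y)"
    by (simp add: inner_eq_Re_cinner)
  also have "\<dots> \<le> norm x * norm (c *\<^sub>C y)"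
    by (rule norm_cauchy_schwarz)
  finally show ?thesis
    by (simp add: norm_scaleC c)
qed simp

lemma scaleC_minus1: "(- 1) *\<^sub>C x = - x" for x :: "'a::complex_hilbert_space"
  using scaleR_scaleC[of "-1" x] by simp

lemma scaleC_one: "1 *\<^sub>C x = x" for x :: "'a::complex_hilbert_space"
  using scaleR_scaleC[of 1 x] by simp

lemma scaleC_zero: "0 *\<^sub>C x = 0" for x :: "'a::complex_hilbert_space"
  using scaleR_scaleC[of 0 x] by simp

lemma bounded_bilinear_cinner:
  "bounded_bilinear (cinner :: 'a::complex_hilbert_space \<Rightarrow> 'a \<Rightarrow> complex)"
proof
  fix x y z :: 'a and r :: real
  show "cinner (x + y) z = cinner x z + cinner y z" by (rule cinner_add_left)
  show "cinner x (y + z) = cinner x y + cinner x z" by (rule cinner_add_right)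
  show "cinner (r *\<^sub>R x) y = r *\<^sub>R cinner x y"
    by (simp add: scaleR_scaleC cinner_scaleC_left scaleC_complex_def)
  show "cinner x (r *\<^sub>R y) = r *\<^sub>R cinner x y"
    by (simp add: scaleR_scaleC cinner_scaleC_right scaleC_complex_def)
  show "\<exists>K. \<forall>a b::'a. cmod (cinner a b) \<le> norm a * norm b * K"
    by (rule exI[of _ 1]) (simp add: cinner_cauchy_schwarz)
qed

interpretation cinner: bounded_bilinear "cinner :: 'a::complex_hilbert_space \<Rightarrow> 'a \<Rightarrow> complex"
  by (rule bounded_bilinear_cinner)

lemma cinner_ext: "(\<And>x. cinner x a = cinner x b) \<Longrightarrow> a = b"
  for a :: "'a::complex_hilbert_space"
  using cinner_self[of "a - b"] by (simp add: cinner.diff_right)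

lemma operator_eqI:
  fixes S T :: "'h::complex_hilbert_space operator"
  assumes "\<And>\<xi> \<eta>. cinner \<xi> (S \<eta>) = cinner \<xi> (T \<eta>)"
  shows "S = T"
  by (rule blinfun_eqI, rule cinner_ext) (rule assms)

section \<open>Riesz representation and bounded sesquilinear forms\<close>

lemma real_riesz:
  fixes f :: "'a::{real_inner,complete_space} \<Rightarrow> real"
  assumes f: "bounded_linear f"
  shows "\<exists>v. \<forall>x. f x = inner v x"
proof -
  interpret f: bounded_linear f by (rule f)
  obtain K where K: "\<And>x. norm (f x) \<le> norm x * K" "K > 0"
    using f.pos_bounded by blast
  text \<open>The representing vector minimises \<open>\<parallel>x\<parallel>\<^sup>2 - 2 f x\<close>.\<close>
  define g where "g x = (norm x)\<^sup>2 - 2 * f x" for x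
  \<comment> \<open>The linear part of \<open>g\<close> cancels, leaving the parallelogram identity.
    It makes a minimising sequence Cauchy, as midpoints cannot fall below the infimum
    \<open>m\<close>.\<close>
  have g_par: "g x + g y = 2 * g ((1/2) *\<^sub>R (x + y)) + (1/2) * (norm (x - y))\<^sup>2" for x y
  proof -
    have "(norm (x + y))\<^sup>2 + (norm (x - y))\<^sup>2 = 2 * (norm x)\<^sup>2 + 2 * (norm y)\<^sup>2"
      by (simp add: power2_norm_eq_inner inner_add_left inner_add_right inner_diff_left
          inner_diff_right)
    moreover have "(norm ((1/2) *\<^sub>R (x + y)))\<^sup>2 = (norm (x + y))\<^sup>2 / 4"
      by (simp only: norm_scaleR) (simp add: power_divide)
    moreover have "f ((1/2) *\<^sub>R (x + y)) = (f x + f y) / 2"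
      by (simp only: f.scaleR f.add) simp
    ultimately show ?thesis
      unfolding g_def by simp
  qed
  have g_low: "- (K\<^sup>2) \<le> g x" for x
  proof -
    have "0 \<le> (norm x - K)\<^sup>2" by simp
    moreover have "f x \<le> norm x * K" using K(1)[of x] by simp
    ultimately show ?thesis by (simp add: g_def power2_eq_square algebra_simps)
  qed
  define m where "m = Inf (range g)"
  have m: "m \<le> g x" for x
    unfolding m_def by (rule cInf_lower) (auto intro!: bdd_belowI[of _ "- (K\<^sup>2)"] g_low)
  have "\<exists>x. g x < m + 1 / real (Suc n)" for n
    using cInf_lessD[of "range g" "m + 1 / real (Suc n)"] unfolding m_def by auto
  then obtain X where X: "\<And>n. g (X n) < m + 1 / real (Suc n)" by metis
  have dX: "(norm (X i - X j))\<^sup>2 \<le> 2 * (1 / real (Suc i) + 1 / real (Suc j))" for i j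
    using g_par[of "X i" "X j"] m[of "(1/2) *\<^sub>R (X i + X j)"] X[of i] X[of j] by simp
  have "Cauchy X"
  proof (rule CauchyI)
    fix e :: real assume e: "e > 0"
    then obtain N where "1 / real (Suc N) < e\<^sup>2 / 4"
      using nat_approx_posE[of "e\<^sup>2 / 4"] by (metis divide_pos_pos zero_less_numeral zero_less_power)
    then have N: "4 / real (Suc N) < e\<^sup>2" by simp
    have "norm (X i - X j) < e" if "i \<ge> N" "j \<ge> N" for i j
    proof -
      have "1 / real (Suc i) \<le> 1 / real (Suc N)" "1 / real (Suc j) \<le> 1 / real (Suc N)"
        using that by (simp_all add: frac_le)
      then have "(norm (X i - X j))\<^sup>2 < e\<^sup>2"
        using dX[of i j] N by simp
      then show ?thesis using e by (simp add: power2_less_imp_less)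
    qed
    then show "\<exists>M. \<forall>m\<ge>M. \<forall>n\<ge>M. norm (X m - X n) < e" by blast
  qed
  then obtain v where v: "X \<longlonglongrightarrow> v"
    using Cauchy_convergent convergent_def by blast
  have "(\<lambda>n. g (X n)) \<longlonglongrightarrow> g v"
    unfolding g_def by (intro tendsto_intros f.tendsto v)
  moreover have "(\<lambda>n. m + 1 / real (Suc n)) \<longlonglongrightarrow> m + 0"
    by (intro tendsto_intros LIMSEQ_Suc lim_1_over_n[unfolded inverse_eq_divide])
  ultimately have gv: "g v \<le> m"
    using LIMSEQ_le[of "\<lambda>n. g (X n)" "g v" "\<lambda>n. m + 1 / real (Suc n)" m] X less_imp_le by auto
  have "f x = inner v x" for x
  proof (rule ccontr)
    assume ne: "f x \<noteq> inner v x"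
    define d where "d = f x - inner v x"
    define n where "n = (norm x)\<^sup>2"
    have n: "n \<ge> 0" by (simp add: n_def)
    \<comment> \<open>The quadratic in \<open>t\<close> has its minimum at \<open>d / n\<close>; the
      denominator \<open>n + 1\<close> avoids division by zero and still gives a strict
      decrease.\<close>
    define t where "t = d / (n + 1)"
    have "g (v + t *\<^sub>R x) = g v - 2 * t * d + t\<^sup>2 * n"
      unfolding g_def d_def n_def f.add f.scaleR power2_norm_eq_inner inner_add_left inner_add_right
      by (simp add: inner_commute[of x v] algebra_simps power2_eq_square)
    then have "2 * t * d \<le> t\<^sup>2 * n" using gv m[of "v + t *\<^sub>R x"] by simp
    moreover have t: "t * (n + 1) = d" using n by (simp add: t_def)
    ultimately have "2 * t * (t * (n + 1)) \<le> t * t * n" by (simp add: power2_eq_square)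
    then have "t * t * (n + 2) \<le> 0" by (simp add: algebra_simps)
    moreover have "t \<noteq> 0" using ne t by (auto simp: d_def)
    then have "t * t > 0" by (metis not_real_square_gt_zero)
    ultimately have "\<not> 0 < n + 2" using mult_pos_pos[of "t * t" "n + 2"] by linarith
    with n show False by simp
  qed
  then show ?thesis by blast
qed

lemma bounded_operatorsD: "T \<in> bounded_operators \<Longrightarrow> T (c *\<^sub>C x) = c *\<^sub>C T x"
  for T :: "'h::complex_hilbert_space operator"
  by (simp add: bounded_operators_def)

text \<open>Used for adjoints and for weak limits, both of which are first given through their
  forms.\<close>

lemma operator_of_form:
  fixes F :: "'h::complex_hilbert_space \<Rightarrow> 'h \<Rightarrow> complex"
  assumes addl: "\<And>x y z. F (x + y) z = F x z + F y z"
    and addr: "\<And>x y z. F x (y + z) = F x y + F x z"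
    and scl: "\<And>c x y. F (c *\<^sub>C x) y = cnj c * F x y"
    and scr: "\<And>c x y. F x (c *\<^sub>C y) = c * F x y"
    and K0: "K \<ge> 0"
    and bnd: "\<And>x y. cmod (F x y) \<le> K * norm x * norm y"
  shows "\<exists>T\<in>bounded_operators. norm T \<le> K \<and> (\<forall>x y. cinner x (blinfun_apply T y) = F x y)"
proof -
  have "\<exists>v. \<forall>x. cinner x v = F x y" for y
  proof -
    have "bounded_linear (\<lambda>x. Re (F x y))"
    proof (rule bounded_linear_intro[where K = "K * norm y"])
      show "norm (Re (F x y)) \<le> norm x * (K * norm y)" for x
        using bnd[of x y] abs_Re_le_cmod[of "F x y"] by (simp add: mult.assoc mult.left_commute)
    qed (auto simp: addl scaleR_scaleC scl)
    then obtain v where v: "\<And>x. Re (F x y) = inner v x"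
      using real_riesz by blast
    have re: "Re (cinner x v) = Re (F x y)" for x
      using v[of x] by (metis inner_commute inner_eq_Re_cinner)
    \<comment> \<open>Both sides are conjugate linear in \<open>x\<close>, so the real part at
      \<open>\<i> *\<^sub>C x\<close> is the imaginary part at \<open>x\<close>.\<close>
    have "Im (cinner x v) = Im (F x y)" for x
      using re[of "\<i> *\<^sub>C x"] by (simp add: cinner_scaleC_left scl)
    with re show ?thesis by (metis complex_eqI)
  qed
  then obtain t where t: "\<And>x y. cinner x (t y) = F x y" by metis
  have tadd: "t (x + y) = t x + t y" for x y
    by (rule cinner_ext) (simp add: t addr cinner_add_right)
  have tsc: "t (c *\<^sub>C x) = c *\<^sub>C t x" for c x
    by (rule cinner_ext) (simp add: t scr cinner_scaleC_right)
  have tb: "norm (t x) \<le> K * norm x" for x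
  proof (cases "t x = 0")
    case False
    have "(norm (t x))\<^sup>2 = cmod (cinner (t x) (t x))" by (simp add: cinner_self norm_power)
    also have "\<dots> \<le> K * norm (t x) * norm x" unfolding t by (rule bnd)
    finally show ?thesis using False by (simp add: power2_eq_square mult.commute mult.left_commute)
  qed (use K0 in simp)
  have bl: "bounded_linear t"
    by (rule bounded_linear_intro[where K = K])
      (auto simp: tadd tsc scaleR_scaleC tb mult.commute)
  show ?thesis
  proof (intro bexI[of _ "Blinfun t"] conjI allI)
    show "norm (Blinfun t) \<le> K"
      by (rule norm_blinfun_bound) (use K0 tb bl in \<open>auto simp: bounded_linear_Blinfun_apply\<close>)
  qed (auto simp: bounded_operators_def bounded_linear_Blinfun_apply bl tsc t)
qed

section \<open>Adjoints and the algebra of bounded operators\<close>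

lemma scaleC_op_apply [simp]: "(c *\<^sub>O T) x = c *\<^sub>C T x"
  for T :: "'h::complex_hilbert_space operator"
  by (simp add: scaleC_op.rep_eq)

lemma adj_exists:
  fixes T :: "'h::complex_hilbert_space operator"
  assumes "T \<in> bounded_operators"
  shows "\<exists>S\<in>bounded_operators. norm S \<le> norm T \<and>
    (\<forall>x y. cinner (blinfun_apply S x) y = cinner x (blinfun_apply T y))"
proof -
  have "\<exists>S\<in>bounded_operators. norm S \<le> norm T \<and>
      (\<forall>x y. cinner x (blinfun_apply S y) = cinner (T x) y)"
  proof (rule operator_of_form)
    show "cmod (cinner (T x) y) \<le> norm T * norm x * norm y" for x y
      using cinner_cauchy_schwarz[of "T x" y] norm_blinfun[of T x]
      by (meson mult_right_mono norm_ge_zero order_trans)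
  qed (simp_all add: blinfun.add_right cinner_add_left cinner_add_right bounded_operatorsD[OF assms]
      cinner_scaleC_left cinner_scaleC_right)
  then show ?thesis
    by (metis cinner_commute)
qed

lemma adj_eqI:
  fixes S T :: "'h::complex_hilbert_space operator"
  assumes "\<And>x y. cinner (S x) y = cinner x (T y)"
  shows "adj T = S"
  unfolding adj_def
proof (rule the_equality)
  fix R :: "'h operator"
  assume "\<forall>x y. cinner (R x) y = cinner x (T y)"
  then show "R = S"
    using assms by (intro operator_eqI) (metis cinner_commute)
qed (use assms in blast)

context
  fixes T :: "'h::complex_hilbert_space operator"
  assumes T: "T \<in> bounded_operators"
begin

lemma adj_props: "adj T \<in> bounded_operators \<and> norm (adj T) \<le> norm T \<and>
    (\<forall>x y. cinner (blinfun_apply (adj T) x) y = cinner x (blinfun_apply T y))"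
  using adj_exists[OF T] adj_eqI by metis

lemma adj_bounded: "adj T \<in> bounded_operators"
  and norm_adj_le: "norm (adj T) \<le> norm T"
  and cinner_adj_left: "cinner (adj T x) y = cinner x (T y)"
  using adj_props by blast+

lemma cinner_adj_right: "cinner x (adj T y) = cinner (T x) y"
  using cinner_adj_left by (metis cinner_commute)

lemma inner_adj_left: "inner (adj T x) y = inner x (T y)"
  by (simp add: inner_eq_Re_cinner cinner_adj_left)

lemma inner_adj_right: "inner x (adj T y) = inner (T x) y"
  by (simp add: inner_eq_Re_cinner cinner_adj_right)

end

lemma adj_adj: "T \<in> bounded_operators \<Longrightarrow> adj (adj T) = T"
  for T :: "'h::complex_hilbert_space operator"
  by (rule adj_eqI) (simp add: cinner_adj_right)

lemma norm_adj: "T \<in> bounded_operators \<Longrightarrow> norm (adj T) = norm T"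
  for T :: "'h::complex_hilbert_space operator"
  using norm_adj_le[of T] norm_adj_le[of "adj T"] by (simp add: adj_adj adj_bounded)

lemma bounded_operators_id [simp]: "id_blinfun \<in> bounded_operators"
  by (simp add: bounded_operators_def)

lemma adj_id [simp]: "adj id_blinfun = id_blinfun"
  by (rule adj_eqI) simp

lemma bounded_operators_add:
  fixes S T :: "'h::complex_hilbert_space operator"
  assumes "S \<in> bounded_operators" "T \<in> bounded_operators"
  shows "S + T \<in> bounded_operators" "adj (S + T) = adj S + adj T"
  using assms
  by (auto simp: bounded_operators_def blinfun.add_left scaleC_add_right)
    (rule adj_eqI, simp add: blinfun.add_left cinner_add_left cinner_add_right cinner_adj_left assms)

lemma bounded_operators_compose:
  fixes S T :: "'h::complex_hilbert_space operator"
  assumes "S \<in> bounded_operators" "T \<in> bounded_operators"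
  shows "S o\<^sub>L T \<in> bounded_operators" "adj (S o\<^sub>L T) = adj T o\<^sub>L adj S"
  using assms
  by (auto simp: bounded_operators_def) (rule adj_eqI, simp add: cinner_adj_left assms)

lemma bounded_operators_scaleC:
  fixes T :: "'h::complex_hilbert_space operator"
  assumes "T \<in> bounded_operators"
  shows "c *\<^sub>O T \<in> bounded_operators" "adj (c *\<^sub>O T) = cnj c *\<^sub>O adj T"
  using assms
  by (auto simp: bounded_operators_def scaleC_scaleC mult.commute)
    (rule adj_eqI, simp add: cinner_adj_left cinner_scaleC_left cinner_scaleC_right assms)

lemma scaleC_op_minus1: "(- 1) *\<^sub>O T = - T" for T :: "'h::complex_hilbert_space operator"
  by (rule blinfun_eqI) (simp add: scaleC_minus1 blinfun.minus_left)

lemma scaleC_op_of_real: "complex_of_real r *\<^sub>O T = r *\<^sub>R T"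
  for T :: "'h::complex_hilbert_space operator"
  by (rule blinfun_eqI) (simp add: scaleR_scaleC blinfun.scaleR_left)

lemma scaleC_op_compose:
  fixes S T :: "'h::complex_hilbert_space operator"
  shows "(c *\<^sub>O S) o\<^sub>L T = c *\<^sub>O (S o\<^sub>L T)"
    and "S \<in> bounded_operators \<Longrightarrow> S o\<^sub>L (c *\<^sub>O T) = c *\<^sub>O (S o\<^sub>L T)"
  by (auto intro!: blinfun_eqI simp: bounded_operatorsD)

lemma blinfun_compose_assoc: "(R o\<^sub>L S) o\<^sub>L T = R o\<^sub>L (S o\<^sub>L T)"
  by (rule blinfun_eqI) simp

lemma blinfun_compose_id [simp]: "id_blinfun o\<^sub>L T = T" "T o\<^sub>L id_blinfun = T"
  by (rule blinfun_eqI, simp)+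

lemmas compose_add_left = bounded_bilinear.add_left[OF bounded_bilinear_blinfun_compose]
lemmas compose_add_right = bounded_bilinear.add_right[OF bounded_bilinear_blinfun_compose]
lemmas compose_diff_right = bounded_bilinear.diff_right[OF bounded_bilinear_blinfun_compose]
lemmas compose_scaleR_left = bounded_bilinear.scaleR_left[OF bounded_bilinear_blinfun_compose]
lemmas compose_scaleR_right = bounded_bilinear.scaleR_right[OF bounded_bilinear_blinfun_compose]

section \<open>Weak convergence\<close>

definition weakly_tendsto ::
    "('i \<Rightarrow> 'h::complex_hilbert_space operator) \<Rightarrow> 'h operator \<Rightarrow> 'i filter \<Rightarrow> bool" where
  "weakly_tendsto x y F \<longleftrightarrow> (\<forall>\<xi> \<eta>. ((\<lambda>i. cinner \<xi> (blinfun_apply (x i) \<eta>)) \<longlongrightarrow> cinner \<xi> (blinfun_apply y \<eta>)) F)"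

lemma weakly_tendstoD: "weakly_tendsto x y F \<Longrightarrow> ((\<lambda>i. cinner \<xi> (x i \<eta>)) \<longlongrightarrow> cinner \<xi> (y \<eta>)) F"
  by (simp add: weakly_tendsto_def)

lemma weakly_tendsto_inner:
  "weakly_tendsto x y F \<Longrightarrow> ((\<lambda>i. inner \<xi> (x i \<eta>)) \<longlongrightarrow> inner \<xi> (y \<eta>)) F"
  unfolding inner_eq_Re_cinner by (intro tendsto_Re weakly_tendstoD)

lemma weakly_tendsto_unique:
  "weakly_tendsto x y F \<Longrightarrow> weakly_tendsto x z F \<Longrightarrow> F \<noteq> bot \<Longrightarrow> y = z"
  by (rule operator_eqI) (metis weakly_tendstoD tendsto_unique)

lemma weakly_tendsto_cong:
  assumes "eventually (\<lambda>i. x i = x' i) F"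
  shows "weakly_tendsto x y F \<longleftrightarrow> weakly_tendsto x' y F"
proof -
  have "((\<lambda>i. cinner \<xi> (x i \<eta>)) \<longlongrightarrow> l) F \<longleftrightarrow> ((\<lambda>i. cinner \<xi> (x' i \<eta>)) \<longlongrightarrow> l) F" for \<xi> \<eta> l
    by (rule tendsto_cong) (use assms in eventually_elim, simp)
  then show ?thesis by (simp add: weakly_tendsto_def)
qed

lemma weakly_tendsto_filterlim:
  "weakly_tendsto x y F \<Longrightarrow> filterlim f F G \<Longrightarrow> weakly_tendsto (\<lambda>i. x (f i)) y G"
  unfolding weakly_tendsto_def
proof (intro allI)
  fix \<xi> \<eta>
  assume "\<forall>\<xi> \<eta>. ((\<lambda>i. cinner \<xi> (blinfun_apply (x i) \<eta>)) \<longlongrightarrow> cinner \<xi> (blinfun_apply y \<eta>)) F" "filterlim f F G"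
  then show "((\<lambda>i. cinner \<xi> (blinfun_apply (x (f i)) \<eta>)) \<longlongrightarrow> cinner \<xi> (blinfun_apply y \<eta>)) G"
    using filterlim_compose[of "\<lambda>i. cinner \<xi> (blinfun_apply (x i) \<eta>)"] by blast
qed

lemma weakly_tendsto_const: "weakly_tendsto (\<lambda>_. y) y F"
  by (simp add: weakly_tendsto_def)

lemma weakly_tendsto_add:
  "weakly_tendsto x y F \<Longrightarrow> weakly_tendsto x' y' F \<Longrightarrow> weakly_tendsto (\<lambda>i. x i + x' i) (y + y') F"
  by (auto simp: weakly_tendsto_def blinfun.add_left cinner_add_right intro!: tendsto_add)

lemma weakly_tendsto_scaleC: "weakly_tendsto x y F \<Longrightarrow> weakly_tendsto (\<lambda>i. c *\<^sub>O x i) (c *\<^sub>O y) F"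
  by (auto simp: weakly_tendsto_def cinner_scaleC_right intro!: tendsto_mult)

lemma weakly_tendsto_compose_right: "weakly_tendsto x y F \<Longrightarrow> weakly_tendsto (\<lambda>i. x i o\<^sub>L T) (y o\<^sub>L T) F"
  by (auto simp: weakly_tendsto_def)

lemma weakly_tendsto_compose_left:
  assumes "weakly_tendsto x y F" "T \<in> bounded_operators"
  shows "weakly_tendsto (\<lambda>i. T o\<^sub>L x i) (T o\<^sub>L y) F"
  using assms unfolding weakly_tendsto_def by (simp flip: cinner_adj_left)

lemma weakly_tendsto_adj:
  assumes "weakly_tendsto x y F" "\<And>i. x i \<in> bounded_operators" "y \<in> bounded_operators"
  shows "weakly_tendsto (\<lambda>i. adj (x i)) (adj y) F"
  unfolding weakly_tendsto_def
proof (intro allI)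
  fix \<xi> \<eta>
  have "((\<lambda>i. cnj (cinner \<eta> (x i \<xi>))) \<longlongrightarrow> cnj (cinner \<eta> (y \<xi>))) F"
    by (intro tendsto_cnj weakly_tendstoD assms)
  then show "((\<lambda>i. cinner \<xi> (adj (x i) \<eta>)) \<longlongrightarrow> cinner \<xi> (adj y \<eta>)) F"
    by (simp add: cinner_adj_right assms flip: cinner_commute)
qed

lemma weakly_tendsto_norm:
  fixes x :: "nat \<Rightarrow> 'h::complex_hilbert_space operator"
  assumes "x \<longlonglongrightarrow> y"
  shows "weakly_tendsto x y sequentially"
  unfolding weakly_tendsto_def
  by (intro allI cinner.tendsto tendsto_const blinfun.tendsto assms)

text \<open>Tychonoff's theorem: the matrix coefficients lie in a product of compact discs, and a
  limit of uniformly bounded sesquilinear forms is again such a form, hence an operator.\<close>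

lemma weak_compactness:
  fixes x :: "'i \<Rightarrow> 'h::complex_hilbert_space operator"
  assumes x: "\<And>i. x i \<in> bounded_operators" and K: "\<And>i. norm (x i) \<le> K" and F: "F \<noteq> bot"
  shows "\<exists>G y. G \<noteq> bot \<and> G \<le> F \<and> y \<in> bounded_operators \<and> norm y \<le> K \<and> weakly_tendsto x y G"
proof -
  have K0: "K \<ge> 0" using K norm_ge_zero order_trans by blast
  define \<Phi> where "\<Phi> T = (\<lambda>(\<xi>, \<eta>). cinner \<xi> (blinfun_apply T \<eta>))" for T :: "'h operator"
  define S where "S = (\<Pi>\<^sub>E p\<in>UNIV. cball (0::complex) (K * norm (fst p :: 'h) * norm (snd p :: 'h)))"
  have "compactin (product_topology (\<lambda>_. euclidean) UNIV) S"
    unfolding S_def compactin_PiE by simp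
  then have "compact S"
    by (simp add: euclidean_product_topology)
  have bnd: "cmod (cinner \<xi> (x i \<eta>)) \<le> K * norm \<xi> * norm \<eta>" for i \<xi> \<eta>
  proof -
    have "cmod (cinner \<xi> (x i \<eta>)) \<le> norm \<xi> * norm (x i \<eta>)"
      by (rule cinner_cauchy_schwarz)
    also have "\<dots> \<le> norm \<xi> * (K * norm \<eta>)"
      by (intro mult_left_mono order_trans[OF norm_blinfun] mult_right_mono K) auto
    finally show ?thesis by (simp add: mult_ac)
  qed
  have "filtermap (\<lambda>i. \<Phi> (x i)) F \<noteq> bot" using F by (simp add: filtermap_bot_iff)
  moreover have "eventually (\<lambda>f. f \<in> S) (filtermap (\<lambda>i. \<Phi> (x i)) F)"
    by (simp add: eventually_filtermap S_def \<Phi>_def PiE_iff bnd)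
  ultimately obtain f where f: "f \<in> S" "inf (nhds f) (filtermap (\<lambda>i. \<Phi> (x i)) F) \<noteq> bot"
    using \<open>compact S\<close> unfolding compact_filter by blast
  \<comment> \<open>\<open>f\<close> is a cluster point of the coefficients. Refining
    \<open>F\<close> by the preimages of the neighbourhoods of \<open>f\<close> makes them converge
    to \<open>f\<close>.\<close>
  define G where "G = inf (filtercomap (\<lambda>i. \<Phi> (x i)) (nhds f)) F"
  have G: "G \<noteq> bot"
  proof
    assume "G = bot"
    then obtain P Q where PQ: "eventually P (filtercomap (\<lambda>i. \<Phi> (x i)) (nhds f))" "eventually Q F"
        "\<And>i. P i \<Longrightarrow> Q i \<Longrightarrow> False"
      unfolding G_def trivial_limit_def eventually_inf by blast
    then obtain R where R: "eventually R (nhds f)" "\<And>i. R (\<Phi> (x i)) \<Longrightarrow> P i"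
      unfolding eventually_filtercomap by blast
    have "eventually (\<lambda>g. \<not> R g) (filtermap (\<lambda>i. \<Phi> (x i)) F)"
      unfolding eventually_filtermap using PQ(2) by eventually_elim (use PQ(3) R(2) in blast)
    with R(1) have "eventually (\<lambda>_. False) (inf (nhds f) (filtermap (\<lambda>i. \<Phi> (x i)) F))"
      unfolding eventually_inf by blast
    with f(2) show False by (simp add: trivial_limit_def)
  qed
  have "filterlim (\<lambda>i. \<Phi> (x i)) (nhds f) G"
    unfolding G_def filterlim_iff_le_filtercomap by simp
  then have "((\<lambda>i. \<Phi> (x i) p) \<longlongrightarrow> f p) G" for p
    by (rule continuous_on_tendsto_compose[OF continuous_on_product_coordinates[of p]]) auto
  from this[of "(_, _)"] have lim: "((\<lambda>i. cinner \<xi> (x i \<eta>)) \<longlongrightarrow> f (\<xi>, \<eta>)) G" for \<xi> \<eta>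
    by (simp add: \<Phi>_def)
  have "\<exists>y\<in>bounded_operators. norm y \<le> K \<and> (\<forall>\<xi> \<eta>. cinner \<xi> (blinfun_apply y \<eta>) = f (\<xi>, \<eta>))"
  proof (rule operator_of_form)
    fix u v w :: 'h and c :: complex
    show "f (u + v, w) = f (u, w) + f (v, w)"
      using tendsto_add[OF lim[of u w] lim[of v w]] lim[of "u + v" w] tendsto_unique[OF G]
      by (auto simp: cinner_add_left)
    show "f (u, v + w) = f (u, v) + f (u, w)"
      using tendsto_add[OF lim[of u v] lim[of u w]] lim[of u "v + w"] tendsto_unique[OF G]
      by (auto simp: cinner_add_right blinfun.add_right)
    show "f (c *\<^sub>C u, v) = cnj c * f (u, v)"
      using tendsto_mult_left[OF lim[of u v], of "cnj c"] lim[of "c *\<^sub>C u" v] tendsto_unique[OF G]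
      by (auto simp: cinner_scaleC_left)
    show "f (u, c *\<^sub>C v) = c * f (u, v)"
      using tendsto_mult_left[OF lim[of u v], of c] lim[of u "c *\<^sub>C v"] tendsto_unique[OF G]
      by (auto simp: cinner_scaleC_right bounded_operatorsD[OF x])
    show "cmod (f (u, v)) \<le> K * norm u * norm v"
      using f(1) by (auto simp: S_def PiE_iff)
  qed (rule K0)
  then obtain y where "y \<in> bounded_operators" "norm y \<le> K" "\<And>\<xi> \<eta>. cinner \<xi> (y \<eta>) = f (\<xi>, \<eta>)"
    by blast
  moreover from this(3) lim have "weakly_tendsto x y G"
    by (simp add: weakly_tendsto_def)
  moreover have "G \<le> F" by (simp add: G_def)
  ultimately show ?thesis using G by blast
qed

text \<open>A family in a compact set with a single cluster point converges: otherwise the indices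
  at which some coefficient leaves a neighbourhood of its limit give a proper filter, along which
  compactness yields a cluster point other than \<open>y\<close>.\<close>

lemma weakly_tendsto_by_subfilters:
  fixes x :: "'i \<Rightarrow> 'h::complex_hilbert_space operator"
  assumes x: "\<And>i. x i \<in> bounded_operators" and K: "\<And>i. norm (x i) \<le> K"
    and uniq: "\<And>G z. G \<noteq> bot \<Longrightarrow> G \<le> F \<Longrightarrow> z \<in> bounded_operators \<Longrightarrow> weakly_tendsto x z G \<Longrightarrow> z = y"
  shows "weakly_tendsto x y F"
proof (rule ccontr)
  assume "\<not> weakly_tendsto x y F"
  then obtain \<xi> \<eta> V where V: "open V" "cinner \<xi> (y \<eta>) \<in> V"
      "\<not> eventually (\<lambda>i. cinner \<xi> (x i \<eta>) \<in> V) F"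
    unfolding weakly_tendsto_def tendsto_def by blast
  define H where "H = inf F (principal {i. cinner \<xi> (x i \<eta>) \<notin> V})"
  have "H \<noteq> bot"
    using V(3) by (simp add: H_def trivial_limit_def eventually_inf_principal)
  then obtain G z where G: "G \<noteq> bot" "G \<le> H" "z \<in> bounded_operators" "weakly_tendsto x z G"
    using weak_compactness[where x = x and K = K and F = H] x K by blast
  have "G \<le> F" using G(2) by (simp add: H_def)
  with G uniq have z: "z = y" by blast
  have "eventually (\<lambda>i. cinner \<xi> (x i \<eta>) \<in> V) G"
    using weakly_tendstoD[OF G(4)] V(1,2) unfolding z tendsto_def by blast
  moreover have "eventually (\<lambda>i. cinner \<xi> (x i \<eta>) \<notin> V) G"
    by (rule filter_leD[OF G(2)]) (simp add: H_def eventually_inf_principal)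
  ultimately have "eventually (\<lambda>_. False) G"
    by eventually_elim simp
  with G(1) show False by (simp add: trivial_limit_def)
qed

section \<open>Positive operators and inverses\<close>

text \<open>Common core of the Cauchy-Schwarz inequalities for positive operators and for the trace.
  The minimum is at \<open>t = - B / C\<close>; if \<open>C = 0\<close>, the expression is affine in
  \<open>t\<close> and the value \<open>- (A + 1) / (2 * B)\<close> drives it to -1.\<close>

lemma discriminant_bound:
  fixes A B C :: real
  assumes "\<And>t. 0 \<le> A + 2 * t * B + t\<^sup>2 * C" and C: "0 \<le> C"
  shows "B\<^sup>2 \<le> A * C"
proof (cases "C = 0")
  case True
  have "B = 0"
  proof (rule ccontr)
    assume "B \<noteq> 0"
    then have "2 * (- (A + 1) / (2 * B)) * B = - (A + 1)" by simp
    then show False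
      using assms(1)[of "- (A + 1) / (2 * B)"] True by (simp only:)
  qed
  with True show ?thesis by simp
next
  case False
  with C have C: "C > 0" by simp
  have "0 \<le> A - B\<^sup>2 / C"
    using assms(1)[of "- B / C"] C by (simp add: power2_eq_square field_simps)
  then show ?thesis using C by (simp add: field_simps)
qed

text \<open>\<open>inner\<close> is only the real part of the complex inner product, so skew-adjoint
  operators satisfy the last condition; self-adjointness has to be demanded separately.\<close>

definition psd :: "'h::complex_hilbert_space operator \<Rightarrow> bool" where
  "psd a \<longleftrightarrow> a \<in> bounded_operators \<and> adj a = a \<and> (\<forall>\<xi>. 0 \<le> inner \<xi> (blinfun_apply a \<xi>))"

lemma bounded_operators_diff:
  fixes S T :: "'h::complex_hilbert_space operator"
  assumes "S \<in> bounded_operators" "T \<in> bounded_operators"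
  shows "S - T \<in> bounded_operators" "adj (S - T) = adj S - adj T"
proof -
  have "- T \<in> bounded_operators" "adj (- T) = - adj T"
    using bounded_operators_scaleC[OF assms(2), of "-1"] by (simp_all add: scaleC_op_minus1)
  then show "S - T \<in> bounded_operators" "adj (S - T) = adj S - adj T"
    using bounded_operators_add[OF assms(1), of "- T"] by simp_all
qed

lemma bounded_operators_scaleR:
  fixes T :: "'h::complex_hilbert_space operator"
  assumes "T \<in> bounded_operators"
  shows "r *\<^sub>R T \<in> bounded_operators" "adj (r *\<^sub>R T) = r *\<^sub>R adj T"
  using bounded_operators_scaleC[OF assms, of "complex_of_real r"] by (simp_all add: scaleC_op_of_real)

lemma psd_bounded: "psd a \<Longrightarrow> a \<in> bounded_operators"
  and psd_adj: "psd a \<Longrightarrow> adj a = a"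
  and psd_nonneg: "psd a \<Longrightarrow> 0 \<le> inner \<xi> (a \<xi>)"
  by (auto simp: psd_def)

lemma inner_selfadjoint:
  fixes a :: "'h::complex_hilbert_space operator"
  assumes "a \<in> bounded_operators" "adj a = a"
  shows "inner (a \<xi>) \<eta> = inner \<xi> (a \<eta>)"
  using inner_adj_left[OF assms(1)] by (simp add: assms(2))

lemma psd_cauchy_schwarz:
  assumes "psd a"
  shows "(inner \<xi> (a \<eta>))\<^sup>2 \<le> inner \<xi> (a \<xi>) * inner \<eta> (a \<eta>)"
proof (rule discriminant_bound)
  fix t :: real
  have "inner \<eta> (a \<xi>) = inner \<xi> (a \<eta>)"
    using inner_selfadjoint[OF psd_bounded psd_adj, OF assms assms] by (metis inner_commute)
  then show "0 \<le> inner \<xi> (a \<xi>) + 2 * t * inner \<xi> (a \<eta>) + t\<^sup>2 * inner \<eta> (a \<eta>)"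
    using psd_nonneg[OF assms, of "\<xi> + t *\<^sub>R \<eta>"]
    by (simp add: blinfun.add_right blinfun.scaleR_right inner_add_left inner_add_right
        power2_eq_square algebra_simps)
qed (rule psd_nonneg[OF assms])

text \<open>Cauchy-Schwarz for the form of \<open>a\<close>, at the vectors \<open>a \<xi>\<close>
  and \<open>\<xi>\<close>, takes the place of a square root of \<open>a\<close>; one factor
  \<open>(norm (a \<xi>))\<^sup>2\<close> then cancels.\<close>

lemma psd_norm_square_le:
  assumes a: "psd a" and K: "\<And>\<xi>. inner \<xi> (a \<xi>) \<le> K * (norm \<xi>)\<^sup>2"
  shows "(norm (a \<xi>))\<^sup>2 \<le> K * inner \<xi> (a \<xi>)"
proof (cases "a \<xi> = 0")
  case False
  have "((norm (a \<xi>))\<^sup>2)\<^sup>2 \<le> inner (a \<xi>) (a (a \<xi>)) * inner \<xi> (a \<xi>)"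
    using psd_cauchy_schwarz[OF a, of "a \<xi>" \<xi>] by (simp add: power2_norm_eq_inner)
  also have "\<dots> \<le> (K * (norm (a \<xi>))\<^sup>2) * inner \<xi> (a \<xi>)"
    by (intro mult_right_mono K psd_nonneg[OF a])
  finally have "(norm (a \<xi>))\<^sup>2 * (norm (a \<xi>))\<^sup>2 \<le> (norm (a \<xi>))\<^sup>2 * (K * inner \<xi> (a \<xi>))"
    by (simp add: power2_eq_square mult_ac)
  moreover have "0 < (norm (a \<xi>))\<^sup>2" using False by simp
  ultimately show ?thesis by (simp only: mult_le_cancel_left_pos)
qed (simp add: psd_nonneg[OF a])

lemma psd_zero: "psd 0"
  using bounded_operators_diff[OF bounded_operators_id bounded_operators_id] by (simp add: psd_def)

lemma psd_add: "psd a \<Longrightarrow> psd b \<Longrightarrow> psd (a + b)"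
  by (simp add: psd_def bounded_operators_add blinfun.add_left inner_add_right)

lemma psd_scaleR: "psd a \<Longrightarrow> 0 \<le> r \<Longrightarrow> psd (r *\<^sub>R a)"
  by (simp add: psd_def bounded_operators_scaleR blinfun.scaleR_left)

lemma psd_id: "psd id_blinfun"
  by (simp add: psd_def)

lemma psd_sum: "(\<And>i. i \<in> A \<Longrightarrow> psd (a i)) \<Longrightarrow> psd (\<Sum>i\<in>A. a i)"
  by (induction A rule: infinite_finite_induct) (auto simp: psd_zero psd_add)

lemma psd_adj_compose:
  fixes T :: "'h::complex_hilbert_space operator"
  assumes "T \<in> bounded_operators"
  shows "psd (adj T o\<^sub>L T)"
  using assms
  by (simp add: psd_def bounded_operators_compose adj_bounded adj_adj inner_adj_right)

text \<open>Together with \<open>norm_le_of_psd\<close> this expresses a norm bound as an order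
  relation, the form in which an isomorphism preserves it.\<close>

lemma psd_id_minus_square:
  fixes T :: "'h::complex_hilbert_space operator"
  assumes T: "T \<in> bounded_operators" and K: "norm T \<le> K"
  shows "psd (K\<^sup>2 *\<^sub>R id_blinfun - (adj T o\<^sub>L T))"
  unfolding psd_def
proof (intro conjI allI)
  show "K\<^sup>2 *\<^sub>R id_blinfun - (adj T o\<^sub>L T) \<in> bounded_operators"
    by (intro bounded_operators_diff bounded_operators_scaleR bounded_operators_compose adj_bounded T
        bounded_operators_id)
  show "adj (K\<^sup>2 *\<^sub>R id_blinfun - (adj T o\<^sub>L T)) = K\<^sup>2 *\<^sub>R id_blinfun - (adj T o\<^sub>L T)"
    by (simp add: bounded_operators_diff bounded_operators_scaleR bounded_operators_compose
        adj_bounded T adj_adj)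
  fix \<xi>
  have "(norm (T \<xi>))\<^sup>2 \<le> (K * norm \<xi>)\<^sup>2"
    by (intro power_mono order_trans[OF norm_blinfun] mult_right_mono K) auto
  then show "0 \<le> inner \<xi> ((K\<^sup>2 *\<^sub>R id_blinfun - (adj T o\<^sub>L T)) \<xi>)"
    by (simp add: blinfun.diff_left blinfun.scaleR_left inner_diff_right inner_adj_right T
        power2_norm_eq_inner power_mult_distrib)
qed

lemma norm_le_of_psd:
  fixes T :: "'h::complex_hilbert_space operator"
  assumes T: "T \<in> bounded_operators" and K: "0 \<le> K" and psd: "psd (K\<^sup>2 *\<^sub>R id_blinfun - (adj T o\<^sub>L T))"
  shows "norm T \<le> K"
proof (rule norm_blinfun_bound[OF K])
  fix \<xi>
  have "(norm (T \<xi>))\<^sup>2 \<le> (K * norm \<xi>)\<^sup>2"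
    using psd_nonneg[OF psd, of \<xi>]
    by (simp add: blinfun.diff_left blinfun.scaleR_left inner_diff_right inner_adj_right T
        power2_norm_eq_inner power_mult_distrib)
  then show "norm (T \<xi>) \<le> K * norm \<xi>"
    by (rule power2_le_imp_le) (use K in simp)
qed

text \<open>The Lax-Milgram theorem. Coercivity concerns the real part of the form only, so the
  result covers operators such as \<open>1 + \<i> h\<close> with self-adjoint
  \<open>h\<close>.\<close>

lemma coercive_inverse:
  fixes T :: "'h::complex_hilbert_space operator"
  assumes T: "T \<in> bounded_operators" and c: "c > 0"
    and coer: "\<And>\<xi>. c * (norm \<xi>)\<^sup>2 \<le> inner \<xi> (T \<xi>)"
  shows "\<exists>S\<in>bounded_operators. S o\<^sub>L T = id_blinfun \<and> T o\<^sub>L S = id_blinfun"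
proof -
  \<comment> \<open>Adding \<open>c\<close> makes \<open>K\<close> positive and at least
    \<open>c\<close>, so that the radicand of \<open>q\<close> below is nonnegative.\<close>
  define K where "K = norm T + c"
  have K: "K > 0" "norm T \<le> K" "c \<le> K" using c by (auto simp: K_def add_nonneg_pos)
  text \<open>For this step size the map \<open>\<eta> \<mapsto> \<eta> - t (T \<eta> - \<xi>)\<close> is a contraction.\<close>
  define t where "t = c / K\<^sup>2"
  \<comment> \<open>With this \<open>t\<close> the factor
    \<open>1 - 2 t c + t\<^sup>2 K\<^sup>2\<close> takes its least value,
    \<open>1 - (c / K)\<^sup>2\<close>.\<close>
  define q where "q = sqrt (1 - (c / K)\<^sup>2)"
  have cK: "0 < c / K" "c / K \<le> 1" using c K by simp_all
  have sq: "0 < (c / K)\<^sup>2" "(c / K)\<^sup>2 \<le> 1"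
    using cK c K by (simp, intro power_le_one) simp_all
  have q: "0 \<le> q" "q < 1" "q\<^sup>2 = 1 - (c / K)\<^sup>2" using sq by (simp_all add: q_def)
  have contr: "norm (\<zeta> - t *\<^sub>R T \<zeta>) \<le> q * norm \<zeta>" for \<zeta>
  proof -
    have "(norm (\<zeta> - t *\<^sub>R T \<zeta>))\<^sup>2 = (norm \<zeta>)\<^sup>2 - 2 * t * inner \<zeta> (T \<zeta>) + t\<^sup>2 * (norm (T \<zeta>))\<^sup>2"
      unfolding power2_norm_eq_inner inner_diff_left inner_diff_right
      by (simp add: inner_commute[of "T \<zeta>" \<zeta>] power2_eq_square)
    also have "\<dots> \<le> (norm \<zeta>)\<^sup>2 - 2 * t * (c * (norm \<zeta>)\<^sup>2) + t\<^sup>2 * (K * norm \<zeta>)\<^sup>2"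
      using c K
      by (intro add_mono diff_mono mult_left_mono coer power_mono order_trans[OF norm_blinfun]
          mult_right_mono order_refl) (auto simp: t_def)
    also have "\<dots> = (q * norm \<zeta>)\<^sup>2"
      using K unfolding power_mult_distrib q t_def by (simp add: power2_eq_square field_simps)
    finally show ?thesis by (rule power2_le_imp_le) (use q in simp)
  qed
  have "\<exists>\<eta>. T \<eta> = \<xi>" for \<xi>
  proof -
    have "\<exists>!\<eta>. \<eta> - t *\<^sub>R (T \<eta> - \<xi>) = \<eta>"
    proof (rule banach_fix_type[OF q(1,2)], intro allI)
      fix x y
      have "(x - t *\<^sub>R (T x - \<xi>)) - (y - t *\<^sub>R (T y - \<xi>)) = (x - y) - t *\<^sub>R T (x - y)"
        by (simp add: blinfun.diff_right algebra_simps)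
      then show "dist (x - t *\<^sub>R (T x - \<xi>)) (y - t *\<^sub>R (T y - \<xi>)) \<le> q * dist x y"
        unfolding dist_norm using contr[of "x - y"] by (simp only:)
    qed
    then show ?thesis using c K by (auto simp: t_def)
  qed
  then obtain s where s: "\<And>\<xi>. T (s \<xi>) = \<xi>" by metis
  have lower: "c * norm \<xi> \<le> norm (T \<xi>)" for \<xi>
  proof (cases "\<xi> = 0")
    case False
    have "c * (norm \<xi>)\<^sup>2 \<le> norm \<xi> * norm (T \<xi>)"
      using coer[of \<xi>] norm_cauchy_schwarz[of \<xi> "T \<xi>"] by linarith
    then have "norm \<xi> * (c * norm \<xi>) \<le> norm \<xi> * norm (T \<xi>)"
      by (simp add: power2_eq_square mult_ac)
    moreover have "0 < norm \<xi>" using False by simp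
    ultimately show ?thesis by (simp only: mult_le_cancel_left_pos)
  qed simp
  have inj: "\<xi> = \<eta>" if "T \<xi> = T \<eta>" for \<xi> \<eta>
  proof -
    have "T (\<xi> - \<eta>) = 0" using that by (simp add: blinfun.diff_right)
    then have "c * norm (\<xi> - \<eta>) \<le> 0" using lower[of "\<xi> - \<eta>"] by simp
    then show ?thesis using c by (simp add: mult_le_0_iff)
  qed
  have bl: "bounded_linear s"
  proof (rule bounded_linear_intro[where K = "1 / c"])
    show "norm (s x) \<le> norm x * (1 / c)" for x
      using lower[of "s x"] c by (simp add: s field_simps)
    show "s (x + y) = s x + s y" for x y
      by (rule inj) (simp add: s blinfun.add_right)
    show "s (r *\<^sub>R x) = r *\<^sub>R s x" for r x
      by (rule inj) (simp add: s blinfun.scaleR_right)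
  qed
  have "s (T x) = x" for x by (rule inj) (simp add: s)
  moreover have "s (a *\<^sub>C x) = a *\<^sub>C s x" for a x
    by (rule inj) (simp add: s bounded_operatorsD[OF T])
  ultimately show ?thesis
    by (intro bexI[of _ "Blinfun s"] conjI blinfun_eqI)
      (auto simp: bounded_linear_Blinfun_apply[OF bl] s bounded_operators_def)
qed

text \<open>The infimum of the numerical range of a self-adjoint operator lies in its spectrum.\<close>

lemma psd_if_resolvents:
  fixes a :: "'h::complex_hilbert_space operator"
  assumes a: "a \<in> bounded_operators" "adj a = a"
    and inv: "\<And>e. e > 0 \<Longrightarrow> \<exists>S. S o\<^sub>L (a + e *\<^sub>R id_blinfun) = id_blinfun"
  shows "psd a"
proof (rule ccontr)
  assume "\<not> psd a"
  then obtain \<xi>0 where \<xi>0: "inner \<xi>0 (a \<xi>0) < 0" using a by (auto simp: psd_def not_le)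
  define N where "N = (\<lambda>\<xi>. inner \<xi> (a \<xi>)) ` {\<xi>. norm \<xi> = 1}"
  have scale: "inner ((1 / norm \<xi>) *\<^sub>R \<xi>) (a ((1 / norm \<xi>) *\<^sub>R \<xi>)) = inner \<xi> (a \<xi>) / (norm \<xi>)\<^sup>2" for \<xi>
    by (simp add: blinfun.scaleR_right power2_eq_square)
  have low: "- norm a \<le> r" if "r \<in> N" for r
  proof -
    from that obtain \<xi> where \<xi>: "norm \<xi> = 1" "r = inner \<xi> (a \<xi>)" by (auto simp: N_def)
    have "\<bar>r\<bar> \<le> norm \<xi> * norm (a \<xi>)" unfolding \<xi>(2) by (rule Cauchy_Schwarz_ineq2)
    also have "\<dots> \<le> norm a" using norm_blinfun[of a \<xi>] \<xi>(1) by simp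
    finally show ?thesis by simp
  qed
  then have bdd: "bdd_below N" by (rule bdd_belowI)
  \<comment> \<open>Shifted by \<open>e\<close>, the operator becomes positive and its numerical
    range has infimum 0. A left inverse is incompatible with that.\<close>
  define e where "e = - Inf N"
  have \<xi>0': "\<xi>0 \<noteq> 0" using \<xi>0 by auto
  then have mem: "inner \<xi>0 (a \<xi>0) / (norm \<xi>0)\<^sup>2 \<in> N"
    unfolding N_def scale[symmetric] by (intro imageI) simp
  moreover have "inner \<xi>0 (a \<xi>0) / (norm \<xi>0)\<^sup>2 < 0" using \<xi>0 \<xi>0' by (simp add: divide_neg_pos)
  ultimately have e: "e > 0" using cInf_lower[OF mem bdd] by (simp add: e_def)
  define b where "b = a + e *\<^sub>R id_blinfun"
  have b: "psd b"
    unfolding psd_def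
  proof (intro conjI allI)
    show "b \<in> bounded_operators" "adj b = b"
      using a by (simp_all add: b_def bounded_operators_add bounded_operators_scaleR)
    fix \<xi>
    show "0 \<le> inner \<xi> (b \<xi>)"
    proof (cases "\<xi> = 0")
      case False
      then have "inner \<xi> (a \<xi>) / (norm \<xi>)\<^sup>2 \<in> N"
        unfolding N_def scale[symmetric] by (intro imageI) simp
      then have "- e \<le> inner \<xi> (a \<xi>) / (norm \<xi>)\<^sup>2" using cInf_lower[OF _ bdd] by (simp add: e_def)
      then show ?thesis using False
        by (simp add: b_def blinfun.add_left blinfun.scaleR_left inner_add_right field_simps
            power2_norm_eq_inner)
    qed simp
  qed
  obtain S where S: "S o\<^sub>L b = id_blinfun" using inv[OF e] by (auto simp: b_def)
  define L where "L = (norm S)\<^sup>2 * norm b"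
  \<comment> \<open>For unit \<open>\<xi>\<close> the left inverse bounds
    \<open>norm (b \<xi>)\<close> from below, while its square is at most
    \<open>norm b * inner \<xi> (b \<xi>)\<close>; so the numerical range of \<open>b\<close> stays
    away from 0.\<close>
  have key: "1 \<le> L * (r + e)" if "r \<in> N" for r
  proof -
    from that obtain \<xi> where \<xi>: "norm \<xi> = 1" "r = inner \<xi> (a \<xi>)" by (auto simp: N_def)
    have re: "inner \<xi> (b \<xi>) = r + e"
      using \<xi> by (simp add: b_def blinfun.add_left blinfun.scaleR_left inner_add_right
          flip: power2_norm_eq_inner)
    have "(norm (b \<xi>))\<^sup>2 \<le> norm b * inner \<xi> (b \<xi>)"
    proof (rule psd_norm_square_le[OF b])
      fix \<zeta>
      have "inner \<zeta> (b \<zeta>) \<le> norm \<zeta> * norm (b \<zeta>)" by (rule norm_cauchy_schwarz)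
      also have "\<dots> \<le> norm \<zeta> * (norm b * norm \<zeta>)" by (intro mult_left_mono norm_blinfun) simp
      finally show "inner \<zeta> (b \<zeta>) \<le> norm b * (norm \<zeta>)\<^sup>2" by (simp add: power2_eq_square mult_ac)
    qed
    moreover have "1 \<le> (norm S * norm (b \<xi>))\<^sup>2"
    proof -
      have "S (b \<xi>) = \<xi>" using arg_cong[OF S, of "\<lambda>T. blinfun_apply T \<xi>"] by simp
      then have "1 \<le> norm S * norm (b \<xi>)" using norm_blinfun[of S "b \<xi>"] \<xi>(1) by simp
      then show ?thesis by (rule one_le_power)
    qed
    ultimately have "1 \<le> (norm S)\<^sup>2 * (norm b * inner \<xi> (b \<xi>))"
      using mult_left_mono[of "(norm (b \<xi>))\<^sup>2" _ "(norm S)\<^sup>2"] by (force simp: power_mult_distrib)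
    then show ?thesis by (simp add: L_def re mult.assoc)
  qed
  have L: "L > 0"
    using key[OF mem] by (cases "L = 0") (auto simp: L_def less_le)
  have "\<exists>r\<in>N. r < Inf N + 1 / L"
    using cInf_lessD[of N "Inf N + 1 / L"] mem L by auto
  then obtain r where "r \<in> N" "r + e < 1 / L" by (auto simp: e_def)
  with key[of r] L show False by (simp add: field_simps)
qed

section \<open>Positive contractions\<close>

lemma psd_contraction_norm_square:
  assumes a: "psd a" "psd (id_blinfun - a)"
  shows "inner \<xi> (a \<xi>) \<le> (norm \<xi>)\<^sup>2" "(norm (a \<xi>))\<^sup>2 \<le> inner \<xi> (a \<xi>)"
proof -
  have le: "inner \<zeta> (a \<zeta>) \<le> 1 * (norm \<zeta>)\<^sup>2" for \<zeta>
    using psd_nonneg[OF a(2), of \<zeta>] by (simp add: blinfun.diff_left inner_diff_right power2_norm_eq_inner)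
  show "inner \<xi> (a \<xi>) \<le> (norm \<xi>)\<^sup>2" "(norm (a \<xi>))\<^sup>2 \<le> inner \<xi> (a \<xi>)"
    using le psd_norm_square_le[OF a(1) le] by simp_all
qed

lemma psd_contraction_norm:
  assumes "psd a" "psd (id_blinfun - a)"
  shows "norm a \<le> 1"
proof (rule norm_blinfun_bound)
  fix \<xi>
  have "(norm (a \<xi>))\<^sup>2 \<le> (1 * norm \<xi>)\<^sup>2"
    unfolding mult_1_left using psd_contraction_norm_square[OF assms] by (rule order_trans[rotated])
  then show "norm (a \<xi>) \<le> 1 * norm \<xi>" by (rule power2_le_imp_le) simp
qed simp

text \<open>The interval from 0 to 1 is invariant under \<open>a \<mapsto> a - a\<^sup>2\<close>,
  since \<open>a\<^sup>2 \<le> a\<close> there and \<open>1 - a + a\<^sup>2\<close> is a sum of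
  positive operators. The map is iterated in \<open>\<tau>_psd_contraction\<close>.\<close>

lemma psd_iterate:
  fixes a :: "'h::complex_hilbert_space operator"
  assumes a: "psd a" "psd (id_blinfun - a)"
  shows "psd (a - (a o\<^sub>L a))" "psd (id_blinfun - (a - (a o\<^sub>L a)))"
proof -
  have ab: "a \<in> bounded_operators" "adj a = a" using a by (auto simp: psd_def)
  have "inner \<xi> (a (a \<xi>)) \<le> inner \<xi> (a \<xi>)" for \<xi>
    using psd_contraction_norm_square(2)[OF a]
    by (simp add: power2_norm_eq_inner flip: inner_selfadjoint[OF ab])
  then show "psd (a - (a o\<^sub>L a))"
    by (simp add: psd_def bounded_operators_diff bounded_operators_compose ab blinfun.diff_left
        inner_diff_right)
  have "psd (adj a o\<^sub>L a)" by (rule psd_adj_compose[OF ab(1)])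
  from psd_add[OF a(2) this] show "psd (id_blinfun - (a - (a o\<^sub>L a)))"
    by (simp add: ab algebra_simps)
qed

lemma psd_id_minus:
  fixes a :: "'h::complex_hilbert_space operator"
  assumes "psd a" "norm a \<le> 1"
  shows "psd (id_blinfun - a)"
  unfolding psd_def
proof (intro conjI allI)
  show "id_blinfun - a \<in> bounded_operators" "adj (id_blinfun - a) = id_blinfun - a"
    using assms by (simp_all add: psd_def bounded_operators_diff)
  fix \<xi>
  have "inner \<xi> (a \<xi>) \<le> norm \<xi> * norm (a \<xi>)" by (rule norm_cauchy_schwarz)
  also have "\<dots> \<le> norm \<xi> * (1 * norm \<xi>)"
    by (intro mult_left_mono order_trans[OF norm_blinfun] mult_right_mono assms) auto
  finally show "0 \<le> inner \<xi> ((id_blinfun - a) \<xi>)"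
    by (simp add: blinfun.diff_left inner_diff_right power2_eq_square flip: power2_norm_eq_inner)
qed

section \<open>Von Neumann algebras and the ultraweak topology\<close>

lemma limitin_topology_generated_by:
  assumes y: "y \<in> \<Union>S" and ev: "\<And>U. U \<in> S \<Longrightarrow> y \<in> U \<Longrightarrow> eventually (\<lambda>i. x i \<in> U) F"
  shows "limitin (topology_generated_by S) x y F"
  unfolding limitin_def
proof (intro conjI allI impI)
  show "y \<in> topspace (topology_generated_by S)" using y by simp
  fix U assume "openin (topology_generated_by S) U \<and> y \<in> U"
  then have "generate_topology_on S U" "y \<in> U" by (auto dest: openin_topology_generated_by)
  then show "eventually (\<lambda>i. x i \<in> U) F"
  proof (induction rule: generate_topology_on.induct)
    case (Int a b)
    then show ?case by (simp add: eventually_conj_iff)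
  next
    case (UN K)
    then obtain k where "k \<in> K" "y \<in> k" by blast
    with UN(2)[of k] show ?case by (auto elim: eventually_mono)
  qed (use ev in auto)
qed

lemma ultraweak_topspace [simp]: "topspace (ultraweak M) = M"
proof -
  have "\<exists>\<xi> \<eta> V. M = {T \<in> M. (\<Sum>n. cinner (\<xi> n) (blinfun_apply T (\<eta> n))) \<in> V} \<and>
        summable (\<lambda>n::nat. (norm (\<xi> n))\<^sup>2) \<and> summable (\<lambda>n. (norm (\<eta> n))\<^sup>2) \<and> open V"
    by (intro exI[of _ "\<lambda>_. 0"] exI[of _ UNIV]) auto
  then show ?thesis
    unfolding ultraweak_def topology_generated_by_topspace by blast
qed

lemma openin_ultraweak_subbasic:
  assumes "summable (\<lambda>n::nat. (norm (\<xi> n))\<^sup>2)" "summable (\<lambda>n. (norm (\<eta> n))\<^sup>2)" "open V"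
  shows "openin (ultraweak M) {T \<in> M. (\<Sum>n. cinner (\<xi> n) (blinfun_apply T (\<eta> n))) \<in> V}"
  unfolding ultraweak_def
  by (rule topology_generated_by_Basis, rule CollectI, intro exI conjI) (rule refl assms)+

lemma summable_norm_mult:
  fixes f g :: "nat \<Rightarrow> 'a::real_normed_vector"
  assumes "summable (\<lambda>n. (norm (f n))\<^sup>2)" "summable (\<lambda>n. (norm (g n))\<^sup>2)"
  shows "summable (\<lambda>n. norm (f n) * norm (g n))"
proof (rule summable_comparison_test')
  show "summable (\<lambda>n. (norm (f n))\<^sup>2 + (norm (g n))\<^sup>2)" by (intro summable_add assms)
  fix n :: nat
  have "0 \<le> norm (f n) * norm (g n)" by simp
  then have "norm (f n) * norm (g n) \<le> (norm (f n))\<^sup>2 + (norm (g n))\<^sup>2"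
    using sum_squares_bound[of "norm (f n)" "norm (g n)"] by linarith
  then show "norm (norm (f n) * norm (g n)) \<le> (norm (f n))\<^sup>2 + (norm (g n))\<^sup>2" by simp
qed

text \<open>On bounded sets the weak operator topology is as fine as the ultraweak one: the series
  are dominated by \<open>K * (norm (\<xi> n) * norm (\<eta> n))\<close>, so sum and limit may be
  exchanged.\<close>

lemma limitin_ultraweak:
  fixes x :: "'i \<Rightarrow> 'h::complex_hilbert_space operator"
  assumes K: "\<And>i. norm (x i) \<le> K" and lim: "weakly_tendsto x y F"
    and M: "\<And>i. x i \<in> M" "y \<in> M" and F: "F \<noteq> bot"
  shows "limitin (ultraweak M) x y F"
  unfolding ultraweak_def
proof (rule limitin_topology_generated_by)
  have "y \<in> topspace (ultraweak M)" using M by simp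
  then show "y \<in> \<Union>{{T \<in> M. (\<Sum>n. cinner (\<xi> n) (blinfun_apply T (\<eta> n))) \<in> V} | \<xi> \<eta> V.
        summable (\<lambda>n::nat. (norm (\<xi> n))\<^sup>2) \<and> summable (\<lambda>n. (norm (\<eta> n))\<^sup>2) \<and> open V}"
    unfolding ultraweak_def topology_generated_by_topspace .
  fix U assume "U \<in> {{T \<in> M. (\<Sum>n. cinner (\<xi> n) (blinfun_apply T (\<eta> n))) \<in> V} | \<xi> \<eta> V.
        summable (\<lambda>n::nat. (norm (\<xi> n))\<^sup>2) \<and> summable (\<lambda>n. (norm (\<eta> n))\<^sup>2) \<and> open V}" "y \<in> U"
  then obtain \<xi> \<eta> :: "nat \<Rightarrow> 'h" and V
    where U: "U = {T \<in> M. (\<Sum>n. cinner (\<xi> n) (blinfun_apply T (\<eta> n))) \<in> V}"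
    and sm: "summable (\<lambda>n::nat. (norm (\<xi> n))\<^sup>2)" "summable (\<lambda>n. (norm (\<eta> n))\<^sup>2)" and V: "open V"
      "(\<Sum>n. cinner (\<xi> n) (blinfun_apply y (\<eta> n))) \<in> V"
    by blast
  have "((\<lambda>i. \<Sum>n. cinner (\<xi> n) (blinfun_apply (x i) (\<eta> n))) \<longlongrightarrow>
      (\<Sum>n. cinner (\<xi> n) (blinfun_apply y (\<eta> n)))) F"
  proof (intro tannerys_theorem[THEN conjunct2, THEN conjunct2])
    show "((\<lambda>i. cinner (\<xi> k) (x i (\<eta> k))) \<longlongrightarrow> cinner (\<xi> k) (y (\<eta> k))) F" for k
      by (rule weakly_tendstoD[OF lim])
    show "summable (\<lambda>n. K * (norm (\<xi> n) * norm (\<eta> n)))"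
      by (intro summable_mult summable_norm_mult sm)
    have "cmod (cinner (\<xi> k) (x i (\<eta> k))) \<le> K * (norm (\<xi> k) * norm (\<eta> k))" for k i
    proof -
      have "cmod (cinner (\<xi> k) (x i (\<eta> k))) \<le> norm (\<xi> k) * norm (x i (\<eta> k))"
        by (rule cinner_cauchy_schwarz)
      also have "\<dots> \<le> norm (\<xi> k) * (K * norm (\<eta> k))"
        by (intro mult_left_mono order_trans[OF norm_blinfun] mult_right_mono K) auto
      finally show ?thesis by (simp add: mult_ac)
    qed
    then show "eventually (\<lambda>(k, i). norm (cinner (\<xi> k) (x i (\<eta> k))) \<le> K * (norm (\<xi> k) * norm (\<eta> k)))
        (at_top \<times>\<^sub>F F)"
      by (intro always_eventually) auto
  qed (rule F)
  from topological_tendstoD[OF this V] show "eventually (\<lambda>i. x i \<in> U) F"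
    by (simp add: U M)
qed

lemma predual_tendsto:
  fixes x :: "'i \<Rightarrow> 'h::complex_hilbert_space operator"
  assumes "\<And>i. norm (x i) \<le> K" "weakly_tendsto x y F" "\<And>i. x i \<in> M" "y \<in> M" "F \<noteq> bot"
    and \<rho>: "\<rho> \<in> predual M"
  shows "((\<lambda>i. \<rho> (x i)) \<longlongrightarrow> \<rho> y) F"
proof -
  have "limitin euclidean (\<rho> \<circ> x) (\<rho> y) F"
    by (rule continuous_map_limit[OF _ limitin_ultraweak[OF assms(1-5)]])
      (use \<rho> in \<open>auto simp: predual_def\<close>)
  then show ?thesis by (simp add: o_def)
qed

lemma weakly_tendsto_limitin:
  assumes "limitin (ultraweak M) x y F" "\<And>i. x i \<in> M"
  shows "weakly_tendsto x y F"
  unfolding weakly_tendsto_def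
proof (intro allI topological_tendstoI)
  fix \<xi> \<eta> and V :: "complex set" assume V: "open V" "cinner \<xi> (y \<eta>) \<in> V"
  \<comment> \<open>Padding with zero vectors exhibits a single matrix coefficient as one of the
    series that generate the ultraweak topology.\<close>
  define s where "s \<zeta> n = (if n = 0 then \<zeta> else 0)" for \<zeta> :: 'a and n :: nat
  have s: "summable (\<lambda>n. (norm (s \<zeta> n))\<^sup>2)" for \<zeta>
    by (rule summable_finite[of "{0}"]) (auto simp: s_def)
  have sum: "(\<Sum>n. cinner (s \<xi> n) (blinfun_apply T (s \<eta> n))) = cinner \<xi> (T \<eta>)" for T
    by (subst suminf_finite[of "{0}"]) (auto simp: s_def cinner.zero_left)
  define U where "U = {T \<in> M. (\<Sum>n. cinner (s \<xi> n) (blinfun_apply T (s \<eta> n))) \<in> V}"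
  have "openin (ultraweak M) U"
    unfolding U_def by (intro openin_ultraweak_subbasic s V)
  moreover have "y \<in> U" using assms(1) V by (simp add: U_def sum limitin_def)
  ultimately have "eventually (\<lambda>i. x i \<in> U) F" using assms(1) by (simp add: limitin_def)
  then show "eventually (\<lambda>i. cinner \<xi> (x i \<eta>) \<in> V) F"
    by eventually_elim (simp add: U_def sum)
qed

locale von_neumann =
  fixes M :: "'h::complex_hilbert_space operator set"
  assumes vna: "von_neumann_algebra M"
begin

lemma star_subalgebra_M: "star_subalgebra M"
  using vna by (simp add: von_neumann_algebra_def)

lemma M_bounded: "x \<in> M \<Longrightarrow> x \<in> bounded_operators"
  and M_id [simp]: "id_blinfun \<in> M"
  and M_add: "x \<in> M \<Longrightarrow> y \<in> M \<Longrightarrow> x + y \<in> M"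
  and M_compose: "x \<in> M \<Longrightarrow> y \<in> M \<Longrightarrow> x o\<^sub>L y \<in> M"
  and M_scaleC: "x \<in> M \<Longrightarrow> c *\<^sub>O x \<in> M"
  and M_adj: "x \<in> M \<Longrightarrow> adj x \<in> M"
  using star_subalgebra_M by (auto simp: star_subalgebra_def)

lemma M_scaleR: "x \<in> M \<Longrightarrow> r *\<^sub>R x \<in> M"
  using M_scaleC[of x "complex_of_real r"] by (simp add: scaleC_op_of_real)

lemma M_uminus: "x \<in> M \<Longrightarrow> - x \<in> M"
  using M_scaleR[of x "-1"] by simp

lemma M_diff: "x \<in> M \<Longrightarrow> y \<in> M \<Longrightarrow> x - y \<in> M"
  using M_add[of x "- y"] M_uminus by simp

lemma M_zero [simp]: "0 \<in> M"
  using M_diff[OF M_id M_id] by simp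

lemma M_sum: "(\<And>i. i \<in> A \<Longrightarrow> x i \<in> M) \<Longrightarrow> (\<Sum>i\<in>A. x i) \<in> M"
  by (induction A rule: infinite_finite_induct) (auto simp: M_add)

lemmas M_closed = M_id M_add M_compose M_scaleC M_adj M_scaleR M_uminus M_diff M_zero M_sum

lemma bicommutant: "x \<in> M \<longleftrightarrow> x \<in> bounded_operators \<and> (\<forall>X\<in>commutant M. x o\<^sub>L X = X o\<^sub>L x)"
proof -
  have "x \<in> M \<longleftrightarrow> x \<in> commutant (commutant M)"
    using vna by (simp add: von_neumann_algebra_def)
  then show ?thesis by (simp add: commutant_def)
qed

text \<open>Multiplication by a fixed operator is weakly continuous, so commuting with the commutant
  of \<open>M\<close> survives weak limits.\<close>

lemma M_weak_limit:
  assumes "weakly_tendsto x y F" "\<And>i. x i \<in> M" "F \<noteq> bot" "y \<in> bounded_operators"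
  shows "y \<in> M"
  unfolding bicommutant
proof (intro conjI ballI)
  fix X assume X: "X \<in> commutant M"
  then have Xb: "X \<in> bounded_operators" by (simp add: commutant_def)
  have "x i o\<^sub>L X = X o\<^sub>L x i" for i using X assms(2)[of i] by (simp add: commutant_def)
  with weakly_tendsto_compose_left[OF assms(1) Xb] have "weakly_tendsto (\<lambda>i. x i o\<^sub>L X) (X o\<^sub>L y) F"
    by simp
  with weakly_tendsto_compose_right[OF assms(1)] show "y o\<^sub>L X = X o\<^sub>L y"
    using assms(3) by (rule weakly_tendsto_unique)
qed (rule assms)

lemma M_inverse:
  assumes T: "T \<in> M" and S: "S \<in> bounded_operators" "S o\<^sub>L T = id_blinfun" "T o\<^sub>L S = id_blinfun"
  shows "S \<in> M"
  unfolding bicommutant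
proof (intro conjI ballI)
  fix X assume X: "X \<in> commutant M"
  have "S o\<^sub>L X = S o\<^sub>L (X o\<^sub>L T) o\<^sub>L S" using S by (simp add: blinfun_compose_assoc)
  also have "X o\<^sub>L T = T o\<^sub>L X" using X T by (simp add: commutant_def)
  also have "S o\<^sub>L (T o\<^sub>L X) o\<^sub>L S = X o\<^sub>L S" using S by (simp flip: blinfun_compose_assoc)
  finally show "S o\<^sub>L X = X o\<^sub>L S" .
qed (rule S)

lemma M_weak_compactness:
  assumes "\<And>i. x i \<in> M" "\<And>i. norm (x i) \<le> K" "F \<noteq> bot"
  obtains G y where "G \<noteq> bot" "G \<le> F" "y \<in> M" "norm y \<le> K" "weakly_tendsto x y G"
proof -
  have "\<exists>G y. G \<noteq> bot \<and> G \<le> F \<and> y \<in> bounded_operators \<and> norm y \<le> K \<and> weakly_tendsto x y G"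
    by (rule weak_compactness) (use assms M_bounded in auto)
  then show ?thesis using that M_weak_limit assms(1) by blast
qed

text \<open>The factor \<open>z\<close> can be absorbed into the vectors \<open>\<eta> n\<close>,
  which remain square summable; hence right multiplication is ultraweakly continuous.\<close>

lemma predual_compose_right:
  assumes \<rho>: "\<rho> \<in> predual M" and z: "z \<in> M"
  shows "(\<lambda>x. \<rho> (x o\<^sub>L z)) \<in> predual M"
proof -
  have "continuous_map (ultraweak M) (ultraweak M) (\<lambda>x. x o\<^sub>L z)"
  proof (subst (2) ultraweak_def, rule continuous_on_generated_topo)
    have "(\<lambda>x. x o\<^sub>L z) ` topspace (ultraweak M) \<subseteq> topspace (ultraweak M)"
      unfolding ultraweak_topspace using z M_compose by blast
    then show "(\<lambda>x. x o\<^sub>L z) ` topspace (ultraweak M)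
        \<subseteq> \<Union>{{T \<in> M. (\<Sum>n. cinner (\<xi> n) (blinfun_apply T (\<eta> n))) \<in> V} | \<xi> \<eta> V.
          summable (\<lambda>n::nat. (norm (\<xi> n))\<^sup>2) \<and> summable (\<lambda>n. (norm (\<eta> n))\<^sup>2) \<and> open V}"
      unfolding ultraweak_def topology_generated_by_topspace .
    fix U assume "U \<in> {{T \<in> M. (\<Sum>n. cinner (\<xi> n) (blinfun_apply T (\<eta> n))) \<in> V} | \<xi> \<eta> V.
        summable (\<lambda>n::nat. (norm (\<xi> n))\<^sup>2) \<and> summable (\<lambda>n. (norm (\<eta> n))\<^sup>2) \<and> open V}"
    then obtain \<xi> \<eta> :: "nat \<Rightarrow> 'h" and V
      where U: "U = {T \<in> M. (\<Sum>n. cinner (\<xi> n) (blinfun_apply T (\<eta> n))) \<in> V}"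
      and sm: "summable (\<lambda>n::nat. (norm (\<xi> n))\<^sup>2)" "summable (\<lambda>n. (norm (\<eta> n))\<^sup>2)" and V: "open V"
      by blast
    have "summable (\<lambda>n. (norm z)\<^sup>2 * (norm (\<eta> n))\<^sup>2)" by (intro summable_mult sm)
    then have sm': "summable (\<lambda>n. (norm (z (\<eta> n)))\<^sup>2)"
      by (rule summable_comparison_test[rotated])
        (auto simp flip: power_mult_distrib intro!: power_mono norm_blinfun)
    have "(\<lambda>x. x o\<^sub>L z) -` U \<inter> topspace (ultraweak M) =
        {T \<in> M. (\<Sum>n. cinner (\<xi> n) (blinfun_apply T (z (\<eta> n)))) \<in> V}"
      using z by (auto simp: U M_compose)
    moreover have "openin (ultraweak M) \<dots>"
      by (intro openin_ultraweak_subbasic sm sm' V)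
    ultimately show "openin (ultraweak M) ((\<lambda>x. x o\<^sub>L z) -` U \<inter> topspace (ultraweak M))" by simp
  qed
  moreover have "continuous_map (ultraweak M) euclidean \<rho>" using \<rho> by (simp add: predual_def)
  ultimately have "continuous_map (ultraweak M) euclidean (\<lambda>x. \<rho> (x o\<^sub>L z))"
    using continuous_map_compose[unfolded o_def] by blast
  then show ?thesis
    using \<rho> z by (auto simp: predual_def M_compose blinfun.bilinear_simps scaleC_op_compose
      bounded_bilinear.add_left[OF bounded_bilinear_blinfun_compose])
qed

text \<open>A norm convergent sequence in \<open>A\<close> is bounded and weakly convergent, so its
  limit lies in \<open>M\<close> and \<rho> vanishes there. The ultraweak closure is then reached
  because the zero set of \<rho> is ultraweakly closed.\<close>

lemma predual_zero_on_dense: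
  assumes \<rho>: "\<rho> \<in> predual M" and A: "A \<subseteq> M" and dense: "ultraweak M closure_of closure A = M"
    and zero: "\<And>a. a \<in> A \<Longrightarrow> \<rho> a = 0" and x: "x \<in> M"
  shows "\<rho> x = 0"
proof -
  have cl: "\<rho> y = 0" if y: "y \<in> closure A" for y
  proof -
    obtain s where s: "\<And>n. s n \<in> A" "s \<longlonglongrightarrow> y"
      using y unfolding closure_sequential by blast
    obtain K where K: "\<And>n. norm (s n) \<le> K"
      using convergent_imp_Bseq[OF convergentI[OF s(2)]] unfolding Bseq_def by blast
    have w: "weakly_tendsto s y sequentially" by (rule weakly_tendsto_norm[OF s(2)])
    have "y \<in> bounded_operators"
      unfolding bounded_operators_def
    proof (intro CollectI allI)
      fix c \<xi>
      have "(\<lambda>n. s n (c *\<^sub>C \<xi>)) \<longlonglongrightarrow> y (c *\<^sub>C \<xi>)"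
        by (intro blinfun.tendsto s tendsto_const)
      moreover have "s n (c *\<^sub>C \<xi>) = c *\<^sub>C s n \<xi>" for n
        using s(1) A M_bounded bounded_operatorsD by blast
      moreover have "(\<lambda>n. c *\<^sub>C s n \<xi>) \<longlonglongrightarrow> c *\<^sub>C y \<xi>"
        by (intro bounded_linear.tendsto[OF bounded_linear_scaleC] blinfun.tendsto s tendsto_const)
      ultimately show "y (c *\<^sub>C \<xi>) = c *\<^sub>C y \<xi>"
        using LIMSEQ_unique by simp
    qed
    then have "y \<in> M" using M_weak_limit[OF w] s(1) A by auto
    then have "(\<lambda>n. \<rho> (s n)) \<longlonglongrightarrow> \<rho> y"
      using predual_tendsto[OF K w _ _ _ \<rho>] s(1) A by auto
    then show ?thesis using zero s(1) LIMSEQ_unique[OF _ tendsto_const] by simp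
  qed
  have "closedin (ultraweak M) {x \<in> topspace (ultraweak M). \<rho> x \<in> {0}}"
    using \<rho> by (intro closedin_continuous_map_preimage[where Y = euclidean]) (auto simp: predual_def)
  then have *: "closedin (ultraweak M) {x \<in> M. \<rho> x = 0}" by simp
  have "ultraweak M closure_of closure A = ultraweak M closure_of (M \<inter> closure A)"
    using closure_of_restrict[of "ultraweak M" "closure A"] by simp
  also have "\<dots> \<subseteq> {x \<in> M. \<rho> x = 0}"
    by (rule closure_of_minimal[OF _ *]) (use cl in auto)
  finally show ?thesis using x dense by auto
qed

end

section \<open>Faithful normal tracial states\<close>

locale tracial = von_neumann M for M :: "'h::complex_hilbert_space operator set" +
  fixes \<tau> :: "'h operator \<Rightarrow> complex"
  assumes trace: "faithful_normal_tracial_state M \<tau>"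
begin

lemma \<tau>_predual: "\<tau> \<in> predual M"
  and \<tau>_id [simp]: "\<tau> id_blinfun = 1"
  and \<tau>_commute: "x \<in> M \<Longrightarrow> y \<in> M \<Longrightarrow> \<tau> (x o\<^sub>L y) = \<tau> (y o\<^sub>L x)"
  using trace by (auto simp: faithful_normal_tracial_state_def)

lemma \<tau>_add: "x \<in> M \<Longrightarrow> y \<in> M \<Longrightarrow> \<tau> (x + y) = \<tau> x + \<tau> y"
  and \<tau>_scaleC: "x \<in> M \<Longrightarrow> \<tau> (c *\<^sub>O x) = c * \<tau> x"
  using \<tau>_predual by (auto simp: predual_def)

lemma \<tau>_scaleR: "x \<in> M \<Longrightarrow> \<tau> (r *\<^sub>R x) = complex_of_real r * \<tau> x"
  using \<tau>_scaleC[of x "complex_of_real r"] by (simp add: scaleC_op_of_real)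

lemma \<tau>_uminus: "x \<in> M \<Longrightarrow> \<tau> (- x) = - \<tau> x"
  using \<tau>_scaleR[of x "-1"] by simp

lemma \<tau>_diff: "x \<in> M \<Longrightarrow> y \<in> M \<Longrightarrow> \<tau> (x - y) = \<tau> x - \<tau> y"
  using \<tau>_add[of x "- y"] by (simp add: \<tau>_uminus M_uminus)

lemma \<tau>_zero [simp]: "\<tau> 0 = 0"
  using \<tau>_diff[OF M_id M_id] by simp

lemma \<tau>_sum: "(\<And>i. i \<in> A \<Longrightarrow> x i \<in> M) \<Longrightarrow> \<tau> (\<Sum>i\<in>A. x i) = (\<Sum>i\<in>A. \<tau> (x i))"
  by (induction A rule: infinite_finite_induct) (auto simp: \<tau>_add M_sum)

text \<open>The square of the 2-norm defined by the trace.\<close>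

definition q :: "'h operator \<Rightarrow> real" where "q x = Re (\<tau> (adj x o\<^sub>L x))"

lemma \<tau>_square: "x \<in> M \<Longrightarrow> \<tau> (adj x o\<^sub>L x) = complex_of_real (q x)"
  and q_nonneg: "x \<in> M \<Longrightarrow> 0 \<le> q x"
  and q_zero_imp: "x \<in> M \<Longrightarrow> q x = 0 \<Longrightarrow> x = 0"
proof -
  assume x: "x \<in> M"
  have nn: "\<tau> (adj x o\<^sub>L x) \<in> \<real>\<^sub>\<ge>\<^sub>0" and 0: "\<tau> (adj x o\<^sub>L x) = 0 \<Longrightarrow> x = 0"
    using trace x by (auto simp: faithful_normal_tracial_state_def)
  show eq: "\<tau> (adj x o\<^sub>L x) = complex_of_real (q x)" and "0 \<le> q x"
    using nn by (auto simp: q_def complex_nonneg_Reals_iff complex_eq_iff)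
  show "x = 0" if "q x = 0" using that eq 0 by simp
qed

lemma adj_add: "x \<in> M \<Longrightarrow> y \<in> M \<Longrightarrow> adj (x + y) = adj x + adj y"
  and adj_compose: "x \<in> M \<Longrightarrow> y \<in> M \<Longrightarrow> adj (x o\<^sub>L y) = adj y o\<^sub>L adj x"
  and adj_scaleR: "x \<in> M \<Longrightarrow> adj (r *\<^sub>R x) = r *\<^sub>R adj x"
  and adj_scaleC: "x \<in> M \<Longrightarrow> adj (c *\<^sub>O x) = cnj c *\<^sub>O adj x"
  and adj_adj_M: "x \<in> M \<Longrightarrow> adj (adj x) = x"
  by (simp_all add: bounded_operators_add bounded_operators_diff bounded_operators_compose
      bounded_operators_scaleR bounded_operators_scaleC adj_adj M_bounded)

text \<open>Positivity forces it: expanding the real number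
  \<open>\<tau> (adj (y + 1) (y + 1))\<close> shows that \<open>\<tau> y + \<tau> (adj y)\<close> is
  real. The cases \<open>y = x\<close> and \<open>y = \<i> x\<close> give the imaginary and the real
  part.\<close>

lemma \<tau>_adj: 
  assumes x: "x \<in> M" shows "\<tau> (adj x) = cnj (\<tau> x)"
proof -
  have *: "Im (\<tau> y) + Im (\<tau> (adj y)) = 0" if y: "y \<in> M" for y
  proof -
    have "adj (y + id_blinfun) o\<^sub>L (y + id_blinfun) = (adj y o\<^sub>L y) + (adj y + (y + id_blinfun))"
      using y by (simp add: adj_add compose_add_left compose_add_right)
    then have "complex_of_real (q (y + id_blinfun)) = complex_of_real (q y) + (\<tau> (adj y) + (\<tau> y + 1))"
      using y by (simp add: \<tau>_add M_closed flip: \<tau>_square)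
    from arg_cong[OF this, of Im] show ?thesis by simp
  qed
  from *[OF x] *[OF M_scaleC[OF x, of \<i>]] show ?thesis
    by (simp add: adj_scaleC x \<tau>_scaleC M_adj complex_eq_iff)
qed

lemma q_add_scale:
  assumes "x \<in> M" "y \<in> M"
  shows "q (x + t *\<^sub>R y) = q x + 2 * t * Re (\<tau> (adj x o\<^sub>L y)) + t\<^sup>2 * q y"
proof -
  have "\<tau> (adj y o\<^sub>L x) = cnj (\<tau> (adj x o\<^sub>L y))"
    using \<tau>_adj[of "adj x o\<^sub>L y"] assms by (simp add: adj_compose adj_adj_M M_closed)
  then show ?thesis
    using assms unfolding q_def
    by (simp add: adj_add adj_scaleR compose_add_left compose_add_right compose_scaleR_left
        compose_scaleR_right \<tau>_add \<tau>_scaleR M_closed power2_eq_square distrib_left)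
qed

lemma q_cauchy_schwarz:
  assumes "x \<in> M" "y \<in> M"
  shows "(Re (\<tau> (adj x o\<^sub>L y)))\<^sup>2 \<le> q x * q y"
  by (rule discriminant_bound)
    (use q_add_scale[OF assms] q_nonneg assms M_add M_scaleR in \<open>metis, metis\<close>)

lemma q_parallelogram:
  assumes "x \<in> M" "y \<in> M"
  shows "q (x + y) + q (x - y) = 2 * q x + 2 * q y"
  using q_add_scale[OF assms, of 1] q_add_scale[OF assms, of "-1"] by simp

lemma q_scaleR: "x \<in> M \<Longrightarrow> q (r *\<^sub>R x) = r\<^sup>2 * q x"
  by (simp add: q_def adj_scaleR compose_scaleR_left compose_scaleR_right \<tau>_scaleR M_closed
      power2_eq_square)

lemma \<tau>_tendsto:
  assumes "\<And>i. norm (x i) \<le> K" "weakly_tendsto x y F" "\<And>i. x i \<in> M" "y \<in> M" "F \<noteq> bot"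
  shows "((\<lambda>i. \<tau> (x i)) \<longlongrightarrow> \<tau> y) F"
  by (rule predual_tendsto[OF assms \<tau>_predual])

lemma \<tau>_tendsto_compose:
  assumes "\<And>i. norm (x i) \<le> K" "weakly_tendsto x y F" "\<And>i. x i \<in> M" "y \<in> M" "F \<noteq> bot" "z \<in> M"
  shows "((\<lambda>i. \<tau> (z o\<^sub>L x i)) \<longlongrightarrow> \<tau> (z o\<^sub>L y)) F"
  using predual_tendsto[OF assms(1-5) predual_compose_right[OF \<tau>_predual assms(6)]]
  by (simp add: \<tau>_commute assms)

text \<open>The only form in which density is used: an element is determined by its trace pairings
  with the family.\<close>

definition separating :: "'h operator set \<Rightarrow> bool" where
  "separating A \<longleftrightarrow> (\<forall>x\<in>M. (\<forall>a\<in>A. \<tau> (a o\<^sub>L x) = 0) \<longrightarrow> x = 0)"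

lemma separatingD:
  assumes "separating A" "A \<subseteq> M" "x \<in> M" "y \<in> M" "\<And>a. a \<in> A \<Longrightarrow> \<tau> (a o\<^sub>L x) = \<tau> (a o\<^sub>L y)"
  shows "x = y"
proof -
  have "x - y \<in> M" by (intro M_closed assms)
  moreover have "\<tau> (a o\<^sub>L (x - y)) = 0" if "a \<in> A" for a
    using that assms by (simp add: compose_diff_right \<tau>_diff M_closed subset_iff)
  ultimately show ?thesis using assms(1) by (auto simp: separating_def)
qed

lemma separating_mono: "separating A \<Longrightarrow> A \<subseteq> B \<Longrightarrow> separating B"
  unfolding separating_def by blast

text \<open>The normal functional \<open>a \<mapsto> \<tau> (a x)\<close> vanishes on
  \<open>A\<close>, hence everywhere, in particular at \<open>adj x\<close>; the trace is
  faithful.\<close>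

lemma separating_dense:
  assumes A: "A \<subseteq> M" and dense: "ultraweak M closure_of closure A = M"
  shows "separating A"
  unfolding separating_def
proof (intro ballI impI)
  fix x assume x: "x \<in> M" "\<forall>a\<in>A. \<tau> (a o\<^sub>L x) = 0"
  have "\<tau> (adj x o\<^sub>L x) = 0"
    by (rule predual_zero_on_dense[OF predual_compose_right[OF \<tau>_predual x(1)] A dense])
      (use x M_adj in auto)
  then show "x = 0" using x(1) by (intro q_zero_imp) (auto simp: q_def)
qed

lemma \<tau>_psd_contraction:
  assumes aM: "a \<in> M" and a: "psd a" "psd (id_blinfun - a)"
  shows "q a \<le> Re (\<tau> a)"
proof -
  text \<open>Writing \<open>a\<^sub>0 = a\<close> and \<open>a\<^sub>k\<^sub>+\<^sub>1 = a\<^sub>k - a\<^sub>k\<^sup>2\<close>, the sum of the \<open>a\<^sub>k\<^sup>2\<close> telescopes to \<open>a\<close>,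
    because \<open>a\<^sub>k\<close> tends strongly to \<open>0\<close>.\<close>
  define s where "s k = ((\<lambda>a. a - (a o\<^sub>L a)) ^^ k) a" for k
  have s0: "s 0 = a" and sS: "s (Suc k) = s k - (s k o\<^sub>L s k)" for k
    by (simp_all add: s_def)
  have s: "s k \<in> M \<and> psd (s k) \<and> psd (id_blinfun - s k)" for k
    by (induction k) (auto simp: s0 sS aM a psd_iterate M_closed)
  have sa: "adj (s k) = s k" for k using s[of k] by (simp add: psd_def)
  have norm1: "norm (s k) \<le> 1" for k
    using s[of k] by (intro psd_contraction_norm) auto
  have "(\<lambda>k. s k \<xi>) \<longlonglongrightarrow> 0" for \<xi>
  proof -
    \<comment> \<open>The same telescoping at a single vector: bounded partial sums make the series
      converge, so its terms tend to 0.\<close>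
    have part: "(\<Sum>j<k. (norm (s j \<xi>))\<^sup>2) = inner \<xi> (a \<xi>) - inner \<xi> (s k \<xi>)" for k
    proof (induction k)
      case (Suc k)
      have "(norm (s k \<xi>))\<^sup>2 = inner \<xi> (s k (s k \<xi>))"
        using inner_selfadjoint[of "s k" \<xi> "s k \<xi>"] s[of k] sa[of k]
        by (simp add: M_bounded power2_norm_eq_inner)
      with Suc show ?case by (simp add: sS blinfun.diff_left inner_diff_right)
    qed (simp add: s0)
    have "summable (\<lambda>j. (norm (s j \<xi>))\<^sup>2)"
      by (rule bounded_imp_summable[where B = "inner \<xi> (a \<xi>)"])
        (use part[of "Suc _"] s psd_nonneg in \<open>auto simp: lessThan_Suc_atMost simp del: sum.lessThan_Suc\<close>)
    from summable_LIMSEQ_zero[OF this] have "(\<lambda>j. sqrt ((norm (s j \<xi>))\<^sup>2)) \<longlonglongrightarrow> sqrt 0"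
      by (rule tendsto_real_sqrt)
    then show ?thesis by (simp add: tendsto_norm_zero_iff)
  qed
  then have w: "weakly_tendsto s 0 sequentially"
    unfolding weakly_tendsto_def
    using cinner.tendsto[OF tendsto_const, of "\<lambda>k. s k _" 0 sequentially] by simp
  have "(\<lambda>k. \<tau> (s k)) \<longlonglongrightarrow> \<tau> 0"
    by (rule \<tau>_tendsto[where K = 1]) (use norm1 w s in auto)
  then have lim: "(\<lambda>k. Re (\<tau> (s k))) \<longlonglongrightarrow> 0" using tendsto_Re by fastforce
  have part: "Re (\<tau> a) = (\<Sum>j<k. q (s j)) + Re (\<tau> (s k))" for k
  proof (induction k)
    case (Suc k)
    then show ?case using s[of k] by (simp add: sS \<tau>_diff M_closed q_def sa)
  qed (simp add: s0)
  have "q a + Re (\<tau> (s (Suc k))) \<le> Re (\<tau> a)" for k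
  proof -
    have "q (s 0) \<le> (\<Sum>j<Suc k. q (s j))"
      using q_nonneg s by (intro member_le_sum) auto
    then show ?thesis using part[of "Suc k"] by (simp add: s0)
  qed
  moreover have "(\<lambda>k. q a + Re (\<tau> (s (Suc k)))) \<longlonglongrightarrow> q a + 0"
    by (intro tendsto_intros LIMSEQ_Suc lim)
  ultimately show ?thesis using LIMSEQ_le_const2 by fastforce
qed

text \<open>The axioms speak of elements \<open>adj x o\<^sub>L x\<close> only. Scaling
  \<open>a\<close> by \<open>r\<close> to a contraction allows the comparison of \<open>q\<close>
  with \<tau>, which yields both positivity and faithfulness on positive operators.\<close>

lemma \<tau>_psd:
  assumes aM: "a \<in> M" and a: "psd a"
  shows "0 \<le> Re (\<tau> a)" and "Re (\<tau> a) = 0 \<Longrightarrow> a = 0"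
proof -
  define r where "r = 1 / (norm a + 1)"
  have r: "r > 0" by (simp add: r_def add_nonneg_pos)
  have "norm (r *\<^sub>R a) \<le> 1" by (simp add: r_def divide_le_eq add_nonneg_pos)
  then have "q (r *\<^sub>R a) \<le> Re (\<tau> (r *\<^sub>R a))"
    using a r by (intro \<tau>_psd_contraction psd_scaleR psd_id_minus M_scaleR aM) auto
  then have *: "r\<^sup>2 * q a \<le> r * Re (\<tau> a)"
    by (simp add: q_scaleR \<tau>_scaleR aM)
  have "0 \<le> r\<^sup>2 * q a" using q_nonneg[OF aM] by simp
  with * have "0 \<le> r * Re (\<tau> a)" by linarith
  with r show "0 \<le> Re (\<tau> a)" by (simp add: zero_le_mult_iff)
  show "a = 0" if "Re (\<tau> a) = 0"
    using * that q_nonneg[OF aM] r by (intro q_zero_imp[OF aM]) (simp add: mult_le_0_iff)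
qed

lemma \<tau>_mono: "a \<in> M \<Longrightarrow> b \<in> M \<Longrightarrow> psd (b - a) \<Longrightarrow> Re (\<tau> a) \<le> Re (\<tau> b)"
  using \<tau>_psd(1)[of "b - a"] by (simp add: M_diff \<tau>_diff)

end

section \<open>Resolvents of positive operators\<close>

lemma psd_antisym:
  assumes "psd (b - a)" "psd (a - b)"
  shows "a = b"
proof -
  define d where "d = b - a"
  have d: "psd d" using assms(1) by (simp add: d_def)
  have z: "inner \<xi> (d \<xi>) = 0" for \<xi>
    using psd_nonneg[OF assms(1), of \<xi>] psd_nonneg[OF assms(2), of \<xi>]
    by (simp add: d_def blinfun.diff_left inner_diff_right)
  have "d \<xi> = 0" for \<xi>
    using psd_cauchy_schwarz[OF d, of "d \<xi>" \<xi>] z by simp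
  then have "d = 0" by (intro blinfun_eqI) simp
  then show ?thesis by (simp add: d_def)
qed

lemma psd_weak_limit:
  assumes lim: "weakly_tendsto x y F" and F: "F \<noteq> bot" and y: "y \<in> bounded_operators"
    and x: "eventually (\<lambda>i. psd (x i)) F"
  shows "psd y"
proof -
  have "inner \<xi> (adj y \<eta>) = inner \<xi> (y \<eta>)" for \<xi> \<eta>
  proof (rule tendsto_unique[OF F])
    show "((\<lambda>i. inner \<xi> (x i \<eta>)) \<longlongrightarrow> inner \<xi> (y \<eta>)) F" by (rule weakly_tendsto_inner[OF lim])
    have ev: "eventually (\<lambda>i. inner \<eta> (x i \<xi>) = inner \<xi> (x i \<eta>)) F"
      using x by eventually_elim (metis inner_selfadjoint psd_bounded psd_adj inner_commute)
    have "((\<lambda>i. inner \<eta> (x i \<xi>)) \<longlongrightarrow> inner \<eta> (y \<xi>)) F" by (rule weakly_tendsto_inner[OF lim])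
    then have "((\<lambda>i. inner \<xi> (x i \<eta>)) \<longlongrightarrow> inner \<eta> (y \<xi>)) F"
      using tendsto_cong[OF ev] by blast
    then show "((\<lambda>i. inner \<xi> (x i \<eta>)) \<longlongrightarrow> inner \<xi> (adj y \<eta>)) F"
      by (simp add: inner_adj_right y inner_commute)
  qed
  then have "adj y = y" by (intro blinfun_eqI) (metis vector_eq_rdot inner_commute)
  moreover have "0 \<le> inner \<xi> (y \<xi>)" for \<xi>
    by (rule tendsto_lowerbound[OF weakly_tendsto_inner[OF lim] _ F])
      (use x in eventually_elim, rule psd_nonneg)
  ultimately show ?thesis using y by (simp add: psd_def)
qed

text \<open>This function turns increasing, possibly unbounded sums into decreasing positive
  contractions, which always have weak limits.\<close>

definition resolvent :: "'h::complex_hilbert_space operator \<Rightarrow> 'h operator" where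
  "resolvent s = (SOME S. S \<in> bounded_operators \<and>
     S o\<^sub>L (id_blinfun + s) = id_blinfun \<and> (id_blinfun + s) o\<^sub>L S = id_blinfun)"

context
  fixes s :: "'h::complex_hilbert_space operator"
  assumes s: "psd s"
begin

lemma resolvent_props:
  "resolvent s \<in> bounded_operators \<and>
   resolvent s o\<^sub>L (id_blinfun + s) = id_blinfun \<and> (id_blinfun + s) o\<^sub>L resolvent s = id_blinfun"
  unfolding resolvent_def
proof (rule someI_ex)
  have "\<exists>S\<in>bounded_operators. S o\<^sub>L (id_blinfun + s) = id_blinfun \<and> (id_blinfun + s) o\<^sub>L S = id_blinfun"
  proof (rule coercive_inverse)
    show "1 * (norm \<xi>)\<^sup>2 \<le> inner \<xi> ((id_blinfun + s) \<xi>)" for \<xi>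
      using psd_nonneg[OF s, of \<xi>] by (simp add: blinfun.add_left inner_add_right power2_norm_eq_inner)
  qed (simp_all add: bounded_operators_add psd_bounded s)
  then show "\<exists>S. S \<in> bounded_operators \<and> S o\<^sub>L (id_blinfun + s) = id_blinfun \<and>
      (id_blinfun + s) o\<^sub>L S = id_blinfun"
    by blast
qed

lemma resolvent_bounded: "resolvent s \<in> bounded_operators"
  using resolvent_props by blast

text \<open>The inequalities below are checked by writing \<open>\<xi> = \<eta> + s \<eta>\<close>
  with \<open>\<eta> = resolvent s \<xi>\<close>, which leaves only polynomials in
  \<open>s\<close>.\<close>

lemma resolvent_split: "resolvent s \<xi> + s (resolvent s \<xi>) = \<xi>"
proof -
  have "((id_blinfun + s) o\<^sub>L resolvent s) \<xi> = \<xi>" using resolvent_props by simp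
  then show ?thesis by (simp add: blinfun.add_left)
qed

lemma resolvent_adj: "adj (resolvent s) = resolvent s"
proof -
  have 1: "id_blinfun + s \<in> bounded_operators" "adj (id_blinfun + s) = id_blinfun + s"
    using s by (simp_all add: psd_def bounded_operators_add)
  then have "adj (resolvent s) o\<^sub>L (id_blinfun + s) = adj ((id_blinfun + s) o\<^sub>L resolvent s)"
    by (simp add: bounded_operators_compose resolvent_bounded)
  then have *: "adj (resolvent s) o\<^sub>L (id_blinfun + s) = id_blinfun" using resolvent_props by simp
  have "adj (resolvent s) = adj (resolvent s) o\<^sub>L ((id_blinfun + s) o\<^sub>L resolvent s)"
    using resolvent_props by simp
  also have "\<dots> = resolvent s" by (simp add: * flip: blinfun_compose_assoc)
  finally show ?thesis .
qed

lemma inner_s_commute: "inner (s \<xi>) \<eta> = inner \<xi> (s \<eta>)"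
  using s by (intro inner_selfadjoint) (auto simp: psd_def)

lemma psd_resolvent: "psd (resolvent s)"
  unfolding psd_def
proof (intro conjI allI resolvent_bounded resolvent_adj)
  fix \<xi>
  let ?\<eta> = "resolvent s \<xi>"
  have "inner \<xi> ?\<eta> = inner (?\<eta> + s ?\<eta>) ?\<eta>" by (simp add: resolvent_split)
  also have "\<dots> \<ge> 0" using psd_nonneg[OF s, of ?\<eta>] by (simp add: inner_add_left inner_s_commute)
  finally show "0 \<le> inner \<xi> ?\<eta>" .
qed

lemma psd_id_minus_resolvent: "psd (id_blinfun - resolvent s)"
  unfolding psd_def
proof (intro conjI allI)
  show "id_blinfun - resolvent s \<in> bounded_operators" "adj (id_blinfun - resolvent s) = id_blinfun - resolvent s"
    by (simp_all add: bounded_operators_diff resolvent_bounded resolvent_adj)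
  fix \<xi>
  let ?\<eta> = "resolvent s \<xi>"
  have "inner \<xi> ((id_blinfun - resolvent s) \<xi>) = inner (?\<eta> + s ?\<eta>) (?\<eta> + s ?\<eta> - ?\<eta>)"
    by (simp add: resolvent_split blinfun.diff_left)
  also have "\<dots> \<ge> 0" using psd_nonneg[OF s, of ?\<eta>] by (simp add: inner_add_left)
  finally show "0 \<le> inner \<xi> ((id_blinfun - resolvent s) \<xi>)" .
qed

text \<open>The scalar model is \<open>1 / (1 + s) - (1 - s) = s\<^sup>2 / (1 + s)\<close>. A small
  trace of \<open>s\<close> thus keeps the trace of the resolvent near 1.\<close>

lemma psd_resolvent_lower: "psd (resolvent s - (id_blinfun - s))"
  unfolding psd_def
proof (intro conjI allI)
  show "resolvent s - (id_blinfun - s) \<in> bounded_operators"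
      "adj (resolvent s - (id_blinfun - s)) = resolvent s - (id_blinfun - s)"
    using s by (simp_all add: bounded_operators_diff resolvent_bounded resolvent_adj psd_def)
  fix \<xi>
  let ?\<eta> = "resolvent s \<xi>"
  have "inner \<xi> ((resolvent s - (id_blinfun - s)) \<xi>) =
      inner (?\<eta> + s ?\<eta>) (?\<eta> - ((?\<eta> + s ?\<eta>) - s (?\<eta> + s ?\<eta>)))"
    by (simp add: resolvent_split blinfun.diff_left)
  also have "\<dots> = inner (s ?\<eta>) (s ?\<eta>) + inner (s ?\<eta>) (s (s ?\<eta>))"
    by (simp add: blinfun.add_right inner_add_left inner_add_right inner_diff_right inner_s_commute)
  also have "\<dots> \<ge> 0" using psd_nonneg[OF s] by simp
  finally show "0 \<le> inner \<xi> ((resolvent s - (id_blinfun - s)) \<xi>)" .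
qed

text \<open>For scalars, the convex function \<open>1 / (1 + s)\<close> lies below its chord between
  \<open>s = 0\<close> and \<open>s = 1\<close>; the slope of that chord is the origin of the
  constant 1/2.\<close>

lemma psd_resolvent_upper:
  assumes "psd (id_blinfun - s)"
  shows "psd (id_blinfun - (1/2) *\<^sub>R s - resolvent s)"
  unfolding psd_def
proof (intro conjI allI)
  show "id_blinfun - (1/2) *\<^sub>R s - resolvent s \<in> bounded_operators"
      "adj (id_blinfun - (1/2) *\<^sub>R s - resolvent s) = id_blinfun - (1/2) *\<^sub>R s - resolvent s"
    using s by (simp_all add: bounded_operators_diff bounded_operators_scaleR resolvent_bounded
        resolvent_adj psd_def)
  fix \<xi>
  let ?\<eta> = "resolvent s \<xi>"
  let ?\<zeta> = "s ?\<eta>"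
  have "inner \<xi> ((id_blinfun - (1/2) *\<^sub>R s - resolvent s) \<xi>) =
      inner (?\<eta> + ?\<zeta>) ((?\<eta> + ?\<zeta>) - (1/2) *\<^sub>R s (?\<eta> + ?\<zeta>) - ?\<eta>)"
    by (simp add: resolvent_split blinfun.diff_left blinfun.scaleR_left)
  also have "\<dots> = (1/2) * (inner ?\<eta> ?\<zeta> - inner ?\<zeta> (s ?\<zeta>))"
    by (simp add: blinfun.add_right inner_add_left inner_add_right inner_diff_right
        scaleR_add_right inner_s_commute field_simps)
  also have "\<dots> \<ge> 0"
  proof -
    have "inner ?\<zeta> (s ?\<zeta>) \<le> (norm ?\<zeta>)\<^sup>2" "(norm ?\<zeta>)\<^sup>2 \<le> inner ?\<eta> ?\<zeta>"
      using psd_contraction_norm_square[OF s assms] by blast+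
    then show ?thesis by simp
  qed
  finally show "0 \<le> inner \<xi> ((id_blinfun - (1/2) *\<^sub>R s - resolvent s) \<xi>)" .
qed

end

text \<open>Cauchy-Schwarz for the form of \<open>id_blinfun + a\<close> at \<open>\<zeta>\<close>
  and \<open>\<eta>\<close>, followed by \<open>a \<le> b\<close> at \<open>\<zeta>\<close>, bounds
  \<open>(inner \<zeta> \<xi>)\<^sup>2\<close> by
  \<open>inner \<zeta> \<xi> * inner \<eta> \<xi>\<close>; one factor cancels.\<close>

lemma psd_resolvent_antimono:
  assumes a: "psd a" and b: "psd b" and ab: "psd (b - a)"
  shows "psd (resolvent a - resolvent b)"
  unfolding psd_def
proof (intro conjI allI)
  show "resolvent a - resolvent b \<in> bounded_operators"
      "adj (resolvent a - resolvent b) = resolvent a - resolvent b"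
    by (simp_all add: bounded_operators_diff resolvent_bounded resolvent_adj a b)
  fix \<xi>
  define \<eta> \<zeta> where "\<eta> = resolvent a \<xi>" and "\<zeta> = resolvent b \<xi>"
  have A: "psd (id_blinfun + a)" by (intro psd_add psd_id a)
  have \<xi>a: "(id_blinfun + a) \<eta> = \<xi>" and \<xi>b: "(id_blinfun + b) \<zeta> = \<xi>"
    using resolvent_split[OF a, of \<xi>] resolvent_split[OF b, of \<xi>]
    by (simp_all add: \<eta>_def \<zeta>_def blinfun.add_left)
  have "(inner \<zeta> \<xi>)\<^sup>2 \<le> inner \<zeta> ((id_blinfun + a) \<zeta>) * inner \<eta> \<xi>"
    using psd_cauchy_schwarz[OF A, of \<zeta> \<eta>] by (simp add: \<xi>a)
  also have "\<dots> \<le> inner \<zeta> \<xi> * inner \<eta> \<xi>"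
  proof (rule mult_right_mono)
    show "inner \<zeta> ((id_blinfun + a) \<zeta>) \<le> inner \<zeta> \<xi>"
      using psd_nonneg[OF ab, of \<zeta>]
      by (simp add: blinfun.add_left blinfun.diff_left inner_add_right inner_diff_right flip: \<xi>b)
    show "0 \<le> inner \<eta> \<xi>" using psd_nonneg[OF A, of \<eta>] by (simp add: \<xi>a)
  qed
  finally have "inner \<zeta> \<xi> * inner \<zeta> \<xi> \<le> inner \<zeta> \<xi> * inner \<eta> \<xi>" by (simp add: power2_eq_square)
  moreover have "0 \<le> inner \<zeta> \<xi>" "0 \<le> inner \<eta> \<xi>"
    using psd_nonneg[OF psd_resolvent[OF b], of \<xi>] psd_nonneg[OF psd_resolvent[OF a], of \<xi>]
    by (simp_all add: \<zeta>_def \<eta>_def inner_commute)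
  ultimately have "inner \<zeta> \<xi> \<le> inner \<eta> \<xi>" by (cases "inner \<zeta> \<xi> = 0") auto
  then show "0 \<le> inner \<xi> ((resolvent a - resolvent b) \<xi>)"
    by (simp add: blinfun.diff_left inner_diff_right \<eta>_def \<zeta>_def inner_commute)
qed

section \<open>Isomorphisms of von Neumann algebras\<close>

context von_neumann
begin

lemma resolvent_M: "s \<in> M \<Longrightarrow> psd s \<Longrightarrow> resolvent s \<in> M"
  using resolvent_props[of s] by (auto intro: M_inverse[of "id_blinfun + s", rotated] simp: M_closed)

text \<open>Bounded monotone quadratic forms converge, and a positive operator is determined by its
  quadratic form, so there is only one cluster point. Both directions occur: resolvents of partial
  sums decrease, those of shrinking tails increase.\<close>

lemma weakly_convergent_monotone:
  fixes x :: "nat \<Rightarrow> 'h operator"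
  assumes M: "\<And>n. x n \<in> M" and K: "\<And>n. norm (x n) \<le> K" and x: "\<And>n. psd (x n)"
    and mono: "(\<forall>m n. m \<le> n \<longrightarrow> psd (x n - x m)) \<or> (\<forall>m n. m \<le> n \<longrightarrow> psd (x m - x n))"
  obtains y where "y \<in> M" "norm y \<le> K" "weakly_tendsto x y sequentially" "psd y"
proof -
  have conv: "convergent (\<lambda>n. inner \<xi> (x n \<xi>))" for \<xi>
  proof (rule Bseq_monoseq_convergent)
    have "\<bar>inner \<xi> (x n \<xi>)\<bar> \<le> norm \<xi> * (K * norm \<xi>)" for n
    proof -
      have "\<bar>inner \<xi> (x n \<xi>)\<bar> \<le> norm \<xi> * norm (x n \<xi>)" by (rule Cauchy_Schwarz_ineq2)
      also have "\<dots> \<le> norm \<xi> * (K * norm \<xi>)"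
        by (intro mult_left_mono order_trans[OF norm_blinfun] mult_right_mono K) auto
      finally show ?thesis .
    qed
    then show "Bseq (\<lambda>n. inner \<xi> (x n \<xi>))" by (intro BseqI') auto
    have "psd (x n - x m) \<Longrightarrow> inner \<xi> (x m \<xi>) \<le> inner \<xi> (x n \<xi>)" for m n
      using psd_nonneg[of "x n - x m" \<xi>] by (simp add: blinfun.diff_left inner_diff_right)
    then show "monoseq (\<lambda>n. inner \<xi> (x n \<xi>))" using mono unfolding monoseq_def by blast
  qed
  obtain G y where G: "G \<noteq> bot" "G \<le> sequentially" "y \<in> M" "norm y \<le> K" "weakly_tendsto x y G"
    by (rule M_weak_compactness[where x = x and K = K and F = sequentially]) (use M K in auto)
  have y: "psd y"
    by (rule psd_weak_limit[OF G(5,1)]) (use x G(3) M_bounded in auto)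
  have "weakly_tendsto x y sequentially"
  proof (rule weakly_tendsto_by_subfilters[where K = K])
    fix H z assume H: "H \<noteq> bot" "H \<le> sequentially" "z \<in> bounded_operators" "weakly_tendsto x z H"
    have z: "psd z" by (rule psd_weak_limit[OF H(4,1,3)]) (use x in auto)
    have eq: "inner \<xi> (y \<xi>) = inner \<xi> (z \<xi>)" for \<xi>
    proof -
      obtain l where "(\<lambda>n. inner \<xi> (x n \<xi>)) \<longlonglongrightarrow> l" using conv unfolding convergent_def by blast
      then show ?thesis
        using tendsto_unique[OF G(1) weakly_tendsto_inner[OF G(5)] tendsto_mono[OF G(2)]]
          tendsto_unique[OF H(1) weakly_tendsto_inner[OF H(4)] tendsto_mono[OF H(2)]] by metis
    qed
    show "z = y"
    proof (rule psd_antisym)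
      show "psd (y - z)" "psd (z - y)"
        using y z eq by (auto simp: psd_def bounded_operators_diff blinfun.diff_left inner_diff_right)
    qed
  qed (use M M_bounded K in auto)
  with G y that show ?thesis by blast
qed

context
  fixes \<kappa> :: "'h operator \<Rightarrow> 'h operator"
  assumes iso: "star_iso M M \<kappa>"
begin

lemma iso_M: "x \<in> M \<Longrightarrow> \<kappa> x \<in> M"
  and iso_add: "x \<in> M \<Longrightarrow> y \<in> M \<Longrightarrow> \<kappa> (x + y) = \<kappa> x + \<kappa> y"
  and iso_compose: "x \<in> M \<Longrightarrow> y \<in> M \<Longrightarrow> \<kappa> (x o\<^sub>L y) = \<kappa> x o\<^sub>L \<kappa> y"
  and iso_scaleC: "x \<in> M \<Longrightarrow> \<kappa> (c *\<^sub>O x) = c *\<^sub>O \<kappa> x"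
  and iso_adj: "x \<in> M \<Longrightarrow> \<kappa> (adj x) = adj (\<kappa> x)"
  and iso_bij: "bij_betw \<kappa> M M"
  using iso by (auto simp: star_iso_def star_hom_def)

lemma iso_scaleR: "x \<in> M \<Longrightarrow> \<kappa> (r *\<^sub>R x) = r *\<^sub>R \<kappa> x"
  using iso_scaleC[of x "complex_of_real r"] by (simp add: scaleC_op_of_real)

lemma iso_diff: "x \<in> M \<Longrightarrow> y \<in> M \<Longrightarrow> \<kappa> (x - y) = \<kappa> x - \<kappa> y"
  using iso_add[of x "(-1) *\<^sub>R y"] iso_scaleR[of y "-1"] by (simp add: M_uminus)

lemma iso_inv: "x \<in> M \<Longrightarrow> inv_into M \<kappa> x \<in> M" "x \<in> M \<Longrightarrow> \<kappa> (inv_into M \<kappa> x) = x"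
  "x \<in> M \<Longrightarrow> inv_into M \<kappa> (\<kappa> x) = x"
proof -
  show "inv_into M \<kappa> x \<in> M" if "x \<in> M"
    using bij_betwE[OF bij_betw_inv_into[OF iso_bij]] that by blast
qed (use bij_betw_inv_into_right[OF iso_bij] bij_betw_inv_into_left[OF iso_bij] in auto)

lemma iso_inj: "x \<in> M \<Longrightarrow> y \<in> M \<Longrightarrow> \<kappa> x = \<kappa> y \<Longrightarrow> x = y"
  using iso_bij by (auto simp: bij_betw_def inj_on_def)

text \<open>Preservation of the unit is not part of \<open>star_hom\<close>; it comes from
  surjectivity, by multiplying with a preimage of the unit.\<close>

lemma iso_id [simp]: "\<kappa> id_blinfun = id_blinfun"
proof -
  let ?e = "inv_into M \<kappa> id_blinfun"
  have "\<kappa> (id_blinfun o\<^sub>L ?e) = \<kappa> id_blinfun o\<^sub>L \<kappa> ?e"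
    by (intro iso_compose iso_inv) auto
  then show ?thesis by (simp add: iso_inv)
qed

lemma iso_inverse: "star_iso M M (inv_into M \<kappa>)"
  unfolding star_iso_def star_hom_def
proof (intro conjI ballI allI)
  let ?i = "inv_into M \<kappa>"
  show "bij_betw ?i M M" by (rule bij_betw_inv_into[OF iso_bij])
  show "?i \<in> M \<rightarrow> M" using iso_inv(1) by blast
  have eqI: "?i x = y" if "x \<in> M" "y \<in> M" "\<kappa> y = x" for x y
    using that iso_inv(3) by blast
  fix x y c assume x: "x \<in> M"
  show "?i (c *\<^sub>O x) = c *\<^sub>O ?i x" "?i (adj x) = adj (?i x)"
    using x by (auto intro!: eqI simp: iso_inv iso_scaleC iso_adj M_closed)
  assume y: "y \<in> M"
  show "?i (x + y) = ?i x + ?i y" "?i (x o\<^sub>L y) = ?i x o\<^sub>L ?i y"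
    using x y by (auto intro!: eqI simp: iso_inv iso_add iso_compose M_closed)
qed

text \<open>Invertibility is an algebraic notion, and it detects positivity of self-adjoint elements.\<close>

lemma iso_psd:
  assumes x: "x \<in> M" "psd x"
  shows "psd (\<kappa> x)"
proof (rule psd_if_resolvents)
  show "\<kappa> x \<in> bounded_operators" using x iso_M M_bounded by blast
  show "adj (\<kappa> x) = \<kappa> x" using iso_adj[of x] x by (simp add: psd_def)
  fix e :: real assume e: "e > 0"
  let ?T = "x + e *\<^sub>R id_blinfun"
  have T: "?T \<in> M" by (intro M_closed x)
  have "\<exists>S\<in>bounded_operators. S o\<^sub>L ?T = id_blinfun \<and> ?T o\<^sub>L S = id_blinfun"
  proof (rule coercive_inverse[OF M_bounded[OF T] e])
    show "e * (norm \<xi>)\<^sup>2 \<le> inner \<xi> (?T \<xi>)" for \<xi>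
      using psd_nonneg[OF x(2), of \<xi>]
      by (simp add: blinfun.add_left blinfun.scaleR_left inner_add_right power2_norm_eq_inner)
  qed
  then obtain S where S: "S \<in> M" "S o\<^sub>L ?T = id_blinfun" using M_inverse[OF T] by blast
  have "\<kappa> S o\<^sub>L \<kappa> ?T = id_blinfun" using iso_compose[OF S(1) T] by (simp add: S(2))
  then show "\<exists>S. S o\<^sub>L (\<kappa> x + e *\<^sub>R id_blinfun) = id_blinfun"
    using x by (auto simp: iso_add iso_scaleR M_closed)
qed

lemma iso_norm_le:
  assumes x: "x \<in> M"
  shows "norm (\<kappa> x) \<le> norm x"
proof (rule norm_le_of_psd)
  have "psd (\<kappa> ((norm x)\<^sup>2 *\<^sub>R id_blinfun - (adj x o\<^sub>L x)))"
    by (intro iso_psd psd_id_minus_square M_bounded M_closed x order_refl)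
  then show "psd ((norm x)\<^sup>2 *\<^sub>R id_blinfun - (adj (\<kappa> x) o\<^sub>L \<kappa> x))"
    using x by (simp add: iso_diff iso_scaleR iso_compose iso_adj M_closed)
qed (use x iso_M M_bounded in auto)

end

end

section \<open>Uniqueness of the trace\<close>

context tracial
begin

context
  fixes \<kappa> :: "'h operator \<Rightarrow> 'h operator"
  assumes iso: "star_iso M M \<kappa>"
begin

lemmas \<kappa>_rules = iso_M[OF iso] iso_add[OF iso] iso_diff[OF iso] iso_scaleR[OF iso] iso_compose[OF iso]
  iso_adj[OF iso] iso_scaleC[OF iso]

text \<open>If \<open>\<tau> (w\<^sub>n)\<close> is summable but \<open>\<tau> (\<kappa> w\<^sub>n)\<close> stays large, then the resolvents
  \<open>R\<^sub>n = (1 + \<Sum>\<^bsub>k\<ge>n\<^esub> w\<^sub>k)\<^sup>-\<^sup>1\<close> increase to \<open>1\<close>, while their images stay away from \<open>1\<close>; this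
  contradicts that \<open>\<kappa>\<close> preserves suprema.\<close>

lemma trace_absolutely_continuous:
  assumes e: "e > 0"
  shows "\<exists>d>0. \<forall>w\<in>M. psd w \<longrightarrow> psd (id_blinfun - w) \<longrightarrow> Re (\<tau> w) \<le> d \<longrightarrow> Re (\<tau> (\<kappa> w)) \<le> e"
proof (rule ccontr)
  assume neg: "\<not> ?thesis"
  \<comment> \<open>The thresholds \<open>(1/2) ^ n\<close> are summable, so the tails of the sum of
    the \<open>w n\<close> have small trace.\<close>
  have "\<exists>w\<in>M. psd w \<and> psd (id_blinfun - w) \<and> Re (\<tau> w) \<le> (1/2) ^ n \<and> e < Re (\<tau> (\<kappa> w))" for n :: nat
  proof -
    have "(1/2 :: real) ^ n > 0" by simp
    with neg show ?thesis by (meson not_le)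
  qed
  then obtain w where wM: "\<And>n. w n \<in> M" and w: "\<And>n. psd (w n)" "\<And>n. psd (id_blinfun - w n)"
    and \<tau>w: "\<And>n. Re (\<tau> (w n)) \<le> (1/2) ^ n" and \<kappa>w: "\<And>n. e < Re (\<tau> (\<kappa> (w n)))"
    by metis
  define s where "s n m = (\<Sum>k\<in>{n..<m}. w k)" for n m
  define r where "r n m = resolvent (s n m)" for n m
  have sM: "s n m \<in> M" and s: "psd (s n m)" for n m
    by (auto simp: s_def wM w intro!: M_sum psd_sum)
  have rM: "r n m \<in> M" and r: "psd (r n m)" "psd (id_blinfun - r n m)" for n m
    using sM s by (auto simp: r_def resolvent_M psd_resolvent psd_id_minus_resolvent)
  have smono: "psd (s n' m' - s n m)" if "n' \<le> n" "m \<le> m'" for n m n' m'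
  proof -
    have "s n' m' - s n m = (\<Sum>k\<in>{n'..<m'} - {n..<m}. w k)"
      unfolding s_def using that by (intro sum_diff[symmetric]) auto
    then show ?thesis using w by (simp add: psd_sum)
  qed
  then have rmono: "psd (r n m - r n' m')" if "n' \<le> n" "m \<le> m'" for n m n' m'
    using that unfolding r_def by (intro psd_resolvent_antimono s) auto
  have rnorm: "norm (r n m) \<le> 1" for n m
    by (rule psd_contraction_norm[OF r])
  have "\<exists>R. R \<in> M \<and> norm R \<le> 1 \<and> weakly_tendsto (r n) R sequentially \<and> psd R" for n
    by (rule weakly_convergent_monotone[where x = "r n" and K = 1])
      (use rM rnorm r rmono in auto)
  then obtain R where RM: "\<And>n. R n \<in> M" and Rnorm: "\<And>n. norm (R n) \<le> 1"
    and Rlim: "\<And>n. weakly_tendsto (r n) (R n) sequentially" and R: "\<And>n. psd (R n)"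
    by metis
  have diff_lim: "weakly_tendsto (\<lambda>i. x i - y) (z - y) F"
    if "weakly_tendsto x z F" for x and y z :: "'h operator" and F :: "nat filter"
    using weakly_tendsto_add[OF that weakly_tendsto_const[of "- y"]] by simp
  have diff_lim': "weakly_tendsto (\<lambda>i. y - x i) (y - z) F"
    if "weakly_tendsto x z F" for x and y z :: "'h operator" and F :: "nat filter"
    using weakly_tendsto_add[OF weakly_tendsto_const[of y] weakly_tendsto_scaleC[OF that, of "-1"]]
    by (simp add: scaleC_op_minus1)
  have Rle: "psd (r n m - R n)" for n m
    by (rule psd_weak_limit[OF diff_lim'[OF Rlim[of n]]])
      (use rM RM rmono M_bounded M_diff in \<open>auto intro: eventually_sequentiallyI[of m]\<close>)
  have Rsuc: "psd (R n' - R n)" if "n \<le> n'" for n n'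
  proof -
    have "weakly_tendsto (\<lambda>i. r n' i + (- 1) *\<^sub>O r n i) (R n' + (- 1) *\<^sub>O R n) sequentially"
      by (intro weakly_tendsto_add weakly_tendsto_scaleC Rlim)
    then have "weakly_tendsto (\<lambda>i. r n' i - r n i) (R n' - R n) sequentially"
      by (simp add: scaleC_op_minus1)
    then show ?thesis
      by (rule psd_weak_limit) (use that rmono RM M_bounded M_diff in auto)
  qed
  have R1: "psd (id_blinfun - R n)" for n
    by (intro psd_id_minus R Rnorm)
  have \<tau>R: "1 - 2 * (1/2) ^ n \<le> Re (\<tau> (R n))" for n
  proof -
    have "1 - 2 * (1/2) ^ n \<le> Re (\<tau> (r n m))" for m
    proof -
      have "(\<Sum>k\<in>{n..<m}. Re (\<tau> (w k))) \<le> (\<Sum>k\<in>{n..<m}. (1/2) ^ k)"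
        by (intro sum_mono \<tau>w)
      also have "\<dots> \<le> 2 * (1/2) ^ n"
      proof (induction m)
        case (Suc m)
        have "(\<Sum>k\<in>{n..<m}. (1/2 :: real) ^ k) = 2 * (1/2) ^ n - 2 * (1/2) ^ m" if "n \<le> m"
          using that by (induction rule: dec_induct) auto
        then show ?case by (cases "n \<le> m") auto
      qed simp
      finally have "Re (\<tau> (s n m)) \<le> 2 * (1/2) ^ n" by (simp add: s_def \<tau>_sum wM)
      moreover have "Re (\<tau> (id_blinfun - s n m)) \<le> Re (\<tau> (r n m))"
        unfolding r_def by (intro \<tau>_mono psd_resolvent_lower s M_diff resolvent_M sM M_id)
      ultimately show ?thesis by (simp add: \<tau>_diff sM)
    qed
    moreover have "(\<lambda>m. Re (\<tau> (r n m))) \<longlonglongrightarrow> Re (\<tau> (R n))"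
      by (intro tendsto_Re \<tau>_tendsto[where K = 1] Rlim rM RM rnorm) simp
    ultimately show ?thesis by (meson LIMSEQ_le_const)
  qed
  have \<tau>\<kappa>R: "Re (\<tau> (\<kappa> (R n))) \<le> 1 - e / 2" for n
  proof -
    have "psd (\<kappa> (r n (Suc n) - R n))"
      by (intro iso_psd[OF iso] Rle M_diff rM RM)
    then have "Re (\<tau> (\<kappa> (R n))) \<le> Re (\<tau> (\<kappa> (r n (Suc n))))"
      by (intro \<tau>_mono) (simp_all add: \<kappa>_rules rM RM)
    moreover have "r n (Suc n) = resolvent (w n)" by (simp add: r_def s_def)
    moreover have "psd (\<kappa> (id_blinfun - (1/2) *\<^sub>R w n - resolvent (w n)))"
      by (intro iso_psd[OF iso] psd_resolvent_upper w M_closed resolvent_M wM)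
    then have "Re (\<tau> (\<kappa> (resolvent (w n)))) \<le> Re (\<tau> (id_blinfun - (1/2) *\<^sub>R \<kappa> (w n)))"
      by (intro \<tau>_mono) (simp_all add: \<kappa>_rules iso_id[OF iso] wM w resolvent_M M_closed)
    then have "Re (\<tau> (\<kappa> (resolvent (w n)))) \<le> 1 - Re (\<tau> (\<kappa> (w n))) / 2"
      by (simp add: \<tau>_diff \<tau>_scaleR \<kappa>_rules wM M_closed)
    ultimately show ?thesis using \<kappa>w[of n] by simp
  qed
  obtain T where T: "T \<in> M" "norm T \<le> 1" "weakly_tendsto R T sequentially" "psd T"
    by (rule weakly_convergent_monotone[where x = R and K = 1]) (use RM Rnorm R Rsuc in auto)
  have T1: "psd (id_blinfun - T)" by (intro psd_id_minus T)
  have "(\<lambda>n. Re (\<tau> (R n))) \<longlonglongrightarrow> Re (\<tau> T)"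
    by (intro tendsto_Re \<tau>_tendsto[where K = 1] T RM Rnorm) simp
  moreover have "(\<lambda>n. 1 - 2 * (1/2 :: real) ^ n) \<longlonglongrightarrow> 1 - 2 * 0"
    by (intro tendsto_intros LIMSEQ_realpow_zero) auto
  ultimately have "1 \<le> Re (\<tau> T)" using LIMSEQ_le[of _ 1 _ "Re (\<tau> T)"] \<tau>R by fastforce
  moreover have "0 \<le> Re (\<tau> (id_blinfun - T))" by (intro \<tau>_psd T1 M_closed T)
  ultimately have "Re (\<tau> (id_blinfun - T)) = 0" by (simp add: \<tau>_diff T)
  then have Tid: "T = id_blinfun" using \<tau>_psd(2)[OF _ T1] T by (simp add: M_closed)
  have \<kappa>norm: "norm (\<kappa> (R n)) \<le> 1" for n
    using iso_norm_le[OF iso RM] Rnorm order_trans by blast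
  obtain S where S: "S \<in> M" "norm S \<le> 1" "weakly_tendsto (\<lambda>n. \<kappa> (R n)) S sequentially" "psd S"
  proof (rule weakly_convergent_monotone[where x = "\<lambda>n. \<kappa> (R n)" and K = 1])
    have "psd (\<kappa> (R n) - \<kappa> (R m))" if "m \<le> n" for m n
      using iso_psd[OF iso _ Rsuc[OF that]] by (simp add: \<kappa>_rules RM M_closed)
    then show "(\<forall>m n. m \<le> n \<longrightarrow> psd (\<kappa> (R n) - \<kappa> (R m))) \<or> (\<forall>m n. m \<le> n \<longrightarrow> psd (\<kappa> (R m) - \<kappa> (R n)))"
      by blast
  qed (use RM R \<kappa>norm iso_M[OF iso] iso_psd[OF iso] in auto)
  define S' where "S' = inv_into M \<kappa> S"
  have S': "S' \<in> M" "\<kappa> S' = S" using iso_inv[OF iso] S by (auto simp: S'_def)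
  have "psd (S' - R n)" for n
  proof -
    have "psd (S - \<kappa> (R n))"
    proof (rule psd_weak_limit[OF diff_lim[OF S(3)]])
      have "psd (\<kappa> (R i) - \<kappa> (R n))" if "n \<le> i" for i
        using iso_psd[OF iso _ Rsuc[OF that]] by (simp add: \<kappa>_rules RM M_closed)
      then show "eventually (\<lambda>i. psd (\<kappa> (R i) - \<kappa> (R n))) sequentially"
        by (rule eventually_sequentiallyI)
    qed (use S iso_M[OF iso] RM M_bounded M_diff in auto)
    then have "psd (inv_into M \<kappa> (\<kappa> (S' - R n)))"
      by (intro iso_psd[OF iso_inverse[OF iso]]) (simp_all add: \<kappa>_rules S' RM S M_closed)
    then show ?thesis by (simp add: iso_inv[OF iso] S' RM M_closed)
  qed
  then have "psd (S' - id_blinfun)"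
    using psd_weak_limit[OF diff_lim'[OF T(3)], of S'] S' M_bounded
    by (simp add: Tid bounded_operators_diff)
  then have "psd (\<kappa> (S' - id_blinfun))"
    by (intro iso_psd[OF iso]) (simp_all add: S' M_closed)
  then have "psd (S - id_blinfun)"
    by (simp add: \<kappa>_rules S' iso_id[OF iso])
  moreover have "psd (id_blinfun - S)" by (intro psd_id_minus S)
  ultimately have "S = id_blinfun" by (intro psd_antisym)
  moreover have "(\<lambda>n. Re (\<tau> (\<kappa> (R n)))) \<longlonglongrightarrow> Re (\<tau> S)"
    by (intro tendsto_Re \<tau>_tendsto[where K = 1] S \<kappa>norm) (auto simp: \<kappa>_rules RM)
  ultimately have "1 \<le> 1 - e / 2" using \<tau>\<kappa>R LIMSEQ_le_const2 by fastforce
  with e show False by simp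
qed

lemma trace_continuous_on_balls:
  fixes y :: "nat \<Rightarrow> 'h operator"
  assumes y: "\<And>n. y n \<in> M" and K: "\<And>n. norm (y n) \<le> K" and lim: "(\<lambda>n. q (y n)) \<longlonglongrightarrow> 0"
  shows "(\<lambda>n. Re (\<tau> (\<kappa> (y n)))) \<longlonglongrightarrow> 0"
proof -
  define c where "c = K\<^sup>2 + 1"
  have c: "c > 0" by (simp add: c_def add_nonneg_pos)
  define w where "w n = (1/c) *\<^sub>R (adj (y n) o\<^sub>L y n)" for n
  have wM: "w n \<in> M" for n by (simp add: w_def y M_closed)
  have w: "psd (w n)" for n
    unfolding w_def using c by (intro psd_scaleR psd_adj_compose M_bounded y) simp
  have w1: "psd (id_blinfun - w n)" for n
  proof -
    have "psd ((1/c) *\<^sub>R ((K\<^sup>2 *\<^sub>R id_blinfun - (adj (y n) o\<^sub>L y n)) + id_blinfun))"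
      using c by (intro psd_scaleR psd_add psd_id_minus_square psd_id M_bounded y K) simp
    moreover have "(1/c) *\<^sub>R ((K\<^sup>2 *\<^sub>R id_blinfun - (adj (y n) o\<^sub>L y n)) + id_blinfun) =
        (1/c) *\<^sub>R (c *\<^sub>R id_blinfun) - w n"
      by (simp only: w_def scaleR_diff_right[symmetric]) (simp add: c_def algebra_simps)
    ultimately show ?thesis using c by simp
  qed
  have "(\<lambda>n. Re (\<tau> (\<kappa> (w n)))) \<longlonglongrightarrow> 0"
  proof (rule LIMSEQ_I)
    fix e :: real assume e: "e > 0"
    then obtain d where d: "d > 0"
      "\<And>w. w \<in> M \<Longrightarrow> psd w \<Longrightarrow> psd (id_blinfun - w) \<Longrightarrow> Re (\<tau> w) \<le> d \<Longrightarrow> Re (\<tau> (\<kappa> w)) \<le> e / 2"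
      using trace_absolutely_continuous[of "e / 2"] by auto
    have "c * d > 0" using c d by simp
    from order_tendstoD(2)[OF lim this] obtain N where N: "\<And>n. n \<ge> N \<Longrightarrow> q (y n) < c * d"
      by (auto simp: eventually_sequentially)
    have "norm (Re (\<tau> (\<kappa> (w n))) - 0) < e" if "n \<ge> N" for n
    proof -
      have "Re (\<tau> (w n)) \<le> d"
        using N[OF that] c by (simp add: w_def \<tau>_scaleR y M_closed \<tau>_square field_simps)
      then have "Re (\<tau> (\<kappa> (w n))) \<le> e / 2" by (intro d wM w w1)
      moreover have "0 \<le> Re (\<tau> (\<kappa> (w n)))"
        by (intro \<tau>_psd iso_psd[OF iso] iso_M[OF iso] wM w)
      ultimately show ?thesis using e by simp
    qed
    then show "\<exists>N. \<forall>n\<ge>N. norm (Re (\<tau> (\<kappa> (w n))) - 0) < e" by blast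
  qed
  from tendsto_mult_left[OF this, of c] have "(\<lambda>n. c * Re (\<tau> (\<kappa> (w n)))) \<longlonglongrightarrow> 0" by simp
  moreover have "c * Re (\<tau> (\<kappa> (w n))) = q (\<kappa> (y n))" for n
    using c by (simp add: w_def \<kappa>_rules y M_closed \<tau>_scaleR \<tau>_square)
  ultimately have "(\<lambda>n. q (\<kappa> (y n))) \<longlonglongrightarrow> 0" by simp
  from tendsto_real_sqrt[OF this] have "(\<lambda>n. sqrt (q (\<kappa> (y n)))) \<longlonglongrightarrow> 0" by simp
  then show ?thesis
  proof (rule Lim_null_comparison[rotated], intro always_eventually allI)
    fix n
    have "(Re (\<tau> (\<kappa> (y n))))\<^sup>2 \<le> q (\<kappa> (y n))"
      using q_cauchy_schwarz[OF M_id iso_M[OF iso y[of n]]] by (simp add: q_def)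
    then show "norm (Re (\<tau> (\<kappa> (y n)))) \<le> sqrt (q (\<kappa> (y n)))"
      by (simp add: real_le_rsqrt)
  qed
qed

end

end

context von_neumann
begin

lemma unitary_norm:
  assumes "u \<in> M" "unitary_op u"
  shows "norm u \<le> 1" "norm (adj u) \<le> 1"
proof -
  have u: "u \<in> bounded_operators" "adj u o\<^sub>L u = id_blinfun" using assms by (auto simp: unitary_op_def)
  show "norm u \<le> 1" by (rule norm_le_of_psd) (use u in \<open>auto simp: psd_zero\<close>)
  then show "norm (adj u) \<le> 1" using u by (simp add: norm_adj)
qed

lemma norm_unitary_conj:
  assumes "u \<in> M" "unitary_op u"
  shows "norm (u o\<^sub>L x o\<^sub>L adj u) \<le> norm x" "norm (adj u o\<^sub>L x o\<^sub>L u) \<le> norm x"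
proof -
  have *: "norm (a o\<^sub>L x o\<^sub>L b) \<le> norm x" if "norm a \<le> 1" "norm b \<le> 1" for a b :: "'h operator"
  proof -
    have "norm (a o\<^sub>L x o\<^sub>L b) \<le> norm (a o\<^sub>L x) * norm b" by (rule norm_blinfun_compose)
    also have "\<dots> \<le> (norm a * norm x) * norm b" by (intro mult_right_mono norm_blinfun_compose) simp
    also have "\<dots> \<le> (1 * norm x) * 1" using that by (intro mult_mono) auto
    finally show ?thesis by simp
  qed
  show "norm (u o\<^sub>L x o\<^sub>L adj u) \<le> norm x" "norm (adj u o\<^sub>L x o\<^sub>L u) \<le> norm x"
    using unitary_norm[OF assms] by (auto intro: *)
qed

text \<open>The Cayley transform \<open>u\<close> of \<open>h\<close> is unitary, and \<open>(1 + \<i> h)\<^sup>-\<^sup>1 = (u + 1) / 2\<close>.\<close>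

lemma commutes_selfadjoint_if_commutes_unitaries:
  assumes y: "y \<in> M" and h: "h \<in> M" "adj h = h"
    and comm: "\<And>u. u \<in> M \<Longrightarrow> unitary_op u \<Longrightarrow> y o\<^sub>L u = u o\<^sub>L y"
  shows "y o\<^sub>L h = h o\<^sub>L y"
proof -
  have hb: "h \<in> bounded_operators" by (rule M_bounded[OF h(1)])
  have Im0: "inner \<xi> (c *\<^sub>C h \<xi>) = 0" if "Re c = 0" for \<xi> c
  proof -
    have "cinner \<xi> (h \<xi>) = cnj (cinner \<xi> (h \<xi>))"
      using cinner_adj_left[OF hb, of \<xi> \<xi>] cinner_commute[of "h \<xi>" \<xi>] by (simp add: h)
    then have "Im (cinner \<xi> (h \<xi>)) = 0" by (simp add: complex_eq_iff)
    with that show ?thesis by (simp add: inner_eq_Re_cinner cinner_scaleC_right)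
  qed
  define A where "A c = id_blinfun + c *\<^sub>O h" for c
  have AM: "A c \<in> M" for c by (simp add: A_def h M_closed)
  have A_adj: "adj (A c) = A (cnj c)" for c
    using h by (simp add: A_def bounded_operators_add bounded_operators_scaleC hb)
  have "\<exists>S\<in>M. S o\<^sub>L A c = id_blinfun \<and> A c o\<^sub>L S = id_blinfun" if "Re c = 0" for c
  proof -
    have "\<exists>S\<in>bounded_operators. S o\<^sub>L A c = id_blinfun \<and> A c o\<^sub>L S = id_blinfun"
      by (rule coercive_inverse[where c = 1])
        (use that AM M_bounded Im0 in
          \<open>auto simp: A_def blinfun.add_left inner_add_right power2_norm_eq_inner\<close>)
    then show ?thesis using M_inverse[OF AM] by blast
  qed
  from this[of \<i>] this[of "- \<i>"] obtain S S' where
    S: "S \<in> M" "S o\<^sub>L A \<i> = id_blinfun" "A \<i> o\<^sub>L S = id_blinfun" and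
    S': "S' \<in> M" "S' o\<^sub>L A (- \<i>) = id_blinfun" "A (- \<i>) o\<^sub>L S' = id_blinfun" by auto
  have AA: "A \<i> o\<^sub>L A (- \<i>) = A (- \<i>) o\<^sub>L A \<i>"
    by (rule blinfun_eqI) (simp add: A_def blinfun.add_left blinfun.add_right scaleC_add_right
        bounded_operatorsD[OF hb] scaleC_scaleC)
  have mid: "X o\<^sub>L (Y o\<^sub>L Z) = Z" if "X o\<^sub>L Y = id_blinfun" for X Y Z :: "'h operator"
    using that by (simp flip: blinfun_compose_assoc)
  have adjS: "adj S = S'"
  proof -
    have "adj S o\<^sub>L A (- \<i>) = adj (A \<i> o\<^sub>L S)"
      using A_adj[of \<i>] by (simp add: bounded_operators_compose AM S(1) M_bounded)
    then have "adj S o\<^sub>L A (- \<i>) = id_blinfun" using S by simp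
    then have "adj S o\<^sub>L (A (- \<i>) o\<^sub>L S') = S'" by (rule mid)
    then show ?thesis by (simp add: S')
  qed
  define u where "u = A (- \<i>) o\<^sub>L S"
  have uM: "u \<in> M" by (simp add: u_def AM S M_closed)
  have au: "adj u = S' o\<^sub>L A \<i>"
    using A_adj[of "- \<i>"] by (simp add: u_def bounded_operators_compose AM S M_bounded adjS)
  have SS: "S o\<^sub>L S' = S' o\<^sub>L S"
  proof -
    have "(S o\<^sub>L S') o\<^sub>L (A (- \<i>) o\<^sub>L A \<i>) = S o\<^sub>L (S' o\<^sub>L (A (- \<i>) o\<^sub>L A \<i>))"
      by (simp only: blinfun_compose_assoc)
    then have l: "(S o\<^sub>L S') o\<^sub>L (A (- \<i>) o\<^sub>L A \<i>) = id_blinfun"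
      by (simp only: mid[OF S'(2)] S(2))
    have "(A (- \<i>) o\<^sub>L A \<i>) o\<^sub>L (S' o\<^sub>L S) = A \<i> o\<^sub>L (A (- \<i>) o\<^sub>L (S' o\<^sub>L S))"
      by (simp only: blinfun_compose_assoc flip: AA)
    then have "(A (- \<i>) o\<^sub>L A \<i>) o\<^sub>L (S' o\<^sub>L S) = id_blinfun"
      by (simp only: mid[OF S'(3)] S(3))
    with mid[OF l, of "S' o\<^sub>L S"] show ?thesis by simp
  qed
  have "unitary_op u"
    unfolding unitary_op_def
  proof (intro conjI)
    have "adj u o\<^sub>L u = S' o\<^sub>L ((A \<i> o\<^sub>L A (- \<i>)) o\<^sub>L S)"
      unfolding au by (simp add: u_def blinfun_compose_assoc)
    also have "\<dots> = S' o\<^sub>L (A (- \<i>) o\<^sub>L (A \<i> o\<^sub>L S))" unfolding AA by (simp add: blinfun_compose_assoc)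
    also have "\<dots> = id_blinfun" by (simp add: S S')
    finally show "adj u o\<^sub>L u = id_blinfun" .
    have "u o\<^sub>L adj u = A (- \<i>) o\<^sub>L ((S o\<^sub>L S') o\<^sub>L A \<i>)"
      unfolding au by (simp add: u_def blinfun_compose_assoc)
    also have "\<dots> = A (- \<i>) o\<^sub>L (S' o\<^sub>L (S o\<^sub>L A \<i>))" unfolding SS by (simp add: blinfun_compose_assoc)
    also have "\<dots> = id_blinfun" by (simp add: S S')
    finally show "u o\<^sub>L adj u = id_blinfun" .
  qed (rule M_bounded[OF uM])
  then have yu: "y o\<^sub>L u = u o\<^sub>L y" by (rule comm[OF uM])
  have "A (- \<i>) + A \<i> = 2 *\<^sub>R id_blinfun"
    by (rule blinfun_eqI) (simp add: A_def blinfun.add_left blinfun.scaleR_left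
        scaleR_2 scaleC_zero flip: scaleC_add_left)
  then have "(A (- \<i>) + A \<i>) o\<^sub>L S = 2 *\<^sub>R S" by (simp add: compose_scaleR_left)
  then have Su: "2 *\<^sub>R S = u + id_blinfun" by (simp add: u_def compose_add_left S)
  have "y o\<^sub>L (2 *\<^sub>R S) = (2 *\<^sub>R S) o\<^sub>L y"
    unfolding Su using yu by (simp add: compose_add_left compose_add_right)
  then have yS: "y o\<^sub>L S = S o\<^sub>L y" by (simp add: compose_scaleR_left compose_scaleR_right)
  have "y o\<^sub>L A \<i> = A \<i> o\<^sub>L (S o\<^sub>L y) o\<^sub>L A \<i>"
    by (simp add: S flip: blinfun_compose_assoc)
  also have "\<dots> = A \<i> o\<^sub>L y"
    by (simp add: S blinfun_compose_assoc flip: yS)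
  finally have "\<i> *\<^sub>O (y o\<^sub>L h) = \<i> *\<^sub>O (h o\<^sub>L y)"
    by (simp add: A_def compose_add_left compose_add_right scaleC_op_compose M_bounded[OF y])
  then have "(- \<i>) *\<^sub>C \<i> *\<^sub>C (y (h \<xi>)) = (- \<i>) *\<^sub>C \<i> *\<^sub>C (h (y \<xi>))" for \<xi>
    by (metis scaleC_op_apply blinfun_apply_blinfun_compose)
  then show ?thesis
    by (intro blinfun_eqI) (simp add: scaleC_scaleC scaleC_one)
qed

lemma commutes_if_commutes_unitaries:
  assumes y: "y \<in> M" and x: "x \<in> M"
    and comm: "\<And>u. u \<in> M \<Longrightarrow> unitary_op u \<Longrightarrow> y o\<^sub>L u = u o\<^sub>L y"
  shows "y o\<^sub>L x = x o\<^sub>L y"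
proof -
  have sc: "c *\<^sub>O d *\<^sub>O T = (c * d) *\<^sub>O T" for c d and T :: "'h operator"
    by (rule blinfun_eqI) (simp add: scaleC_scaleC)
  define a b where "a = x + adj x" and "b = \<i> *\<^sub>O (x - adj x)"
  have "(- \<i>) *\<^sub>O (adj x - x) = \<i> *\<^sub>O (x - adj x)"
    using sc[of "- \<i>" "- 1" "x - adj x"] by (simp add: scaleC_op_minus1)
  then have "adj a = a" "adj b = b"
    using x M_bounded
    by (simp_all add: a_def b_def bounded_operators_add bounded_operators_scaleC adj_adj
        bounded_operators_diff adj_bounded add.commute)
  then have "y o\<^sub>L a = a o\<^sub>L y" "y o\<^sub>L b = b o\<^sub>L y"
    using x by (auto simp: a_def b_def M_closed
        intro!: commutes_selfadjoint_if_commutes_unitaries[OF y _ _ comm])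
  moreover have "x = (1/2) *\<^sub>R a + (- \<i> / 2) *\<^sub>O b"
  proof -
    have "(- \<i> / 2) *\<^sub>O b = (1/2) *\<^sub>R (x - adj x)"
      using sc[of "- \<i> / 2" \<i> "x - adj x"] scaleC_op_of_real[of "1/2" "x - adj x"]
      by (simp add: b_def)
    then have "(1/2) *\<^sub>R a + (- \<i> / 2) *\<^sub>O b = (1/2) *\<^sub>R (a + (x - adj x))"
      by (simp add: scaleR_add_right)
    also have "a + (x - adj x) = 2 *\<^sub>R x" by (simp add: a_def scaleR_2)
    finally show ?thesis by simp
  qed
  ultimately show ?thesis
    by (simp add: compose_add_left compose_add_right compose_scaleR_left compose_scaleR_right
        scaleC_op_compose M_bounded[OF y])
qed

end

context tracial
begin

lemma trace_unique_Re:
  assumes fac: "factor M" and iso: "star_iso M M \<kappa>" and x: "x \<in> M"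
  shows "Re (\<tau> (\<kappa> x)) = Re (\<tau> x)"
proof -
  note \<kappa>_rules = iso_M[OF iso] iso_add[OF iso] iso_diff[OF iso] iso_scaleR[OF iso] iso_compose[OF iso]
    iso_adj[OF iso] iso_scaleC[OF iso]
  define O1 where "O1 = {u o\<^sub>L x o\<^sub>L adj u | u. u \<in> M \<and> unitary_op u}"
  define C where "C = convex hull O1"
  define P where "P = {y \<in> M. norm y \<le> norm x \<and> \<tau> y = \<tau> x \<and> \<tau> (\<kappa> y) = \<tau> (\<kappa> x)}"
  have conj_\<tau>: "\<tau> (u o\<^sub>L y o\<^sub>L adj u) = \<tau> y" if "u \<in> M" "adj u o\<^sub>L u = id_blinfun" "y \<in> M" for u y
  proof -
    have "\<tau> (u o\<^sub>L y o\<^sub>L adj u) = \<tau> (adj u o\<^sub>L (u o\<^sub>L y))"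
      using that by (intro \<tau>_commute) (auto simp: M_closed)
    then show ?thesis using that by (simp flip: blinfun_compose_assoc)
  qed
  have "O1 \<subseteq> P"
  proof
    fix y assume "y \<in> O1"
    then obtain u where u: "u \<in> M" "unitary_op u" and y: "y = u o\<^sub>L x o\<^sub>L adj u" by (auto simp: O1_def)
    have uu: "adj u o\<^sub>L u = id_blinfun" using u by (simp add: unitary_op_def)
    then have "adj (\<kappa> u) o\<^sub>L \<kappa> u = id_blinfun"
      using u by (metis iso_adj[OF iso] iso_compose[OF iso] iso_id[OF iso] M_adj)
    then show "y \<in> P"
      using u x uu by (simp add: P_def y M_closed norm_unitary_conj conj_\<tau> \<kappa>_rules)
  qed
  moreover have "convex P"
  proof (rule convexI)
    fix y z and a b :: real
    assume yz: "y \<in> P" "z \<in> P" and ab: "0 \<le> a" "0 \<le> b" "a + b = 1"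
    have "norm (a *\<^sub>R y + b *\<^sub>R z) \<le> a * norm y + b * norm z"
      using ab by (intro order_trans[OF norm_triangle_ineq]) simp
    also have "\<dots> \<le> a * norm x + b * norm x"
      using yz ab by (intro add_mono mult_left_mono) (auto simp: P_def)
    also have "\<dots> = norm x" using ab by (simp flip: distrib_right)
    finally have "norm (a *\<^sub>R y + b *\<^sub>R z) \<le> norm x" .
    moreover have "complex_of_real a * c + complex_of_real b * c = c" for c
      using ab by (simp flip: distrib_right of_real_add)
    ultimately show "a *\<^sub>R y + b *\<^sub>R z \<in> P"
      using yz by (simp add: P_def M_closed \<tau>_add \<tau>_scaleR \<kappa>_rules)
  qed
  ultimately have CP: "C \<subseteq> P" unfolding C_def by (rule hull_minimal)
  then have CM: "C \<subseteq> M" by (auto simp: P_def)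
  have conj_C: "u o\<^sub>L y o\<^sub>L adj u \<in> C" if u: "u \<in> M" "unitary_op u" and y: "y \<in> C" for u y
  proof -
    have "O1 \<subseteq> {y. u o\<^sub>L y o\<^sub>L adj u \<in> C}"
    proof
      fix z assume "z \<in> O1"
      then obtain v where v: "v \<in> M" "unitary_op v" "z = v o\<^sub>L x o\<^sub>L adj v" by (auto simp: O1_def)
      have "unitary_op (u o\<^sub>L v)"
        unfolding unitary_op_def
      proof (intro conjI)
        have *: "adj (u o\<^sub>L v) = adj v o\<^sub>L adj u" using u v by (simp add: adj_compose)
        have "adj (u o\<^sub>L v) o\<^sub>L (u o\<^sub>L v) = adj v o\<^sub>L ((adj u o\<^sub>L u) o\<^sub>L v)"
          by (simp add: * blinfun_compose_assoc)
        then show "adj (u o\<^sub>L v) o\<^sub>L (u o\<^sub>L v) = id_blinfun" using u v by (simp add: unitary_op_def)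
        have "(u o\<^sub>L v) o\<^sub>L adj (u o\<^sub>L v) = u o\<^sub>L ((v o\<^sub>L adj v) o\<^sub>L adj u)"
          by (simp add: * blinfun_compose_assoc)
        then show "(u o\<^sub>L v) o\<^sub>L adj (u o\<^sub>L v) = id_blinfun" using u v by (simp add: unitary_op_def)
      qed (use u v M_bounded M_compose in blast)
      moreover have "u o\<^sub>L z o\<^sub>L adj u = (u o\<^sub>L v) o\<^sub>L x o\<^sub>L adj (u o\<^sub>L v)"
        using u v by (simp add: adj_compose blinfun_compose_assoc)
      ultimately have "u o\<^sub>L z o\<^sub>L adj u \<in> O1" using u v by (auto simp: O1_def M_compose)
      then show "z \<in> {y. u o\<^sub>L y o\<^sub>L adj u \<in> C}" unfolding C_def by (simp add: hull_inc)
    qed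
    moreover have "convex {y. u o\<^sub>L y o\<^sub>L adj u \<in> C}"
      using convex_convex_hull[of O1]
      by (auto simp: convex_def C_def compose_add_left compose_add_right compose_scaleR_left
          compose_scaleR_right)
    ultimately have "C \<subseteq> {y. u o\<^sub>L y o\<^sub>L adj u \<in> C}" unfolding C_def by (rule hull_minimal)
    with y show ?thesis by blast
  qed
  have "x \<in> O1"
    unfolding O1_def by (rule CollectI, rule exI[of _ id_blinfun]) (simp add: unitary_op_def)
  then have "x \<in> C" unfolding C_def by (rule hull_inc)
  then have Cne: "q ` C \<noteq> {}" by blast
  define d where "d = Inf (q ` C)"
  have d: "d \<le> q y" if "y \<in> C" for y
    unfolding d_def using that CM q_nonneg by (intro cInf_lower) (auto intro!: bdd_belowI[of _ 0])
  have "\<exists>y\<in>C. q y < d + 1 / real (Suc n)" for n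
    using cInf_lessD[OF Cne, of "d + 1 / real (Suc n)"] unfolding d_def by auto
  then obtain Y where Y: "\<And>n. Y n \<in> C" "\<And>n. q (Y n) < d + 1 / real (Suc n)" by metis
  have YM: "Y n \<in> M" and Yn: "norm (Y n) \<le> norm x" and Y\<tau>: "\<tau> (Y n) = \<tau> x" "\<tau> (\<kappa> (Y n)) = \<tau> (\<kappa> x)" for n
    using Y(1)[of n] CP by (auto simp: P_def)
  have qdiff: "q (y - z) \<le> 2 * (q y - d) + 2 * (q z - d)" if yz: "y \<in> C" "z \<in> C" for y z
  proof -
    have "(1/2) *\<^sub>R y + (1/2) *\<^sub>R z \<in> C"
      unfolding C_def using yz by (intro convexD[OF convex_convex_hull]) (auto simp: C_def)
    then have "d \<le> q ((1/2) *\<^sub>R (y + z))" using d by (simp add: scaleR_add_right)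
    also have "\<dots> = (1/2)\<^sup>2 * q (y + z)" using yz CM by (intro q_scaleR M_add) auto
    finally have "4 * d \<le> q (y + z)" by (simp add: power2_eq_square)
    moreover have "y \<in> M" "z \<in> M" using yz CM by auto
    ultimately show ?thesis using q_parallelogram[of y z] by simp
  qed
  obtain G y where G: "G \<noteq> bot" "G \<le> sequentially" and yM: "y \<in> M" and lim: "weakly_tendsto Y y G"
    by (rule M_weak_compactness[where x = Y and K = "norm x" and F = sequentially])
      (use YM Yn in auto)
  have inv0: "(\<lambda>n. a / real (Suc n)) \<longlonglongrightarrow> 0" for a
    using tendsto_mult_left[OF LIMSEQ_Suc[OF lim_1_over_n], of a] by (simp add: divide_inverse)
  have Yconj: "y o\<^sub>L u = u o\<^sub>L y" if u: "u \<in> M" "unitary_op u" for u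
  proof -
    have uu: "adj u o\<^sub>L u = id_blinfun" using u by (simp add: unitary_op_def)
    define b where "b n = Y n - (u o\<^sub>L Y n o\<^sub>L adj u)" for n
    define b0 where "b0 = y - (u o\<^sub>L y o\<^sub>L adj u)"
    have bM: "b n \<in> M" "b0 \<in> M" for n using u by (simp_all add: b_def b0_def YM yM M_closed)
    have q_conj: "q (u o\<^sub>L z o\<^sub>L adj u) = q z" if z: "z \<in> M" for z
    proof -
      have "adj (u o\<^sub>L z o\<^sub>L adj u) o\<^sub>L (u o\<^sub>L z o\<^sub>L adj u) = u o\<^sub>L (adj z o\<^sub>L ((adj u o\<^sub>L u) o\<^sub>L z)) o\<^sub>L adj u"
        using u z by (simp add: adj_compose M_closed adj_adj_M blinfun_compose_assoc)
      then show ?thesis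
        using conj_\<tau>[OF u(1) uu, of "adj z o\<^sub>L z"] z by (simp add: q_def uu M_closed)
    qed
    have qb: "q (b n) \<le> 4 / real (Suc n)" for n
    proof -
      have "q (b n) \<le> 2 * (q (Y n) - d) + 2 * (q (Y n) - d)"
        using qdiff[OF Y(1)[of n] conj_C[OF u Y(1)[of n]]] by (simp add: b_def q_conj YM)
      then show ?thesis using Y(2)[of n] by simp
    qed
    have bnorm: "norm (b n) \<le> 2 * norm x" for n
      unfolding b_def using Yn[of n] norm_unitary_conj(1)[OF u, of "Y n"] norm_triangle_ineq4[of "Y n"]
      by (smt (verit))
    have "weakly_tendsto (\<lambda>n. Y n + (-1) *\<^sub>O (u o\<^sub>L Y n o\<^sub>L adj u)) (y + (-1) *\<^sub>O (u o\<^sub>L y o\<^sub>L adj u)) G"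
      by (intro weakly_tendsto_add weakly_tendsto_scaleC weakly_tendsto_compose_right
          weakly_tendsto_compose_left lim M_bounded u)
    then have blim: "weakly_tendsto b b0 G" by (simp add: b_def[abs_def] b0_def scaleC_op_minus1)
    have L: "((\<lambda>n. (Re (\<tau> (adj b0 o\<^sub>L b n)))\<^sup>2) \<longlongrightarrow> (Re (\<tau> (adj b0 o\<^sub>L b0)))\<^sup>2) G"
      by (intro tendsto_power tendsto_Re \<tau>_tendsto_compose[where K = "2 * norm x"] bnorm blim bM G M_adj)
    have L': "((\<lambda>n. q b0 * (4 / real (Suc n))) \<longlongrightarrow> q b0 * 0) G"
      by (intro tendsto_mult tendsto_const tendsto_mono[OF G(2) inv0])
    have le: "(Re (\<tau> (adj b0 o\<^sub>L b n)))\<^sup>2 \<le> q b0 * (4 / real (Suc n))" for n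
      using q_cauchy_schwarz[OF bM(2) bM(1)[of n]] mult_left_mono[OF qb q_nonneg[OF bM(2)], of n]
      by linarith
    have "(q b0)\<^sup>2 \<le> q b0 * 0"
      using tendsto_le[OF G(1) L' L always_eventually] le unfolding q_def[symmetric] by blast
    then have "b0 = 0" using q_zero_imp[OF bM(2)] by simp
    then have "y = u o\<^sub>L y o\<^sub>L adj u" by (simp add: b0_def)
    then have "y o\<^sub>L u = u o\<^sub>L y o\<^sub>L (adj u o\<^sub>L u)" by (metis blinfun_compose_assoc)
    then show ?thesis by (simp add: uu)
  qed
  have "y \<in> commutant M"
    using commutes_if_commutes_unitaries[OF yM _ Yconj] yM M_bounded by (auto simp: commutant_def)
  with yM fac obtain c where c: "y = c *\<^sub>O id_blinfun" by (auto simp: factor_def)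
  have "((\<lambda>n. \<tau> (Y n)) \<longlongrightarrow> \<tau> y) G"
    by (rule \<tau>_tendsto[where K = "norm x"]) (use Yn lim YM yM G in auto)
  then have "\<tau> y = \<tau> x" using tendsto_unique[OF G(1) _ tendsto_const] by (simp add: Y\<tau>)
  then have c\<tau>: "c = \<tau> x" by (simp add: c \<tau>_scaleC)
  define z where "z n = Y n - y" for n
  have zM: "z n \<in> M" for n by (simp add: z_def YM yM M_closed)
  have znorm: "norm (z n) \<le> norm x + norm y" for n
    unfolding z_def using Yn[of n] norm_triangle_ineq4[of "Y n" y] by linarith
  have qz: "q (z n) \<le> 2 / real (Suc n)" for n
  proof -
    have nm: "norm (Y n - Y m) \<le> 2 * norm x" for m
      using Yn[of n] Yn[of m] norm_triangle_ineq4[of "Y n" "Y m"] by linarith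
    have "weakly_tendsto (\<lambda>m. Y n + (-1) *\<^sub>O Y m) (Y n + (-1) *\<^sub>O y) G"
      by (intro weakly_tendsto_add weakly_tendsto_scaleC weakly_tendsto_const lim)
    then have zl: "weakly_tendsto (\<lambda>m. Y n - Y m) (z n) G" by (simp add: z_def scaleC_op_minus1)
    have L: "((\<lambda>m. (Re (\<tau> (adj (z n) o\<^sub>L (Y n - Y m))))\<^sup>2) \<longlongrightarrow> (Re (\<tau> (adj (z n) o\<^sub>L z n)))\<^sup>2) G"
      by (intro tendsto_power tendsto_Re \<tau>_tendsto_compose[where K = "2 * norm x"] nm zl zM G M_adj
          M_diff YM)
    have L': "((\<lambda>m. q (z n) * (2 / real (Suc n) + 2 / real (Suc m))) \<longlongrightarrow>
        q (z n) * (2 / real (Suc n) + 0)) G"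
      by (intro tendsto_mult tendsto_add tendsto_const tendsto_mono[OF G(2) inv0])
    have le: "(Re (\<tau> (adj (z n) o\<^sub>L (Y n - Y m))))\<^sup>2 \<le> q (z n) * (2 / real (Suc n) + 2 / real (Suc m))" for m
    proof -
      have "q (Y n - Y m) \<le> 2 / real (Suc n) + 2 / real (Suc m)"
        using qdiff[OF Y(1)[of n] Y(1)[of m]] Y(2)[of n] Y(2)[of m] by simp
      from mult_left_mono[OF this q_nonneg[OF zM[of n]]] show ?thesis
        using q_cauchy_schwarz[OF zM[of n] M_diff[OF YM YM], of n m] by linarith
    qed
    have "(q (z n))\<^sup>2 \<le> q (z n) * (2 / real (Suc n) + 0)"
      using tendsto_le[OF G(1) L' L always_eventually] le unfolding q_def[symmetric] by blast
    then have "q (z n) * q (z n) \<le> q (z n) * (2 / real (Suc n))" by (simp add: power2_eq_square)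
    then show ?thesis
      using q_nonneg[OF zM[of n]] mult_le_cancel_left_pos[of "q (z n)" "q (z n)" "2 / real (Suc n)"]
      by (cases "q (z n) = 0") (simp_all del: of_nat_Suc)
  qed
  have "(\<lambda>n. q (z n)) \<longlonglongrightarrow> 0"
    by (rule tendsto_sandwich[OF _ _ tendsto_const inv0[of 2]]) (use qz q_nonneg zM in auto)
  then have "(\<lambda>n. Re (\<tau> (\<kappa> (z n)))) \<longlonglongrightarrow> 0"
    by (rule trace_continuous_on_balls[OF iso zM znorm])
  moreover have "\<tau> (\<kappa> (z n)) = \<tau> (\<kappa> x) - \<tau> x" for n
    by (simp add: z_def \<kappa>_rules \<tau>_diff YM yM Y\<tau> c \<tau>_scaleC iso_id[OF iso] M_closed) (simp add: c\<tau>)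
  ultimately show ?thesis by (simp add: LIMSEQ_const_iff)
qed

theorem trace_unique:
  assumes "factor M" "star_iso M M \<kappa>" "x \<in> M"
  shows "\<tau> (\<kappa> x) = \<tau> x"
proof (rule complex_eqI)
  show "Re (\<tau> (\<kappa> x)) = Re (\<tau> x)" by (rule trace_unique_Re[OF assms])
  show "Im (\<tau> (\<kappa> x)) = Im (\<tau> x)"
    using trace_unique_Re[OF assms(1,2) M_scaleC[OF assms(3), of "- \<i>"]] assms(3)
    by (simp add: iso_scaleC[OF assms(2)] iso_M[OF assms(2)] \<tau>_scaleC)
qed

end

section \<open>Limits of inner automorphisms\<close>

context tracial
begin

definition stable :: "(real \<Rightarrow> 'h operator) \<Rightarrow> 'h operator set" where
  "stable W = {c \<in> M. \<exists>d\<in>M. eventually (\<lambda>t. adj (W t) o\<^sub>L c o\<^sub>L W t = d) at_top}"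

definition conj_lim :: "(real \<Rightarrow> 'h operator) \<Rightarrow> 'h operator \<Rightarrow> 'h operator" where
  "conj_lim W x = (SOME y. y \<in> M \<and> weakly_tendsto (\<lambda>t. W t o\<^sub>L x o\<^sub>L adj (W t)) y at_top)"

context
  fixes W :: "real \<Rightarrow> 'h operator"
  assumes WM: "\<And>t. W t \<in> M" and unitary: "\<And>t. unitary_op (W t)"
    and sep: "separating (stable W)"
begin

lemma unitary_cancel:
  "adj (W t) o\<^sub>L W t = id_blinfun" "W t o\<^sub>L adj (W t) = id_blinfun"
  "adj (W t) o\<^sub>L (W t o\<^sub>L x) = x" "W t o\<^sub>L (adj (W t) o\<^sub>L x) = x"
  using unitary[of t] by (simp_all add: unitary_op_def flip: blinfun_compose_assoc)

lemma conj_M: "x \<in> M \<Longrightarrow> W t o\<^sub>L x o\<^sub>L adj (W t) \<in> M"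
  by (intro M_closed WM)

text \<open>By traciality \<open>\<tau> (c W\<^sub>t x W\<^sub>t\<^sup>*) = \<tau> (W\<^sub>t\<^sup>* c W\<^sub>t x)\<close>, which is eventually constant for stable \<open>c\<close>;
  hence weak cluster points are unique.\<close>

lemma conj_lim_exists:
  assumes x: "x \<in> M"
  shows "\<exists>y\<in>M. weakly_tendsto (\<lambda>t. W t o\<^sub>L x o\<^sub>L adj (W t)) y at_top"
proof -
  let ?X = "\<lambda>t. W t o\<^sub>L x o\<^sub>L adj (W t)"
  have XM: "?X t \<in> M" and Xn: "norm (?X t) \<le> norm x" for t
    using conj_M[OF x] norm_unitary_conj[OF WM unitary] by auto
  have cluster: "\<tau> (c o\<^sub>L z) = \<tau> (d o\<^sub>L x)"
    if G: "G \<noteq> bot" "G \<le> at_top" and z: "z \<in> M" "weakly_tendsto ?X z G"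
      and c: "c \<in> M" and d: "eventually (\<lambda>t. adj (W t) o\<^sub>L c o\<^sub>L W t = d) at_top" for G z c d
  proof (rule tendsto_unique[OF G(1)])
    show "((\<lambda>t. \<tau> (c o\<^sub>L ?X t)) \<longlongrightarrow> \<tau> (c o\<^sub>L z)) G"
      by (rule \<tau>_tendsto_compose[where K = "norm x"]) (use Xn XM z G c in auto)
    have "eventually (\<lambda>t. adj (W t) o\<^sub>L c o\<^sub>L W t = d) G" by (rule filter_leD[OF G(2) d])
    then have "eventually (\<lambda>t. \<tau> (c o\<^sub>L ?X t) = \<tau> (d o\<^sub>L x)) G"
    proof eventually_elim
      case (elim t)
      have "\<tau> (c o\<^sub>L ?X t) = \<tau> ((c o\<^sub>L (W t o\<^sub>L x)) o\<^sub>L adj (W t))" by (simp add: blinfun_compose_assoc)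
      also have "\<dots> = \<tau> (adj (W t) o\<^sub>L (c o\<^sub>L (W t o\<^sub>L x)))" by (intro \<tau>_commute M_closed WM c x)
      also have "adj (W t) o\<^sub>L (c o\<^sub>L (W t o\<^sub>L x)) = d o\<^sub>L x" by (simp add: blinfun_compose_assoc flip: elim)
      finally show ?case .
    qed
    then show "((\<lambda>t. \<tau> (c o\<^sub>L ?X t)) \<longlongrightarrow> \<tau> (d o\<^sub>L x)) G" by (rule tendsto_eventually)
  qed
  obtain G y where G: "G \<noteq> bot" "G \<le> at_top" "y \<in> M" "weakly_tendsto ?X y G"
    by (rule M_weak_compactness[where x = ?X and K = "norm x" and F = at_top]) (use XM Xn in auto)
  have "weakly_tendsto ?X y at_top"
  proof (rule weakly_tendsto_by_subfilters[where K = "norm x"])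
    fix H z assume H: "H \<noteq> bot" "H \<le> at_top" "z \<in> bounded_operators" "weakly_tendsto ?X z H"
    have zM: "z \<in> M" by (rule M_weak_limit[OF H(4) XM H(1,3)])
    show "z = y"
    proof (rule separatingD[OF sep _ zM G(3)])
      fix c assume "c \<in> stable W"
      then obtain d where c: "c \<in> M" "eventually (\<lambda>t. adj (W t) o\<^sub>L c o\<^sub>L W t = d) at_top"
        by (auto simp: stable_def)
      show "\<tau> (c o\<^sub>L z) = \<tau> (c o\<^sub>L y)"
        using cluster[OF H(1,2) zM H(4) c] cluster[OF G c] by simp
    qed (auto simp: stable_def)
  qed (use XM M_bounded Xn in auto)
  with G(3) show ?thesis by blast
qed

lemma conj_lim_props:
  "x \<in> M \<Longrightarrow> conj_lim W x \<in> M \<and> weakly_tendsto (\<lambda>t. W t o\<^sub>L x o\<^sub>L adj (W t)) (conj_lim W x) at_top"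
  unfolding conj_lim_def by (rule someI_ex) (use conj_lim_exists in blast)

lemma conj_lim_M: "x \<in> M \<Longrightarrow> conj_lim W x \<in> M"
  and conj_lim_tendsto:
    "x \<in> M \<Longrightarrow> weakly_tendsto (\<lambda>t. W t o\<^sub>L x o\<^sub>L adj (W t)) (conj_lim W x) at_top"
  using conj_lim_props by blast+

lemma conj_lim_eqI:
  assumes "x \<in> M" "weakly_tendsto (\<lambda>t. W t o\<^sub>L x o\<^sub>L adj (W t)) y at_top"
  shows "conj_lim W x = y"
  using weakly_tendsto_unique[OF conj_lim_tendsto[OF assms(1)] assms(2)] by simp

lemma conj_lim_eventually:
  assumes "x \<in> M" "eventually (\<lambda>t. W t o\<^sub>L x o\<^sub>L adj (W t) = y) at_top"
  shows "conj_lim W x = y"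
  using assms weakly_tendsto_cong[OF assms(2), of y] by (intro conj_lim_eqI) (simp_all add: weakly_tendsto_const)

lemma conj_lim_id: "conj_lim W id_blinfun = id_blinfun"
  by (rule conj_lim_eventually) (simp_all add: unitary_cancel)

lemma conj_lim_add:
  assumes "x \<in> M" "y \<in> M"
  shows "conj_lim W (x + y) = conj_lim W x + conj_lim W y"
  using weakly_tendsto_add[OF conj_lim_tendsto conj_lim_tendsto, OF assms]
  by (intro conj_lim_eqI) (simp_all add: assms M_add compose_add_left compose_add_right)

lemma conj_lim_scaleC:
  assumes "x \<in> M"
  shows "conj_lim W (c *\<^sub>O x) = c *\<^sub>O conj_lim W x"
  using weakly_tendsto_scaleC[OF conj_lim_tendsto[OF assms], of c]
  by (intro conj_lim_eqI) (simp_all add: assms M_scaleC scaleC_op_compose M_bounded WM M_closed)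

lemma conj_lim_adj:
  assumes x: "x \<in> M"
  shows "conj_lim W (adj x) = adj (conj_lim W x)"
proof (rule conj_lim_eqI[OF M_adj[OF x]])
  have "weakly_tendsto (\<lambda>t. adj (W t o\<^sub>L x o\<^sub>L adj (W t))) (adj (conj_lim W x)) at_top"
    by (intro weakly_tendsto_adj conj_lim_tendsto M_bounded conj_M conj_lim_M x)
  then show "weakly_tendsto (\<lambda>t. W t o\<^sub>L adj x o\<^sub>L adj (W t)) (adj (conj_lim W x)) at_top"
    by (simp add: adj_compose adj_adj_M WM x M_closed blinfun_compose_assoc)
qed

lemma conj_lim_mult_stable:
  assumes x: "x \<in> stable (\<lambda>t. adj (W t))" and y: "y \<in> M"
  shows "conj_lim W (x o\<^sub>L y) = conj_lim W x o\<^sub>L conj_lim W y"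
proof -
  from x obtain d where xM: "x \<in> M" and d: "d \<in> M" "eventually (\<lambda>t. W t o\<^sub>L x o\<^sub>L adj (W t) = d) at_top"
    by (auto simp: stable_def adj_adj_M WM)
  have "eventually (\<lambda>t. d o\<^sub>L (W t o\<^sub>L y o\<^sub>L adj (W t)) = W t o\<^sub>L (x o\<^sub>L y) o\<^sub>L adj (W t)) at_top"
    using d(2) by eventually_elim (auto simp: blinfun_compose_assoc unitary_cancel)
  from weakly_tendsto_cong[OF this, THEN iffD1,
      OF weakly_tendsto_compose_left[OF conj_lim_tendsto[OF y] M_bounded[OF d(1)]]]
  have "conj_lim W (x o\<^sub>L y) = d o\<^sub>L conj_lim W y"
    by (intro conj_lim_eqI M_compose xM y)
  moreover have "conj_lim W x = d" by (rule conj_lim_eventually[OF xM d(2)])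
  ultimately show ?thesis by simp
qed

end

context
  fixes V :: "real \<Rightarrow> 'h operator"
  assumes VM: "\<And>t. V t \<in> M" and unitary: "\<And>t. unitary_op (V t)"
    and sep1: "separating (stable V)" and sep2: "separating (stable (\<lambda>t. adj (V t)))"
begin

abbreviation (input) "\<theta> \<equiv> conj_lim V"
abbreviation (input) "\<psi> \<equiv> conj_lim (\<lambda>t. adj (V t))"

lemma adj_adj_V: "adj (adj (V t)) = V t"
  by (simp add: adj_adj_M VM)

lemma adj_V: "adj (V t) \<in> M" "unitary_op (adj (V t))"
  using unitary[of t] M_adj[OF VM, of t] by (auto simp: unitary_op_def adj_adj_V M_bounded)

lemmas \<theta> = VM unitary sep1
lemmas \<psi> = adj_V sep2

lemma trace_conj_lim:
  assumes u: "u \<in> M" and y: "y \<in> M"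
  shows "\<tau> (y o\<^sub>L \<theta> u) = \<tau> (u o\<^sub>L \<psi> y)"
proof (rule tendsto_unique[OF trivial_limit_at_top_linorder])
  show "((\<lambda>t. \<tau> (y o\<^sub>L (V t o\<^sub>L u o\<^sub>L adj (V t)))) \<longlongrightarrow> \<tau> (y o\<^sub>L \<theta> u)) at_top"
    by (rule \<tau>_tendsto_compose[where K = "norm u"])
      (use norm_unitary_conj[OF VM unitary] conj_lim_tendsto[OF \<theta> u] conj_lim_M[OF \<theta> u] u y
        conj_M[OF \<theta> u] in auto)
  have "((\<lambda>t. \<tau> (u o\<^sub>L (adj (V t) o\<^sub>L y o\<^sub>L adj (adj (V t))))) \<longlongrightarrow> \<tau> (u o\<^sub>L \<psi> y)) at_top"
    by (rule \<tau>_tendsto_compose[where K = "norm y"])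
      (use norm_unitary_conj[OF adj_V] conj_lim_tendsto[OF \<psi> y] conj_lim_M[OF \<psi> y] u y
        conj_M[OF \<psi> y] in auto)
  moreover have "\<tau> (u o\<^sub>L (adj (V t) o\<^sub>L y o\<^sub>L adj (adj (V t)))) = \<tau> (y o\<^sub>L (V t o\<^sub>L u o\<^sub>L adj (V t)))" for t
    using \<tau>_commute[of "u o\<^sub>L adj (V t)" "y o\<^sub>L V t"] \<tau>_commute[of "y o\<^sub>L (V t o\<^sub>L u)" "adj (V t)"]
    by (simp add: adj_adj_V VM u y M_closed blinfun_compose_assoc)
  ultimately show "((\<lambda>t. \<tau> (y o\<^sub>L (V t o\<^sub>L u o\<^sub>L adj (V t)))) \<longlongrightarrow> \<tau> (u o\<^sub>L \<psi> y)) at_top" by simp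
qed

lemma conj_lim_inverse:
  assumes x: "x \<in> M"
  shows "\<psi> (\<theta> x) = x"
proof (rule separatingD[OF sep2])
  show "\<psi> (\<theta> x) \<in> M" by (intro conj_lim_M[OF \<psi>] conj_lim_M[OF \<theta>] x)
  fix a assume a: "a \<in> stable (\<lambda>t. adj (V t))"
  then have aM: "a \<in> M" by (simp add: stable_def)
  have "\<tau> (a o\<^sub>L \<psi> (\<theta> x)) = \<tau> (\<theta> x o\<^sub>L \<theta> a)"
    by (rule trace_conj_lim[symmetric]) (intro aM conj_lim_M[OF \<theta>] x)+
  also have "\<dots> = \<tau> (\<theta> (a o\<^sub>L x))"
    unfolding conj_lim_mult_stable[OF \<theta> a x]
    by (intro \<tau>_commute conj_lim_M[OF \<theta>] x aM)
  also have "\<dots> = \<tau> (a o\<^sub>L x)"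
    using trace_conj_lim[of "a o\<^sub>L x" id_blinfun] conj_lim_id[OF \<psi>] aM x by (simp add: M_compose)
  finally show "\<tau> (a o\<^sub>L \<psi> (\<theta> x)) = \<tau> (a o\<^sub>L x)" .
qed (auto simp: stable_def x)

end

context
  fixes V :: "real \<Rightarrow> 'h operator"
  assumes VM: "\<And>t. V t \<in> M" and unitary: "\<And>t. unitary_op (V t)"
    and sep1: "separating (stable V)" and sep2: "separating (stable (\<lambda>t. adj (V t)))"
begin

lemma star_iso_conj_lim: "star_iso M M (conj_lim V)"
proof -
  let ?\<theta> = "conj_lim V" and ?\<psi> = "conj_lim (\<lambda>t. adj (V t))"
  have VV: "adj (adj (V t)) = V t" for t by (simp add: adj_adj_M VM)
  have adjV: "adj (V t) \<in> M" "unitary_op (adj (V t))" for t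
    using adj_V[OF VM unitary sep1 sep2] by auto
  note \<theta> = VM unitary sep1 and \<psi> = adjV sep2
  have \<psi>\<theta>: "?\<psi> (?\<theta> x) = x" if "x \<in> M" for x
    using conj_lim_inverse[OF VM unitary sep1 sep2 that] .
  have \<theta>\<psi>: "?\<theta> (?\<psi> x) = x" if "x \<in> M" for x
    using conj_lim_inverse[where V = "\<lambda>t. adj (V t)", OF adjV sep2 _ that] sep1 by (simp add: VV)
  have "?\<theta> (x o\<^sub>L y) = ?\<theta> x o\<^sub>L ?\<theta> y" if x: "x \<in> M" and y: "y \<in> M" for x y
  proof (rule separatingD[OF sep1])
    fix c assume c: "c \<in> stable V"
    then have cM: "c \<in> M" by (simp add: stable_def)
    note tr = trace_conj_lim[OF VM unitary sep1 sep2]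
    note clM = conj_lim_M[OF \<theta>] conj_lim_M[OF \<psi>]
    have "\<tau> (c o\<^sub>L (?\<theta> x o\<^sub>L ?\<theta> y)) = \<tau> (y o\<^sub>L ?\<psi> (c o\<^sub>L ?\<theta> x))"
      using tr[OF y, of "c o\<^sub>L ?\<theta> x"] cM x by (simp add: M_compose clM blinfun_compose_assoc)
    also have "?\<psi> (c o\<^sub>L ?\<theta> x) = ?\<psi> c o\<^sub>L x"
      using conj_lim_mult_stable[OF \<psi>, of c "?\<theta> x"] c x by (simp add: VV clM \<psi>\<theta>)
    also have "\<tau> (y o\<^sub>L (?\<psi> c o\<^sub>L x)) = \<tau> ((x o\<^sub>L y) o\<^sub>L ?\<psi> c)"
      using \<tau>_commute[of "y o\<^sub>L ?\<psi> c" x] x y cM by (simp add: M_compose clM blinfun_compose_assoc)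
    also have "\<dots> = \<tau> (c o\<^sub>L ?\<theta> (x o\<^sub>L y))"
      by (rule tr[symmetric]) (intro M_compose x y cM)+
    finally show "\<tau> (c o\<^sub>L ?\<theta> (x o\<^sub>L y)) = \<tau> (c o\<^sub>L (?\<theta> x o\<^sub>L ?\<theta> y))" by simp
  qed (auto simp: stable_def intro!: conj_lim_M[OF \<theta>] M_compose x y)
  moreover have "bij_betw ?\<theta> M M"
    by (rule bij_betwI[where g = ?\<psi>]) (use conj_lim_M[OF \<theta>] conj_lim_M[OF \<psi>] \<theta>\<psi> \<psi>\<theta> in auto)
  ultimately show ?thesis
    by (auto simp: star_iso_def star_hom_def conj_lim_M[OF \<theta>] conj_lim_add[OF \<theta>]
        conj_lim_scaleC[OF \<theta>] conj_lim_adj[OF \<theta>])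
qed

end

end

section \<open>Cocycle conjugacy\<close>

lemma star_iso_compose:
  assumes "star_iso M N \<theta>" "star_iso N P \<kappa>"
  shows "star_iso M P (\<kappa> \<circ> \<theta>)"
proof -
  have "\<theta> x \<in> N" if "x \<in> M" for x using that assms(1) by (auto simp: star_iso_def star_hom_def)
  then show ?thesis
    using assms bij_betw_trans[of \<theta> M N \<kappa> P] by (auto simp: star_iso_def star_hom_def Pi_iff)
qed

lemma cocycle_conjugate_if_conjugate:
  assumes \<alpha>: "E0_semigroup M \<alpha>" and M: "von_neumann_algebra M" and conj: "conjugate M \<alpha> N \<beta>"
  shows "cocycle_conjugate M \<alpha> N \<beta>"
  unfolding cocycle_conjugate_def
proof (intro exI conjI)
  interpret von_neumann M by unfold_locales (rule M)
  have "\<alpha> s id_blinfun = id_blinfun" if "s \<ge> 0" for s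
    using \<alpha> that by (simp add: E0_semigroup_def normal_unital_endomorphism_def)
  then show "cocycle M \<alpha> (\<lambda>_. id_blinfun)"
    by (simp add: cocycle_def unitary_op_def)
  have "perturbed \<alpha> (\<lambda>_. id_blinfun) = \<alpha>" by (intro ext) (simp add: perturbed_def)
  then show "conjugate M (perturbed \<alpha> (\<lambda>_. id_blinfun)) N \<beta>" using conj by simp
qed

context tracial
begin

lemma star_hom_pres:
  assumes "star_hom M M \<phi>"
  shows "x \<in> M \<Longrightarrow> \<phi> x \<in> M" "x \<in> M \<Longrightarrow> y \<in> M \<Longrightarrow> \<phi> (x o\<^sub>L y) = \<phi> x o\<^sub>L \<phi> y"
    "x \<in> M \<Longrightarrow> \<phi> (adj x) = adj (\<phi> x)"
  using assms by (auto simp: star_hom_def)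

context
  fixes \<alpha> :: "real \<Rightarrow> 'h operator \<Rightarrow> 'h operator" and U :: "real \<Rightarrow> 'h operator"
  assumes \<alpha>: "E0_semigroup M \<alpha>" and U: "cocycle M \<alpha> U"
begin

lemma \<alpha>_hom: "s \<ge> 0 \<Longrightarrow> star_hom M M (\<alpha> s)" and \<alpha>_id: "s \<ge> 0 \<Longrightarrow> \<alpha> s id_blinfun = id_blinfun"
  and \<alpha>_normal: "s \<ge> 0 \<Longrightarrow> continuous_map (ultraweak M) (ultraweak M) (\<alpha> s)"
  using \<alpha> by (auto simp: E0_semigroup_def normal_unital_endomorphism_def)

lemma U_M: "t \<ge> 0 \<Longrightarrow> U t \<in> M" and U_unitary: "t \<ge> 0 \<Longrightarrow> unitary_op (U t)"
  and U_cocycle: "s \<ge> 0 \<Longrightarrow> t \<ge> 0 \<Longrightarrow> U s o\<^sub>L \<alpha> s (U t) = U (s + t)"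
  using U by (auto simp: cocycle_def)

lemma U_cancel:
  assumes "t \<ge> 0"
  shows "adj (U t) o\<^sub>L U t = id_blinfun" "U t o\<^sub>L adj (U t) = id_blinfun"
    "adj (U t) o\<^sub>L (U t o\<^sub>L x) = x" "U t o\<^sub>L (adj (U t) o\<^sub>L x) = x"
  using U_unitary[OF assms] by (simp_all add: unitary_op_def flip: blinfun_compose_assoc)

lemma \<alpha>_U_cancel:
  assumes "s \<ge> 0" "t \<ge> 0"
  shows "adj (\<alpha> s (U t)) o\<^sub>L (\<alpha> s (U t) o\<^sub>L x) = x" "\<alpha> s (U t) o\<^sub>L (adj (\<alpha> s (U t)) o\<^sub>L x) = x"
proof -
  note hom = star_hom_pres[OF \<alpha>_hom[OF assms(1)]]
  have "adj (\<alpha> s (U t)) o\<^sub>L \<alpha> s (U t) = \<alpha> s (adj (U t) o\<^sub>L U t)"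
    "\<alpha> s (U t) o\<^sub>L adj (\<alpha> s (U t)) = \<alpha> s (U t o\<^sub>L adj (U t))"
    using U_M[OF assms(2)] by (simp_all add: hom M_adj)
  then show "adj (\<alpha> s (U t)) o\<^sub>L (\<alpha> s (U t) o\<^sub>L x) = x" "\<alpha> s (U t) o\<^sub>L (adj (\<alpha> s (U t)) o\<^sub>L x) = x"
    by (simp_all add: U_cancel[OF assms(2)] \<alpha>_id[OF assms(1)] flip: blinfun_compose_assoc)
qed

lemma adj_U_add:
  assumes "s \<ge> 0" "t \<ge> 0"
  shows "adj (U (s + t)) = adj (\<alpha> s (U t)) o\<^sub>L adj (U s)"
  using U_cocycle[OF assms] U_M assms star_hom_pres[OF \<alpha>_hom[OF assms(1)]]
  by (simp add: adj_compose flip: U_cocycle)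

text \<open>The cocycle, extended to negative times so that it is unitary throughout.\<close>

definition ray_ext :: "real \<Rightarrow> 'h operator" where "ray_ext t = U (max t 0)"

lemma ray_ext_M: "ray_ext t \<in> M" and ray_ext_unitary: "unitary_op (ray_ext t)"
  by (simp_all add: ray_ext_def U_M U_unitary)

lemma eventually_ray_ext:
  assumes s: "s \<ge> 0" and P: "\<And>v. v \<ge> 0 \<Longrightarrow> P (U (s + v))"
  shows "eventually (\<lambda>t. P (ray_ext t)) at_top"
  using eventually_ge_at_top[of s]
proof eventually_elim
  case (elim t)
  with s have "ray_ext t = U (s + (t - s))" by (simp add: ray_ext_def)
  with P[of "t - s"] elim show ?case by simp
qed

lemma stable_relcomm:
  "(\<Union>s\<in>{0..}. commutant (\<alpha> s ` M) \<inter> M) \<subseteq> stable (\<lambda>t. adj (ray_ext t))"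
proof
  fix x assume "x \<in> (\<Union>s\<in>{0..}. commutant (\<alpha> s ` M) \<inter> M)"
  then obtain s where s: "s \<ge> 0" and x: "x \<in> M" "\<And>y. y \<in> M \<Longrightarrow> x o\<^sub>L \<alpha> s y = \<alpha> s y o\<^sub>L x"
    by (auto simp: commutant_def)
  have "eventually (\<lambda>t. ray_ext t o\<^sub>L x o\<^sub>L adj (ray_ext t) = U s o\<^sub>L x o\<^sub>L adj (U s)) at_top"
  proof (rule eventually_ray_ext[OF s])
    fix v :: real assume v: "v \<ge> 0"
    have "U (s + v) o\<^sub>L x o\<^sub>L adj (U (s + v)) =
        U s o\<^sub>L ((\<alpha> s (U v) o\<^sub>L x) o\<^sub>L (adj (\<alpha> s (U v)) o\<^sub>L adj (U s)))"
      unfolding adj_U_add[OF s v] by (simp add: blinfun_compose_assoc flip: U_cocycle[OF s v])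
    also have "\<dots> = U s o\<^sub>L x o\<^sub>L adj (U s)"
      unfolding x(2)[OF U_M[OF v], symmetric]
      by (simp add: blinfun_compose_assoc \<alpha>_U_cancel[OF s v])
    finally show "U (s + v) o\<^sub>L x o\<^sub>L adj (U (s + v)) = U s o\<^sub>L x o\<^sub>L adj (U s)" .
  qed
  then show "x \<in> stable (\<lambda>t. adj (ray_ext t))"
    using x(1) s by (auto simp: stable_def adj_adj_M ray_ext_M intro!: bexI[of _ "U s o\<^sub>L x o\<^sub>L adj (U s)"] M_closed U_M)
qed

lemma perturbed_M: "s \<ge> 0 \<Longrightarrow> x \<in> M \<Longrightarrow> perturbed \<alpha> U s x \<in> M"
  by (simp add: perturbed_def M_closed U_M star_hom_pres(1)[OF \<alpha>_hom])

lemma stable_relcomm_perturbed: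
  "(\<Union>s\<in>{0..}. commutant (perturbed \<alpha> U s ` M) \<inter> M) \<subseteq> stable ray_ext"
proof
  fix c assume "c \<in> (\<Union>s\<in>{0..}. commutant (perturbed \<alpha> U s ` M) \<inter> M)"
  then obtain s where s: "s \<ge> 0" and c: "c \<in> M"
    "\<And>y. y \<in> M \<Longrightarrow> c o\<^sub>L perturbed \<alpha> U s y = perturbed \<alpha> U s y o\<^sub>L c"
    by (auto simp: commutant_def)
  define x where "x = adj (U s) o\<^sub>L c o\<^sub>L U s"
  have x: "x o\<^sub>L \<alpha> s y = \<alpha> s y o\<^sub>L x" if "y \<in> M" for y
  proof -
    have "x o\<^sub>L \<alpha> s y = adj (U s) o\<^sub>L (c o\<^sub>L perturbed \<alpha> U s y) o\<^sub>L U s"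
      by (simp add: x_def perturbed_def blinfun_compose_assoc U_cancel[OF s])
    also have "\<dots> = \<alpha> s y o\<^sub>L x"
      unfolding c(2)[OF that] by (simp add: x_def perturbed_def blinfun_compose_assoc U_cancel[OF s])
    finally show ?thesis .
  qed
  have "eventually (\<lambda>t. adj (ray_ext t) o\<^sub>L c o\<^sub>L ray_ext t = x) at_top"
  proof (rule eventually_ray_ext[OF s])
    fix v :: real assume v: "v \<ge> 0"
    have "adj (U (s + v)) o\<^sub>L c o\<^sub>L U (s + v) = adj (\<alpha> s (U v)) o\<^sub>L (x o\<^sub>L \<alpha> s (U v))"
      unfolding adj_U_add[OF s v] by (simp add: x_def blinfun_compose_assoc flip: U_cocycle[OF s v])
    also have "\<dots> = x" unfolding x[OF U_M[OF v]] by (simp add: \<alpha>_U_cancel[OF s v])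
    finally show "adj (U (s + v)) o\<^sub>L c o\<^sub>L U (s + v) = x" .
  qed
  then show "c \<in> stable ray_ext"
    using c(1) s by (auto simp: stable_def x_def intro!: bexI[of _ x] M_closed U_M)
qed

lemma conjugate_perturbed:
  assumes sep: "separating (\<Union>s\<in>{0..}. commutant (\<alpha> s ` M) \<inter> M)"
    "separating (\<Union>s\<in>{0..}. commutant (perturbed \<alpha> U s ` M) \<inter> M)"
  shows "\<exists>\<theta>. star_iso M M \<theta> \<and> (\<forall>s\<ge>0. \<forall>x\<in>M. \<theta> (\<alpha> s x) = perturbed \<alpha> U s (\<theta> x))"
proof (intro exI conjI allI impI ballI)
  have sep': "separating (stable ray_ext)" "separating (stable (\<lambda>t. adj (ray_ext t)))"
    using separating_mono[OF sep(1) stable_relcomm] separating_mono[OF sep(2) stable_relcomm_perturbed]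
    by auto
  note \<theta> = ray_ext_M ray_ext_unitary sep'(1)
  show "star_iso M M (conj_lim ray_ext)" by (rule star_iso_conj_lim[OF ray_ext_M ray_ext_unitary sep'])
  fix s :: real and x assume s: "s \<ge> 0" and x: "x \<in> M"
  note hom = star_hom_pres[OF \<alpha>_hom[OF s]]
  let ?X = "\<lambda>t. ray_ext t o\<^sub>L x o\<^sub>L adj (ray_ext t)"
  have XM: "?X t \<in> M" and Xn: "norm (?X t) \<le> norm x" for t
    using ray_ext_M x norm_unitary_conj[OF ray_ext_M ray_ext_unitary] by (auto intro!: M_closed)
  have "limitin (ultraweak M) (\<alpha> s \<circ> ?X) (\<alpha> s (conj_lim ray_ext x)) at_top"
    by (intro continuous_map_limit[OF \<alpha>_normal[OF s] limitin_ultraweak[where K = "norm x"]])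
      (use XM Xn conj_lim_tendsto[OF \<theta> x] conj_lim_M[OF \<theta> x] in auto)
  then have "weakly_tendsto (\<alpha> s \<circ> ?X) (\<alpha> s (conj_lim ray_ext x)) at_top"
    by (rule weakly_tendsto_limitin) (simp add: hom XM)
  then have "weakly_tendsto (\<lambda>t. U s o\<^sub>L \<alpha> s (?X t) o\<^sub>L adj (U s)) (perturbed \<alpha> U s (conj_lim ray_ext x)) at_top"
    unfolding perturbed_def o_def
    by (intro weakly_tendsto_compose_left weakly_tendsto_compose_right M_bounded U_M s)
  moreover have "eventually (\<lambda>t. U s o\<^sub>L \<alpha> s (?X t) o\<^sub>L adj (U s) = ray_ext (s + t) o\<^sub>L \<alpha> s x o\<^sub>L adj (ray_ext (s + t))) at_top"
    using eventually_ge_at_top[of 0]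
  proof eventually_elim
    case (elim t)
    have "ray_ext (s + t) = U s o\<^sub>L \<alpha> s (U t)" "adj (ray_ext (s + t)) = adj (\<alpha> s (U t)) o\<^sub>L adj (U s)"
      using elim s U_cocycle[OF s elim] adj_U_add[OF s elim] by (simp_all add: ray_ext_def)
    then show ?case
      using elim x by (simp add: ray_ext_def hom U_M M_closed blinfun_compose_assoc)
  qed
  ultimately have "weakly_tendsto (\<lambda>t. ray_ext (s + t) o\<^sub>L \<alpha> s x o\<^sub>L adj (ray_ext (s + t)))
      (perturbed \<alpha> U s (conj_lim ray_ext x)) at_top"
    by (rule weakly_tendsto_cong[THEN iffD1, rotated])
  moreover have "weakly_tendsto (\<lambda>t. ray_ext (s + t) o\<^sub>L \<alpha> s x o\<^sub>L adj (ray_ext (s + t))) (conj_lim ray_ext (\<alpha> s x)) at_top"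
    by (intro weakly_tendsto_filterlim[OF conj_lim_tendsto[OF \<theta> hom(1)[OF x]]]
        filterlim_tendsto_add_at_top[OF tendsto_const] filterlim_ident)
  ultimately show "conj_lim ray_ext (\<alpha> s x) = perturbed \<alpha> U s (conj_lim ray_ext x)"
    using weakly_tendsto_unique by (metis trivial_limit_at_top_linorder)
qed

end

lemma conjugate_if_cocycle_conjugate:
  assumes fac: "factor M" and \<alpha>: "E0_semigroup M \<alpha>"
    and sep\<alpha>: "separating (\<Union>s\<in>{0..}. commutant (\<alpha> s ` M) \<inter> M)"
    and sep\<beta>: "separating (\<Union>s\<in>{0..}. commutant (\<beta> s ` M) \<inter> M)"
    and conj: "cocycle_conjugate M \<alpha> M \<beta>"
  shows "conjugate M \<alpha> M \<beta>"
proof -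
  obtain U \<kappa> where U: "cocycle M \<alpha> U" and iso: "star_iso M M \<kappa>"
    and \<beta>: "\<And>t y. t \<ge> 0 \<Longrightarrow> y \<in> M \<Longrightarrow> \<beta> t y = \<kappa> (perturbed \<alpha> U t (inv_into M \<kappa> y))"
    using conj by (auto simp: cocycle_conjugate_def conjugate_def)
  note inv = iso_inv[OF iso] iso_M[OF iso]
  define C where "C = (\<Union>s\<in>{0..}. commutant (perturbed \<alpha> U s ` M) \<inter> M)"
  have "separating C"
    unfolding separating_def
  proof (intro ballI impI)
    fix x assume x: "x \<in> M" and zero: "\<forall>c\<in>C. \<tau> (c o\<^sub>L x) = 0"
    have "\<kappa> x = 0"
    proof (rule sep\<beta>[unfolded separating_def, rule_format, OF iso_M[OF iso x]])
      fix b assume "b \<in> (\<Union>s\<in>{0..}. commutant (\<beta> s ` M) \<inter> M)"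
      then obtain s where s: "s \<ge> 0" and b: "b \<in> M" "\<And>y. y \<in> M \<Longrightarrow> b o\<^sub>L \<beta> s y = \<beta> s y o\<^sub>L b"
        by (auto simp: commutant_def)
      let ?c = "inv_into M \<kappa> b"
      have "?c o\<^sub>L perturbed \<alpha> U s y = perturbed \<alpha> U s y o\<^sub>L ?c" if y: "y \<in> M" for y
      proof (rule iso_inj[OF iso])
        have p: "perturbed \<alpha> U s y \<in> M" by (rule perturbed_M[OF \<alpha> U s y])
        then show "?c o\<^sub>L perturbed \<alpha> U s y \<in> M" "perturbed \<alpha> U s y o\<^sub>L ?c \<in> M"
          using inv b by (auto intro!: M_compose)
        have "\<beta> s (\<kappa> y) = \<kappa> (perturbed \<alpha> U s y)" using \<beta>[OF s, of "\<kappa> y"] y inv by simp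
        then show "\<kappa> (?c o\<^sub>L perturbed \<alpha> U s y) = \<kappa> (perturbed \<alpha> U s y o\<^sub>L ?c)"
          using b(2)[of "\<kappa> y"] b(1) y p inv by (simp add: iso_compose[OF iso])
      qed
      then have "?c \<in> C" using s inv b(1) M_bounded by (auto simp: C_def commutant_def)
      with zero have "\<tau> (?c o\<^sub>L x) = 0" by blast
      moreover have "\<tau> (\<kappa> (?c o\<^sub>L x)) = \<tau> (?c o\<^sub>L x)"
        using inv b x by (intro trace_unique[OF fac iso] M_compose) auto
      ultimately show "\<tau> (b o\<^sub>L \<kappa> x) = 0" using inv b x by (simp add: iso_compose[OF iso])
    qed
    then show "x = 0" using iso_inj[OF iso x M_zero] iso_diff[OF iso x x] by simp
  qed
  then obtain \<theta> where \<theta>: "star_iso M M \<theta>"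
    and twine: "\<And>s x. s \<ge> 0 \<Longrightarrow> x \<in> M \<Longrightarrow> \<theta> (\<alpha> s x) = perturbed \<alpha> U s (\<theta> x)"
    using conjugate_perturbed[OF \<alpha> U sep\<alpha>] by (auto simp: C_def)
  have iso': "star_iso M M (\<kappa> \<circ> \<theta>)" by (rule star_iso_compose[OF \<theta> iso])
  have "\<beta> t y = (\<kappa> \<circ> \<theta>) (\<alpha> t (inv_into M (\<kappa> \<circ> \<theta>) y))" if t: "t \<ge> 0" and y: "y \<in> M" for t y
  proof -
    let ?x = "inv_into M (\<kappa> \<circ> \<theta>) y"
    have x: "?x \<in> M" "\<kappa> (\<theta> ?x) = y" using iso_inv[OF iso', of y] y by auto
    then have "inv_into M \<kappa> y = \<theta> ?x" using inv(3)[OF iso_M[OF \<theta> x(1)]] by simp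
    then show ?thesis using \<beta>[OF t y] twine[OF t x(1)] by simp
  qed
  with iso' show ?thesis by (auto simp: conjugate_def)
qed

end

theorem corollary9p5:
  fixes M :: "'h::complex_hilbert_space operator set"
    and \<alpha> \<beta> :: "real \<Rightarrow> 'h operator \<Rightarrow> 'h operator"
  assumes "II1_factor M"
    and "E0_semigroup M \<alpha>" and "E0_semigroup M \<beta>"
    and "ultraweak M closure_of relcomm_algebra M \<alpha> = M"
    and "ultraweak M closure_of relcomm_algebra M \<beta> = M"
  shows "cocycle_conjugate M \<alpha> M \<beta> \<longleftrightarrow> conjugate M \<alpha> M \<beta>"
proof -
  have fac: "factor M" and M: "von_neumann_algebra M"
    using assms(1) by (auto simp: II1_factor_def factor_def)
  obtain \<tau> where "faithful_normal_tracial_state M \<tau>"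
    using assms(1) by (auto simp: II1_factor_def)
  then interpret tracial M \<tau>
    using M by unfold_locales
  have "separating (\<Union>s\<in>{0..}. commutant (\<alpha> s ` M) \<inter> M)"
    "separating (\<Union>s\<in>{0..}. commutant (\<beta> s ` M) \<inter> M)"
    using assms(4,5) by (auto simp: relcomm_algebra_def intro!: separating_dense)
  then show ?thesis
    using conjugate_if_cocycle_conjugate[OF fac assms(2)] cocycle_conjugate_if_conjugate[OF assms(2) M]
    by blast
qed

end
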